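(* Let $\mathscr{A}$ be an abelian category with enough projective objects and let $Q=(Q_0,Q_1)$ be a finite acyclic quiver. Let $\mathscr{T}$ be a support $\tau$-tilting subcategory of $\mathscr{A}$ such that $\mathrm{Fac}(\mathscr{T})$ is closed with respect to kernels of epimorphisms. Then \[\mathbb{T}=\mathrm{add}\{e_i^{\rho}(T)\mid i\in Q_0,\ T\in\mathscr{T}\}\] is a support $\tau$-tilting subcategory of $\mathrm{Rep}(Q,\mathscr{A})$.
   Context: Subcategories are full and closed under isomorphisms. $\mathrm{add}$ of a family of objects is the full subcategory of direct summands of finite direct sums of members of the family. $\mathrm{Fac}(\mathscr{X})$ is the full subcategory of all quotients of objects of $\mathscr{X}$ (for a single object $T$, quotients of finite direct sums of copies of $T$). $\mathrm{Fac}(\mathscr{T})$ is closed with respect to kernels of epimorphisms if the kernel of any epimorphism between objects of $\mathrm{Fac}(\mathscr{T})$ lies in $\mathrm{Fac}(\mathscr{T})$. A left $\mathscr{X}$-approximation of $A$ is a morphism $f:A\to X$ with $X\in\mathscr{X}$ such that every morphism $A\to X'$ with $X'\in\mathscr{X}$ factors through $f$; right approximations are dual; $\mathscr{X}$ is contravariantly finite if every object has a right $\mathscr{X}$-approximation. Support $\tau$-tilting subcategory of an abelian category $\mathscr{A}$ with enough projectives: an additive full subcategory $\mathscr{T}$ (closed under finite direct sums and direct summands), contravariantly finite in $\mathscr{A}$, such that (i) $\mathrm{Ext}^1_{\mathscr{A}}(T_1,\mathrm{Fac}(T_2))=0$ for all $T_1,T_2\in\mathscr{T}$; (ii) for every projective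 $P$ in $\mathscr{A}$ there is an exact sequence $P\xrightarrow{f}T^0\to T^1\to0$ with $T^0,T^1\in\mathscr{T}$ and $f$ a left $\mathscr{T}$-approximation of $P$. $\mathrm{Rep}(Q,\mathscr{A})$ is the category of representations of $Q$ in $\mathscr{A}$: an object $X$ assigns to each vertex $i$ an object $X_i$ and to each arrow $\alpha:i\to j$ a morphism $X_\alpha:X_i\to X_j$; morphisms are families $(\varphi_i)_{i\in Q_0}$ commuting with the $X_\alpha$. It is abelian with enough projective objects, with kernels and cokernels computed vertexwise. The functor $e_i^{\rho}:\mathscr{A}\to\mathrm{Rep}(Q,\mathscr{A})$ is the right adjoint of the evaluation functor $e_i:X\mapsto X_i$; explicitly $e_i^{\rho}(A)_j=\bigoplus_{Q(j,i)}A$, where $Q(j,i)$ is the set of paths from $j$ to $i$, with structure morphisms the natural projections. *)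

theory Defs
  imports "HOL-Algebra.FiniteProduct" "HOL-Library.FuncSet" "Graph_Theory.Arc_Walk"
begin

section \<open>Preadditive and abelian categories\<close>

text \<open>
  Morphisms are given by Hom-sets indexed by pairs of objects.  The Hom-sets need not be disjoint
  (in \<open>Rep\<close> below they are not), but composition and addition do not mention the objects;
  tagging each morphism with its domain and codomain brings every category into this form.
\<close>

record ('o, 'm) preadd_cat =
  Obj :: "'o set"
  Hom :: "'o \<Rightarrow> 'o \<Rightarrow> 'm set"
  Ident :: "'o \<Rightarrow> 'm"
  Compose :: "'m \<Rightarrow> 'm \<Rightarrow> 'm"  (infixr "\<cdot>\<index>" 70)
  Plus :: "'m \<Rightarrow> 'm \<Rightarrow> 'm"
  Zero :: "'o \<Rightarrow> 'o \<Rightarrow> 'm"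

definition hom_group :: "('o, 'm) preadd_cat \<Rightarrow> 'o \<Rightarrow> 'o \<Rightarrow> 'm monoid" where
  "hom_group C X Y = \<lparr>carrier = Hom C X Y, mult = Plus C, one = Zero C X Y\<rparr>"

text \<open>The sum of a finite family of parallel morphisms (\<open>finprod\<close> because
  \<open>hom_group\<close> is a multiplicatively written monoid record).\<close>

definition hom_sum :: "('o, 'm) preadd_cat \<Rightarrow> 'o \<Rightarrow> 'o \<Rightarrow> ('i \<Rightarrow> 'm) \<Rightarrow> 'i set \<Rightarrow> 'm" where
  "hom_sum C X Y f I = finprod (hom_group C X Y) f I"

locale preadditive_category =
  fixes C :: "('o, 'm) preadd_cat" (structure)
  assumes ident_closed: "X \<in> Obj C \<Longrightarrow> Ident C X \<in> Hom C X X"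
    and comp_closed: "\<lbrakk>X \<in> Obj C; Y \<in> Obj C; Z \<in> Obj C; f \<in> Hom C X Y; g \<in> Hom C Y Z\<rbrakk>
      \<Longrightarrow> g \<cdot> f \<in> Hom C X Z"
    and ident_left: "\<lbrakk>X \<in> Obj C; Y \<in> Obj C; f \<in> Hom C X Y\<rbrakk> \<Longrightarrow> Ident C Y \<cdot> f = f"
    and ident_right: "\<lbrakk>X \<in> Obj C; Y \<in> Obj C; f \<in> Hom C X Y\<rbrakk> \<Longrightarrow> f \<cdot> Ident C X = f"
    and comp_assoc: "\<lbrakk>W \<in> Obj C; X \<in> Obj C; Y \<in> Obj C; Z \<in> Obj C;
        f \<in> Hom C W X; g \<in> Hom C X Y; h \<in> Hom C Y Z\<rbrakk> \<Longrightarrow> (h \<cdot> g) \<cdot> f = h \<cdot> (g \<cdot> f)"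
    and hom_comm_group: "\<lbrakk>X \<in> Obj C; Y \<in> Obj C\<rbrakk> \<Longrightarrow> comm_group (hom_group C X Y)"
    and comp_plus_left: "\<lbrakk>X \<in> Obj C; Y \<in> Obj C; Z \<in> Obj C; f \<in> Hom C X Y;
        g \<in> Hom C Y Z; h \<in> Hom C Y Z\<rbrakk> \<Longrightarrow> Plus C g h \<cdot> f = Plus C (g \<cdot> f) (h \<cdot> f)"
    and comp_plus_right: "\<lbrakk>X \<in> Obj C; Y \<in> Obj C; Z \<in> Obj C; f \<in> Hom C X Y;
        g \<in> Hom C X Y; h \<in> Hom C Y Z\<rbrakk> \<Longrightarrow> h \<cdot> Plus C f g = Plus C (h \<cdot> f) (h \<cdot> g)"

definition direct_sum ::
  "('o, 'm) preadd_cat \<Rightarrow> 'i set \<Rightarrow> ('i \<Rightarrow> 'o) \<Rightarrow> 'o \<Rightarrow> ('i \<Rightarrow> 'm) \<Rightarrow> ('i \<Rightarrow> 'm) \<Rightarrow> bool" where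
  "direct_sum C I X S inc prj \<longleftrightarrow>
     finite I \<and> S \<in> Obj C \<and>
     (\<forall>k\<in>I. X k \<in> Obj C \<and> inc k \<in> Hom C (X k) S \<and> prj k \<in> Hom C S (X k)) \<and>
     (\<forall>k\<in>I. \<forall>l\<in>I. prj k \<cdot>\<^bsub>C\<^esub> inc l = (if k = l then Ident C (X k) else Zero C (X l) (X k))) \<and>
     hom_sum C S S (\<lambda>k. inc k \<cdot>\<^bsub>C\<^esub> prj k) I = Ident C S"

text \<open>For \<open>Xs = []\<close> this says that \<open>S\<close> is a zero object.\<close>

definition is_dsum :: "('o, 'm) preadd_cat \<Rightarrow> 'o list \<Rightarrow> 'o \<Rightarrow> bool" where
  "is_dsum C Xs S \<longleftrightarrow> (\<exists>inc prj. direct_sum C {..<length Xs} (\<lambda>k. Xs ! k) S inc prj)"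

definition monic :: "('o, 'm) preadd_cat \<Rightarrow> 'o \<Rightarrow> 'o \<Rightarrow> 'm \<Rightarrow> bool" where
  "monic C X Y f \<longleftrightarrow> X \<in> Obj C \<and> Y \<in> Obj C \<and> f \<in> Hom C X Y \<and>
     (\<forall>W\<in>Obj C. \<forall>g\<in>Hom C W X. \<forall>h\<in>Hom C W X. f \<cdot>\<^bsub>C\<^esub> g = f \<cdot>\<^bsub>C\<^esub> h \<longrightarrow> g = h)"

definition epic :: "('o, 'm) preadd_cat \<Rightarrow> 'o \<Rightarrow> 'o \<Rightarrow> 'm \<Rightarrow> bool" where
  "epic C X Y f \<longleftrightarrow> X \<in> Obj C \<and> Y \<in> Obj C \<and> f \<in> Hom C X Y \<and>
     (\<forall>Z\<in>Obj C. \<forall>g\<in>Hom C Y Z. \<forall>h\<in>Hom C Y Z. g \<cdot>\<^bsub>C\<^esub> f = h \<cdot>\<^bsub>C\<^esub> f \<longrightarrow> g = h)"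

definition isomorphism :: "('o, 'm) preadd_cat \<Rightarrow> 'o \<Rightarrow> 'o \<Rightarrow> 'm \<Rightarrow> bool" where
  "isomorphism C X Y f \<longleftrightarrow> X \<in> Obj C \<and> Y \<in> Obj C \<and> f \<in> Hom C X Y \<and>
     (\<exists>g\<in>Hom C Y X. g \<cdot>\<^bsub>C\<^esub> f = Ident C X \<and> f \<cdot>\<^bsub>C\<^esub> g = Ident C Y)"

definition is_kernel :: "('o, 'm) preadd_cat \<Rightarrow> 'o \<Rightarrow> 'o \<Rightarrow> 'm \<Rightarrow> 'o \<Rightarrow> 'm \<Rightarrow> bool" where
  "is_kernel C X Y f K k \<longleftrightarrow>
     X \<in> Obj C \<and> Y \<in> Obj C \<and> f \<in> Hom C X Y \<and> K \<in> Obj C \<and> k \<in> Hom C K X \<and>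
     f \<cdot>\<^bsub>C\<^esub> k = Zero C K Y \<and>
     (\<forall>W\<in>Obj C. \<forall>h\<in>Hom C W X. f \<cdot>\<^bsub>C\<^esub> h = Zero C W Y \<longrightarrow> (\<exists>!u. u \<in> Hom C W K \<and> k \<cdot>\<^bsub>C\<^esub> u = h))"

definition is_cokernel :: "('o, 'm) preadd_cat \<Rightarrow> 'o \<Rightarrow> 'o \<Rightarrow> 'm \<Rightarrow> 'o \<Rightarrow> 'm \<Rightarrow> bool" where
  "is_cokernel C X Y f K c \<longleftrightarrow>
     X \<in> Obj C \<and> Y \<in> Obj C \<and> f \<in> Hom C X Y \<and> K \<in> Obj C \<and> c \<in> Hom C Y K \<and>
     c \<cdot>\<^bsub>C\<^esub> f = Zero C X K \<and>
     (\<forall>Z\<in>Obj C. \<forall>h\<in>Hom C Y Z. h \<cdot>\<^bsub>C\<^esub> f = Zero C X Z \<longrightarrow> (\<exists>!u. u \<in> Hom C K Z \<and> u \<cdot>\<^bsub>C\<^esub> c = h))"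

locale abelian_category = preadditive_category +
  assumes direct_sum_exists: "set Xs \<subseteq> Obj C \<Longrightarrow> \<exists>S. is_dsum C Xs S"
    and kernel_exists: "\<lbrakk>X \<in> Obj C; Y \<in> Obj C; f \<in> Hom C X Y\<rbrakk> \<Longrightarrow> \<exists>K k. is_kernel C X Y f K k"
    and cokernel_exists: "\<lbrakk>X \<in> Obj C; Y \<in> Obj C; f \<in> Hom C X Y\<rbrakk> \<Longrightarrow> \<exists>K c. is_cokernel C X Y f K c"
    and monic_is_kernel: "monic C X Y f \<Longrightarrow> \<exists>Z g. is_kernel C Y Z g X f"
    and epic_is_cokernel: "epic C X Y f \<Longrightarrow> \<exists>W g. is_cokernel C W X g Y f"

definition projective :: "('o, 'm) preadd_cat \<Rightarrow> 'o \<Rightarrow> bool" where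
  "projective C P \<longleftrightarrow> P \<in> Obj C \<and>
     (\<forall>X Y e. epic C X Y e \<longrightarrow> (\<forall>f\<in>Hom C P Y. \<exists>g\<in>Hom C P X. e \<cdot>\<^bsub>C\<^esub> g = f))"

definition enough_projectives :: "('o, 'm) preadd_cat \<Rightarrow> bool" where
  "enough_projectives C \<longleftrightarrow> (\<forall>X\<in>Obj C. \<exists>P e. projective C P \<and> epic C P X e)"

text \<open>Exactness of \<open>X \<rightarrow> Y \<rightarrow> Z\<close> at \<open>Y\<close>: the image of \<open>f\<close> is the kernel of \<open>g\<close>, that is,
  \<open>f\<close> factors through the kernel of \<open>g\<close> by an epimorphism.\<close>

definition exact_at :: "('o, 'm) preadd_cat \<Rightarrow> 'o \<Rightarrow> 'o \<Rightarrow> 'o \<Rightarrow> 'm \<Rightarrow> 'm \<Rightarrow> bool" where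
  "exact_at C X Y Z f g \<longleftrightarrow> f \<in> Hom C X Y \<and>
     (\<exists>K k e. is_kernel C Y Z g K k \<and> epic C X K e \<and> f = k \<cdot>\<^bsub>C\<^esub> e)"

definition short_exact :: "('o, 'm) preadd_cat \<Rightarrow> 'o \<Rightarrow> 'o \<Rightarrow> 'o \<Rightarrow> 'm \<Rightarrow> 'm \<Rightarrow> bool" where
  "short_exact C Y E X i p \<longleftrightarrow> is_kernel C E X p Y i \<and> is_cokernel C Y E i X p"

section \<open>The first extension group\<close>

text \<open>
  \<open>Ext1 C X Y\<close> is the underlying set of the Yoneda group: short exact sequences
  \<open>0 \<rightarrow> Y \<rightarrow> E \<rightarrow> X \<rightarrow> 0\<close> up to isomorphisms that are the identity on \<open>X\<close> and \<open>Y\<close>.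
  The group vanishes if and only if this set has exactly one element, so the Baer sum is not
  needed.
\<close>

definition extensions :: "('o, 'm) preadd_cat \<Rightarrow> 'o \<Rightarrow> 'o \<Rightarrow> ('o \<times> 'm \<times> 'm) set" where
  "extensions C X Y = {(E, i, p). short_exact C Y E X i p}"

definition extension_equiv ::
  "('o, 'm) preadd_cat \<Rightarrow> 'o \<Rightarrow> 'o \<Rightarrow> (('o \<times> 'm \<times> 'm) \<times> ('o \<times> 'm \<times> 'm)) set" where
  "extension_equiv C X Y = {((E, i, p), (E', i', p')).
     (E, i, p) \<in> extensions C X Y \<and> (E', i', p') \<in> extensions C X Y \<and>
     (\<exists>h. isomorphism C E E' h \<and> h \<cdot>\<^bsub>C\<^esub> i = i' \<and> p' \<cdot>\<^bsub>C\<^esub> h = p)}"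

definition Ext1 :: "('o, 'm) preadd_cat \<Rightarrow> 'o \<Rightarrow> 'o \<Rightarrow> ('o \<times> 'm \<times> 'm) set set" where
  "Ext1 C X Y = extensions C X Y // extension_equiv C X Y"

definition Ext1_vanishes :: "('o, 'm) preadd_cat \<Rightarrow> 'o \<Rightarrow> 'o \<Rightarrow> bool" where
  "Ext1_vanishes C X Y \<longleftrightarrow> is_singleton (Ext1 C X Y)"

section \<open>Subcategories and support tau-tilting subcategories\<close>

text \<open>A full subcategory is given by its set of objects.\<close>

definition direct_sums :: "('o, 'm) preadd_cat \<Rightarrow> 'o set \<Rightarrow> 'o set" where
  "direct_sums C \<X> = {S. \<exists>Xs. set Xs \<subseteq> \<X> \<and> is_dsum C Xs S}"

definition summands :: "('o, 'm) preadd_cat \<Rightarrow> 'o set \<Rightarrow> 'o set" where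
  "summands C \<X> = {X. \<exists>Y. \<exists>S\<in>\<X>. is_dsum C [X, Y] S}"

definition add_subcat :: "('o, 'm) preadd_cat \<Rightarrow> 'o set \<Rightarrow> 'o set" where
  "add_subcat C \<X> = summands C (direct_sums C \<X>)"

text \<open>Closure under isomorphisms is the case of one-element lists in \<open>direct_sums\<close>, and
  the empty list gives the zero objects.\<close>

definition additive_subcategory :: "('o, 'm) preadd_cat \<Rightarrow> 'o set \<Rightarrow> bool" where
  "additive_subcategory C \<X> \<longleftrightarrow>
     \<X> \<subseteq> Obj C \<and> direct_sums C \<X> \<subseteq> \<X> \<and> summands C \<X> \<subseteq> \<X>"

definition Fac :: "('o, 'm) preadd_cat \<Rightarrow> 'o set \<Rightarrow> 'o set" where
  "Fac C \<X> = {Y. \<exists>X\<in>\<X>. \<exists>e. epic C X Y e}"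

definition Fac_obj :: "('o, 'm) preadd_cat \<Rightarrow> 'o \<Rightarrow> 'o set" where
  "Fac_obj C T = Fac C (direct_sums C {T})"

definition closed_under_epi_kernels :: "('o, 'm) preadd_cat \<Rightarrow> 'o set \<Rightarrow> bool" where
  "closed_under_epi_kernels C \<X> \<longleftrightarrow>
     (\<forall>X\<in>\<X>. \<forall>Y\<in>\<X>. \<forall>f K k. epic C X Y f \<and> is_kernel C X Y f K k \<longrightarrow> K \<in> \<X>)"

definition left_approximation ::
  "('o, 'm) preadd_cat \<Rightarrow> 'o set \<Rightarrow> 'o \<Rightarrow> 'o \<Rightarrow> 'm \<Rightarrow> bool" where
  "left_approximation C \<X> A X f \<longleftrightarrow> X \<in> \<X> \<and> f \<in> Hom C A X \<and>
     (\<forall>X'\<in>\<X>. \<forall>h\<in>Hom C A X'. \<exists>u\<in>Hom C X X'. u \<cdot>\<^bsub>C\<^esub> f = h)"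

definition right_approximation ::
  "('o, 'm) preadd_cat \<Rightarrow> 'o set \<Rightarrow> 'o \<Rightarrow> 'o \<Rightarrow> 'm \<Rightarrow> bool" where
  "right_approximation C \<X> A X f \<longleftrightarrow> X \<in> \<X> \<and> f \<in> Hom C X A \<and>
     (\<forall>X'\<in>\<X>. \<forall>h\<in>Hom C X' A. \<exists>u\<in>Hom C X' X. f \<cdot>\<^bsub>C\<^esub> u = h)"

definition contravariantly_finite :: "('o, 'm) preadd_cat \<Rightarrow> 'o set \<Rightarrow> bool" where
  "contravariantly_finite C \<X> \<longleftrightarrow> (\<forall>A\<in>Obj C. \<exists>X f. right_approximation C \<X> A X f)"

text \<open>The ambient assumptions on \<open>C\<close> are part of the notion.\<close>

definition support_tau_tilting :: "('o, 'm) preadd_cat \<Rightarrow> 'o set \<Rightarrow> bool" where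
  "support_tau_tilting C \<T> \<longleftrightarrow>
     abelian_category C \<and> enough_projectives C \<and>
     additive_subcategory C \<T> \<and> contravariantly_finite C \<T> \<and>
     (\<forall>T1\<in>\<T>. \<forall>T2\<in>\<T>. \<forall>Y\<in>Fac_obj C T2. Ext1_vanishes C T1 Y) \<and>
     (\<forall>P. projective C P \<longrightarrow>
        (\<exists>T0\<in>\<T>. \<exists>T1\<in>\<T>. \<exists>f g.
           left_approximation C \<T> P T0 f \<and> exact_at C P T0 T1 f g \<and> epic C T0 T1 g))"

section \<open>Representations of a quiver\<close>

text \<open>
  A quiver is a digraph (loops and multiple arcs allowed) in the sense of the graph library;
  \<open>awalk Q j p i\<close> says that the list of arcs \<open>p\<close> is a path from \<open>j\<close> to \<open>i\<close>, the first arc in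
  the list being the one that starts at \<open>j\<close>.
\<close>

definition acyclic_quiver :: "('v, 'a) pre_digraph \<Rightarrow> bool" where
  "acyclic_quiver Q \<longleftrightarrow> (\<nexists>c. pre_digraph.cycle Q c)"

definition paths :: "('v, 'a) pre_digraph \<Rightarrow> 'v \<Rightarrow> 'v \<Rightarrow> 'a list set" where
  "paths Q j i = {p. pre_digraph.awalk Q j p i}"

record ('v, 'a, 'o, 'm) rep =
  at_vert :: "'v \<Rightarrow> 'o"
  at_arc :: "'a \<Rightarrow> 'm"

definition Rep :: "('v, 'a) pre_digraph \<Rightarrow> ('o, 'm) preadd_cat
    \<Rightarrow> (('v, 'a, 'o, 'm) rep, 'v \<Rightarrow> 'm) preadd_cat" where
  "Rep Q C = \<lparr>
     Obj = {X. at_vert X \<in> verts Q \<rightarrow>\<^sub>E Obj C \<and>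
               at_arc X \<in> (\<Pi>\<^sub>E a\<in>arcs Q. Hom C (at_vert X (tail Q a)) (at_vert X (head Q a)))},
     Hom = (\<lambda>X Y. {\<phi> \<in> (\<Pi>\<^sub>E i\<in>verts Q. Hom C (at_vert X i) (at_vert Y i)).
               \<forall>a\<in>arcs Q. \<phi> (head Q a) \<cdot>\<^bsub>C\<^esub> at_arc X a = at_arc Y a \<cdot>\<^bsub>C\<^esub> \<phi> (tail Q a)}),
     Ident = (\<lambda>X. \<lambda>i\<in>verts Q. Ident C (at_vert X i)),
     Compose = (\<lambda>\<psi> \<phi>. \<lambda>i\<in>verts Q. \<psi> i \<cdot>\<^bsub>C\<^esub> \<phi> i),
     Plus = (\<lambda>\<phi> \<psi>. \<lambda>i\<in>verts Q. Plus C (\<phi> i) (\<psi> i)),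
     Zero = (\<lambda>X Y. \<lambda>i\<in>verts Q. Zero C (at_vert X i) (at_vert Y i))\<rparr>"

text \<open>A chosen direct sum of copies of \<open>A\<close> indexed by \<open>I\<close>: object, injections, projections.\<close>

definition copower_data ::
  "('o, 'm) preadd_cat \<Rightarrow> 'i set \<Rightarrow> 'o \<Rightarrow> 'o \<times> ('i \<Rightarrow> 'm) \<times> ('i \<Rightarrow> 'm)" where
  "copower_data C I A = (SOME (S, inc, prj). direct_sum C I (\<lambda>_. A) S inc prj)"

definition copower :: "('o, 'm) preadd_cat \<Rightarrow> 'i set \<Rightarrow> 'o \<Rightarrow> 'o" where
  "copower C I A = fst (copower_data C I A)"

definition copower_inc :: "('o, 'm) preadd_cat \<Rightarrow> 'i set \<Rightarrow> 'o \<Rightarrow> 'i \<Rightarrow> 'm" where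
  "copower_inc C I A = fst (snd (copower_data C I A))"

definition copower_prj :: "('o, 'm) preadd_cat \<Rightarrow> 'i set \<Rightarrow> 'o \<Rightarrow> 'i \<Rightarrow> 'm" where
  "copower_prj C I A = snd (snd (copower_data C I A))"

text \<open>
  The value on \<open>A\<close> of the right adjoint of evaluation at the vertex \<open>i\<close>.  For an arc \<open>a\<close> from
  \<open>j\<close> to \<open>k\<close>, prefixing \<open>a\<close> embeds the paths from \<open>k\<close> to \<open>i\<close> into the paths from \<open>j\<close> to \<open>i\<close>;
  the structure morphism at \<open>a\<close> is the projection onto the copies of \<open>A\<close> indexed by the image,
  i.e. its component at a path \<open>q\<close> is the projection at \<open>a # q\<close>.
\<close>

definition e_rho :: "('v, 'a) pre_digraph \<Rightarrow> ('o, 'm) preadd_cat \<Rightarrow> 'v \<Rightarrow> 'o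
    \<Rightarrow> ('v, 'a, 'o, 'm) rep" where
  "e_rho Q C i A = \<lparr>
     at_vert = (\<lambda>j\<in>verts Q. copower C (paths Q j i) A),
     at_arc = (\<lambda>a\<in>arcs Q.
       hom_sum C (copower C (paths Q (tail Q a) i) A) (copower C (paths Q (head Q a) i) A)
         (\<lambda>q. copower_inc C (paths Q (head Q a) i) A q
                \<cdot>\<^bsub>C\<^esub> copower_prj C (paths Q (tail Q a) i) A (a # q))
         (paths Q (head Q a) i))\<rparr>"

end

theory Submission
  imports Defs
begin

text \<open>
  Write \<open>R_i\<close> for the right adjoint \<open>e_rho Q C i\<close> of evaluation at the vertex \<open>i\<close>.  Since \<open>Q\<close> is
  finite and acyclic, a morphism of representations can be constructed one vertex at a time, a
  vertex being treated after the heads of the arcs that start at it; the single obligation at a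
  vertex \<open>j\<close> concerns the map from the value at \<open>j\<close> to the direct sum of the values at those heads
  (the \<^emph>\<open>arc map\<close> at \<open>j\<close>).  The proof reads off everything from the arc maps.

  \<^item> \<^emph>\<open>The additive closure of the \<open>R_i T\<close>.\<close>  It consists of the representations with values in \<open>\<T>\<close>
    all of whose arc maps are split epimorphisms; these are called cofree.  The objects \<open>R_i T\<close> are
    cofree, and sections of the arc maps pass to direct sums and to retracts.  Conversely, let \<open>K_j\<close>
    be the kernels of the arc maps of a cofree \<open>M\<close>; they are summands of values of \<open>M\<close>, hence lie in
    \<open>\<T>\<close>.  Morphisms to \<open>M\<close> are the same as families of morphisms to the \<open>K_j\<close>, a property shared by
    the direct sum of the \<open>R_j (K_j)\<close>, so \<open>M\<close> is a retract of this sum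
    (\<open>add_generators_cofree\<close>, \<open>cofree_add_generators\<close>).

  \<^item> \<^emph>\<open>Vanishing of Ext.\<close>  A quotient \<open>X\<close> of a cofree representation has values in \<open>Fac \<T>\<close> and
    epimorphic arc maps.  By the hypothesis on kernels of epimorphisms, the kernels of its arc maps
    lie in \<open>Fac \<T>\<close>.  Suppose that \<open>X\<close> is the kernel of an epimorphism, and lift a morphism from \<open>M\<close>
    along it vertex by vertex.  The obstruction at \<open>j\<close> lies in \<open>Ext\<close> of the value of \<open>M\<close> at \<open>j\<close> by
    the kernel of the arc map of \<open>X\<close> at \<open>j\<close>, which vanishes as soon as \<open>M\<close> has values in \<open>\<T>\<close>
    (\<open>lift_along_arc_epi\<close>).

  \<^item> \<^emph>\<open>Right approximations.\<close>  For a fixed \<open>X\<close>, the morphisms from \<open>R_i A\<close> to \<open>X\<close> are the morphisms from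
    \<open>A\<close> to a finite limit built from the values of \<open>X\<close>; a right \<open>\<T>\<close>-approximation of this limit
    yields an approximation of \<open>X\<close> by some \<open>R_i T\<close>.  Adding these up over \<open>i\<close> suffices
    (\<open>e_rho_right_approximation\<close>).

  \<^item> \<^emph>\<open>Left approximations of a projective \<open>P\<close>.\<close>  As \<open>R_i\<close> preserves epimorphisms, the value of \<open>P\<close> at
    \<open>i\<close> is projective and has a left approximation by some \<open>T_i\<close> in \<open>\<T>\<close>.  Together these give a left
    approximation from \<open>P\<close> to the sum of the \<open>R_i (T_i)\<close>.  Its cokernel is, at each vertex, the
    cokernel of a left \<open>\<T>\<close>-approximation of a projective object, hence has values in \<open>\<T>\<close>
    (\<open>tilting_cokernel_left_approximation\<close>).  Its arc maps are epimorphisms whose kernels lie in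
    \<open>Fac \<T>\<close> and whose targets lie in \<open>\<T>\<close>, so they split, and the cokernel is cofree
    (\<open>cofree_if_arc_epi\<close>).

  That representations form an abelian category is checked vertexwise, one half of the statements
  following from the other by passing to opposite categories and quivers.  The same duality turns
  the right adjoints of evaluation into left adjoints, which provide enough projective objects.
\<close>

section \<open>Calculus in a preadditive category\<close>

text \<open>
  Hom-sets of objects outside the category carry no information, and composition does not mention
  objects.  Bundling the membership of both objects with that of the morphism leaves one typing
  judgement, closed under composition, from which all side conditions follow.
\<close>

definition mor :: "('o, 'm) preadd_cat \<Rightarrow> 'o \<Rightarrow> 'o \<Rightarrow> 'm \<Rightarrow> bool" where
  "mor C X Y f \<longleftrightarrow> X \<in> Obj C \<and> Y \<in> Obj C \<and> f \<in> Hom C X Y"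

definition retract :: "('o, 'm) preadd_cat \<Rightarrow> 'o \<Rightarrow> 'o \<Rightarrow> 'm \<Rightarrow> 'm \<Rightarrow> bool" where
  "retract C X S i r \<longleftrightarrow> mor C X S i \<and> mor C S X r \<and> r \<cdot>\<^bsub>C\<^esub> i = Ident C X"

definition op_cat :: "('o, 'm) preadd_cat \<Rightarrow> ('o, 'm) preadd_cat" where
  "op_cat C = \<lparr>Obj = Obj C, Hom = (\<lambda>X Y. Hom C Y X), Ident = Ident C,
     Compose = (\<lambda>g f. f \<cdot>\<^bsub>C\<^esub> g), Plus = Plus C, Zero = (\<lambda>X Y. Zero C Y X)\<rparr>"

lemma op_cat_simps [simp]:
  "Obj (op_cat C) = Obj C" "Hom (op_cat C) X Y = Hom C Y X" "Ident (op_cat C) = Ident C"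
  "g \<cdot>\<^bsub>op_cat C\<^esub> f = f \<cdot>\<^bsub>C\<^esub> g" "Plus (op_cat C) = Plus C" "Zero (op_cat C) X Y = Zero C Y X"
  "hom_group (op_cat C) X Y = hom_group C Y X"
  "hom_sum (op_cat C) X Y h I = hom_sum C Y X h I"
  "mor (op_cat C) X Y f \<longleftrightarrow> mor C Y X f"
  by (auto simp: op_cat_def hom_group_def hom_sum_def mor_def)

lemma monic_op [simp]: "monic (op_cat C) X Y f \<longleftrightarrow> epic C Y X f"
  and epic_op [simp]: "epic (op_cat C) X Y f \<longleftrightarrow> monic C Y X f"
  and is_kernel_op [simp]: "is_kernel (op_cat C) X Y f K k \<longleftrightarrow> is_cokernel C Y X f K k"
  and is_cokernel_op [simp]: "is_cokernel (op_cat C) X Y f K k \<longleftrightarrow> is_kernel C Y X f K k"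
  by (auto simp: monic_def epic_def is_kernel_def is_cokernel_def)

lemma direct_sum_op [simp]: "direct_sum (op_cat C) I X S prj inc \<longleftrightarrow> direct_sum C I X S inc prj"
  by (auto simp: direct_sum_def)

context preadditive_category
begin

lemma preadditive_op: "preadditive_category (op_cat C)"
  by (rule preadditive_category.intro)
    (auto simp: ident_closed ident_left ident_right hom_comm_group
      intro: comp_closed comp_plus_left comp_plus_right comp_assoc[symmetric])

lemma mor_objD: "mor C X Y f \<Longrightarrow> X \<in> Obj C" "mor C X Y f \<Longrightarrow> Y \<in> Obj C"
  by (auto simp: mor_def)

lemma mor_comp: "mor C X Y f \<Longrightarrow> mor C Y Z g \<Longrightarrow> mor C X Z (g \<cdot> f)"
  by (auto simp: mor_def intro: comp_closed)

lemma mor_id: "X \<in> Obj C \<Longrightarrow> mor C X X (Ident C X)"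
  by (auto simp: mor_def ident_closed)

lemma assoc: "mor C W X f \<Longrightarrow> mor C X Y g \<Longrightarrow> mor C Y Z h \<Longrightarrow> (h \<cdot> g) \<cdot> f = h \<cdot> (g \<cdot> f)"
  by (auto simp: mor_def intro: comp_assoc)

text \<open>
  Composites are kept bracketed to the right, so an equation for \<open>h \<cdot> g\<close> is applied inside
  \<open>h \<cdot> (g \<cdot> f)\<close> through this rule and the next one.
\<close>

lemma comp_cong: "mor C W X f \<Longrightarrow> mor C X Y g \<Longrightarrow> mor C Y Z h \<Longrightarrow> h \<cdot> g = k \<Longrightarrow> h \<cdot> (g \<cdot> f) = k \<cdot> f"
  using assoc[of W X f Y g Z h] by simp

lemma comp_square: "mor C W X f \<Longrightarrow> mor C X Y g \<Longrightarrow> mor C Y Z h \<Longrightarrow> mor C X Y' g' \<Longrightarrow> mor C Y' Z h' \<Longrightarrow>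
    h \<cdot> g = h' \<cdot> g' \<Longrightarrow> h \<cdot> (g \<cdot> f) = h' \<cdot> (g' \<cdot> f)"
  using assoc[of W X f Y g Z h] assoc[of W X f Y' g' Z h'] by simp

lemma id_left: "mor C X Y f \<Longrightarrow> Ident C Y \<cdot> f = f"
  and id_right: "mor C X Y f \<Longrightarrow> f \<cdot> Ident C X = f"
  by (auto simp: mor_def ident_left ident_right)

lemma mor_zero:
  assumes "X \<in> Obj C" "Y \<in> Obj C" shows "mor C X Y (Zero C X Y)"
proof -
  interpret comm_group "hom_group C X Y" using assms by (simp add: hom_comm_group)
  show ?thesis using one_closed assms by (auto simp: mor_def hom_group_def)
qed

lemma mor_plus:
  assumes "mor C X Y f" "mor C X Y g" shows "mor C X Y (Plus C f g)"
proof -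
  interpret comm_group "hom_group C X Y" using assms by (simp add: hom_comm_group mor_def)
  show ?thesis using m_closed[of f g] assms by (auto simp: mor_def hom_group_def)
qed

lemma plus_comm:
  assumes "mor C X Y f" "mor C X Y g" shows "Plus C f g = Plus C g f"
proof -
  interpret comm_group "hom_group C X Y" using assms by (simp add: hom_comm_group mor_def)
  show ?thesis using m_comm[of f g] assms by (auto simp: mor_def hom_group_def)
qed

lemma plus_zero:
  assumes "mor C X Y f" shows "Plus C f (Zero C X Y) = f" "Plus C (Zero C X Y) f = f"
proof -
  interpret comm_group "hom_group C X Y" using assms by (simp add: hom_comm_group mor_def)
  show "Plus C f (Zero C X Y) = f" "Plus C (Zero C X Y) f = f"
    using r_one[of f] l_one[of f] assms by (auto simp: mor_def hom_group_def)
qed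

lemma plus_cancel:
  assumes "mor C X Y f" "mor C X Y g" "mor C X Y h" "Plus C f h = Plus C g h" shows "f = g"
proof -
  interpret comm_group "hom_group C X Y" using assms by (simp add: hom_comm_group mor_def)
  show ?thesis using right_cancel[of h f g] assms by (auto simp: mor_def hom_group_def)
qed

lemma plus_left: "mor C X Y f \<Longrightarrow> mor C Y Z g \<Longrightarrow> mor C Y Z h \<Longrightarrow>
    Plus C g h \<cdot> f = Plus C (g \<cdot> f) (h \<cdot> f)"
  by (auto simp: mor_def intro: comp_plus_left)

lemma plus_right: "mor C X Y f \<Longrightarrow> mor C X Y g \<Longrightarrow> mor C Y Z h \<Longrightarrow>
    h \<cdot> Plus C f g = Plus C (h \<cdot> f) (h \<cdot> g)"
  by (auto simp: mor_def intro: comp_plus_right)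

lemma zero_right:
  assumes "mor C Y Z g" "X \<in> Obj C" shows "g \<cdot> Zero C X Y = Zero C X Z"
proof -
  have Y: "Y \<in> Obj C" and Z: "Z \<in> Obj C" using assms by (auto simp: mor_def)
  have z: "mor C X Y (Zero C X Y)" using assms Y by (simp add: mor_zero)
  have gz: "mor C X Z (g \<cdot> Zero C X Y)" using mor_comp[OF z assms(1)] .
  have "Plus C (g \<cdot> Zero C X Y) (g \<cdot> Zero C X Y) = g \<cdot> Zero C X Y"
    using plus_right[OF z z assms(1)] plus_zero[OF z] by simp
  also have "\<dots> = Plus C (Zero C X Z) (g \<cdot> Zero C X Y)" using plus_zero[OF gz] by simp
  finally show ?thesis using plus_cancel[OF gz mor_zero[OF assms(2) Z] gz] by simp
qed

lemma zero_left: "mor C X Y f \<Longrightarrow> Z \<in> Obj C \<Longrightarrow> Zero C Y Z \<cdot> f = Zero C X Z"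
  using preadditive_category.zero_right[OF preadditive_op, of Y X f Z] by simp

text \<open>
  Subtraction serves to turn equality of composites with \<open>f\<close> and \<open>g\<close> into the vanishing of a
  composite; \<open>f - g\<close> is described by these properties instead of being named.
\<close>

lemma difference:
  assumes f: "mor C X Y f" and g: "mor C X Y g"
  shows "\<exists>d. mor C X Y d \<and> Plus C d g = f \<and>
    (\<forall>W h. mor C W X h \<longrightarrow> (d \<cdot> h = Zero C W Y \<longleftrightarrow> f \<cdot> h = g \<cdot> h)) \<and>
    (\<forall>Z h. mor C Y Z h \<longrightarrow> (h \<cdot> d = Zero C X Z \<longleftrightarrow> h \<cdot> f = h \<cdot> g))"
proof -
  interpret G: comm_group "hom_group C X Y" using assms by (simp add: hom_comm_group mor_def)
  have c: "f \<in> carrier (hom_group C X Y)" "g \<in> carrier (hom_group C X Y)"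
    using assms by (auto simp: mor_def hom_group_def)
  define d where "d = f \<otimes>\<^bsub>hom_group C X Y\<^esub> inv\<^bsub>hom_group C X Y\<^esub> g"
  have "d \<in> carrier (hom_group C X Y)" using c by (simp add: d_def)
  then have d: "mor C X Y d" using f by (auto simp: mor_def hom_group_def)
  have "d \<otimes>\<^bsub>hom_group C X Y\<^esub> g = f" using c by (simp add: d_def G.m_assoc)
  then have s: "Plus C d g = f" by (simp add: hom_group_def)
  have 1: "d \<cdot> h = Zero C W Y \<longleftrightarrow> f \<cdot> h = g \<cdot> h" if h: "mor C W X h" for W h
  proof -
    have e: "Plus C (d \<cdot> h) (g \<cdot> h) = f \<cdot> h" using plus_left[OF h d g] s by simp
    have gh: "mor C W Y (g \<cdot> h)" and dh: "mor C W Y (d \<cdot> h)" using h d g mor_comp by blast+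
    have z: "mor C W Y (Zero C W Y)" using gh mor_zero by (auto simp: mor_def)
    show ?thesis using e plus_zero[OF gh] plus_cancel[OF dh z gh] by auto
  qed
  have 2: "h \<cdot> d = Zero C X Z \<longleftrightarrow> h \<cdot> f = h \<cdot> g" if h: "mor C Y Z h" for Z h
  proof -
    have e: "Plus C (h \<cdot> d) (h \<cdot> g) = h \<cdot> f" using plus_right[OF d g h] s by simp
    have gh: "mor C X Z (h \<cdot> g)" and dh: "mor C X Z (h \<cdot> d)" using h d g mor_comp by blast+
    have z: "mor C X Z (Zero C X Z)" using gh mor_zero by (auto simp: mor_def)
    show ?thesis using e plus_zero[OF gh] plus_cancel[OF dh z gh] by auto
  qed
  show ?thesis using d s 1 2 by blast
qed

lemma epicD: "epic C X Y f \<Longrightarrow> mor C X Y f"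
  and monicD: "monic C X Y f \<Longrightarrow> mor C X Y f"
  by (auto simp: epic_def monic_def mor_def)

lemma epic_cancel: "epic C X Y f \<Longrightarrow> mor C Y Z g \<Longrightarrow> mor C Y Z h \<Longrightarrow> g \<cdot> f = h \<cdot> f \<Longrightarrow> g = h"
  by (auto simp: epic_def mor_def)

lemma monic_cancel: "monic C X Y f \<Longrightarrow> mor C W X g \<Longrightarrow> mor C W X h \<Longrightarrow> f \<cdot> g = f \<cdot> h \<Longrightarrow> g = h"
  by (auto simp: monic_def mor_def)

lemma epicI:
  assumes f: "mor C X Y f"
    and z: "\<And>Z g. mor C Y Z g \<Longrightarrow> g \<cdot> f = Zero C X Z \<Longrightarrow> g = Zero C Y Z"
  shows "epic C X Y f"
  unfolding epic_def
proof (intro conjI ballI impI)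
  fix Z g h assume a: "Z \<in> Obj C" "g \<in> Hom C Y Z" "h \<in> Hom C Y Z" "g \<cdot> f = h \<cdot> f"
  then have g: "mor C Y Z g" and h: "mor C Y Z h" using f by (auto simp: mor_def)
  obtain d where d: "mor C Y Z d" "Plus C d h = g" and e: "d \<cdot> f = Zero C X Z \<longleftrightarrow> g \<cdot> f = h \<cdot> f"
    using difference[OF g h] f by metis
  have "d = Zero C Y Z" using z d e a by blast
  then show "g = h" using d plus_zero[OF h] by simp
qed (use f in \<open>auto simp: mor_def\<close>)

lemma monicI:
  assumes "mor C X Y f"
    and "\<And>W g. mor C W X g \<Longrightarrow> f \<cdot> g = Zero C W Y \<Longrightarrow> g = Zero C W X"
  shows "monic C X Y f"
  using preadditive_category.epicI[OF preadditive_op, of Y X f] assms by simp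

lemma epic_zero:
  assumes "epic C X Y f" "mor C Y Z g" "g \<cdot> f = Zero C X Z" shows "g = Zero C Y Z"
proof -
  have "Z \<in> Obj C" "Y \<in> Obj C" using assms(2) by (auto simp: mor_def)
  then show ?thesis
    using epic_cancel[OF assms(1,2) mor_zero] zero_left[OF epicD[OF assms(1)]] assms(3) by auto
qed

lemma monic_zero:
  "monic C X Y f \<Longrightarrow> mor C W X g \<Longrightarrow> f \<cdot> g = Zero C W Y \<Longrightarrow> g = Zero C W X"
  using preadditive_category.epic_zero[OF preadditive_op, of Y X f W g] by simp

lemma epic_comp:
  assumes "epic C X Y f" "epic C Y Z g" shows "epic C X Z (g \<cdot> f)"
proof -
  have f: "mor C X Y f" and g: "mor C Y Z g" using assms epicD by auto
  show ?thesis
  proof (rule epicI)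
    fix W h assume h: "mor C Z W h" and e: "h \<cdot> (g \<cdot> f) = Zero C X W"
    have "(h \<cdot> g) \<cdot> f = Zero C X W" using e assoc[OF f g h] by simp
    then show "h = Zero C Z W"
      using epic_zero[OF assms(1) mor_comp[OF g h]] epic_zero[OF assms(2) h] by blast
  qed (rule mor_comp[OF f g])
qed

lemma epic_if_comp_epic:
  assumes f: "mor C X Y f" and g: "mor C Y Z g" and e: "epic C X Z (g \<cdot> f)" shows "epic C Y Z g"
proof (rule epicI[OF g])
  fix W h assume h: "mor C Z W h" and "h \<cdot> g = Zero C Y W"
  then have "h \<cdot> (g \<cdot> f) = Zero C X W"
    using assoc[OF f g h] zero_left[OF f] by (auto simp: mor_def)
  then show "h = Zero C Z W" using epic_zero[OF e h] by simp
qed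

lemma monic_comp: "monic C X Y f \<Longrightarrow> monic C Y Z g \<Longrightarrow> monic C X Z (g \<cdot> f)"
  using preadditive_category.epic_comp[OF preadditive_op, of Z Y g X f] by simp

lemma epic_id: "X \<in> Obj C \<Longrightarrow> epic C X X (Ident C X)"
  by (rule epicI) (auto simp: mor_id id_right)

lemma kernel_mor:
  assumes "is_kernel C X Y f K k"
  shows "mor C X Y f" "mor C K X k" "f \<cdot> k = Zero C K Y" "monic C K X k"
proof -
  show f: "mor C X Y f" and k: "mor C K X k" and z: "f \<cdot> k = Zero C K Y"
    using assms by (auto simp: is_kernel_def mor_def)
  show "monic C K X k"
    unfolding monic_def
  proof (intro conjI ballI impI)
    fix W g h assume a: "W \<in> Obj C" "g \<in> Hom C W K" "h \<in> Hom C W K" "k \<cdot> g = k \<cdot> h"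
    then have g: "mor C W K g" using k by (auto simp: mor_def)
    have "f \<cdot> (k \<cdot> g) = Zero C W Y"
      using assoc[OF g k f] z zero_left[OF g] f by (auto simp: mor_def)
    moreover have "k \<cdot> g \<in> Hom C W X" using mor_comp[OF g k] by (simp add: mor_def)
    ultimately show "g = h" using assms a by (auto simp: is_kernel_def)
  qed (use k in \<open>auto simp: mor_def\<close>)
qed

lemma kernel_lift:
  assumes "is_kernel C X Y f K k" "mor C W X h" "f \<cdot> h = Zero C W Y"
  obtains u where "mor C W K u" "k \<cdot> u = h"
  using assms unfolding is_kernel_def mor_def by metis

lemma kernelI:
  assumes f: "mor C X Y f" and k: "monic C K X k" and z: "f \<cdot> k = Zero C K Y"
    and l: "\<And>W h. mor C W X h \<Longrightarrow> f \<cdot> h = Zero C W Y \<Longrightarrow> \<exists>u. mor C W K u \<and> k \<cdot> u = h"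
  shows "is_kernel C X Y f K k"
  unfolding is_kernel_def
proof (intro conjI ballI impI)
  have k': "mor C K X k" using monicD[OF k] .
  fix W h assume "W \<in> Obj C" "h \<in> Hom C W X" "f \<cdot> h = Zero C W Y"
  then obtain u where "mor C W K u" "k \<cdot> u = h" using l[of W h] f by (auto simp: mor_def)
  then show "\<exists>!u. u \<in> Hom C W K \<and> k \<cdot> u = h"
    using monic_cancel[OF k, of W] by (auto simp: mor_def)
qed (use assms monicD[OF k] in \<open>auto simp: mor_def\<close>)

lemma cokernel_mor:
  assumes "is_cokernel C X Y f K c"
  shows "mor C X Y f" "mor C Y K c" "c \<cdot> f = Zero C X K" "epic C Y K c"
  using preadditive_category.kernel_mor[OF preadditive_op, of Y X f K c] assms by simp_all

lemma cokernel_desc: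
  assumes "is_cokernel C X Y f K c" "mor C Y Z h" "h \<cdot> f = Zero C X Z"
  obtains u where "mor C K Z u" "u \<cdot> c = h"
  using preadditive_category.kernel_lift[OF preadditive_op, of Y X f K c Z h] assms by auto

lemma cokernelI:
  assumes "mor C X Y f" "epic C Y K c" "c \<cdot> f = Zero C X K"
    and "\<And>Z h. mor C Y Z h \<Longrightarrow> h \<cdot> f = Zero C X Z \<Longrightarrow> \<exists>u. mor C K Z u \<and> u \<cdot> c = h"
  shows "is_cokernel C X Y f K c"
  using preadditive_category.kernelI[OF preadditive_op, of Y X f K c] assms by simp

lemma retract_trans:
  assumes "retract C X Y i r" "retract C Y Z i' r'" shows "retract C X Z (i' \<cdot> i) (r \<cdot> r')"
proof -
  have m: "mor C X Y i" "mor C Y X r" "mor C Y Z i'" "mor C Z Y r'"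
    and e: "r \<cdot> i = Ident C X" "r' \<cdot> i' = Ident C Y" using assms by (auto simp: retract_def)
  have "(r \<cdot> r') \<cdot> (i' \<cdot> i) = r \<cdot> ((r' \<cdot> i') \<cdot> i)"
    using assoc[OF mor_comp[OF m(1,3)] m(4,2)] assoc[OF m(1,3,4)] by simp
  then show ?thesis using m e id_left[OF m(1)] mor_comp by (auto simp: retract_def)
qed

subsection \<open>Finite sums of morphisms\<close>

lemma hom_sum_mor:
  assumes "X \<in> Obj C" "Y \<in> Obj C" "\<And>k. k \<in> I \<Longrightarrow> mor C X Y (f k)"
  shows "mor C X Y (hom_sum C X Y f I)"
proof -
  interpret G: comm_group "hom_group C X Y" using assms by (simp add: hom_comm_group)
  have "f \<in> I \<rightarrow> carrier (hom_group C X Y)" using assms by (auto simp: mor_def hom_group_def)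
  from G.finprod_closed[OF this] show ?thesis using assms
    by (simp add: mor_def hom_group_def hom_sum_def)
qed

lemma hom_sum_empty:
  assumes "X \<in> Obj C" "Y \<in> Obj C" shows "hom_sum C X Y f {} = Zero C X Y"
proof -
  interpret G: comm_group "hom_group C X Y" using assms by (simp add: hom_comm_group)
  show ?thesis unfolding hom_sum_def G.finprod_empty by (simp add: hom_group_def)
qed

lemma hom_sum_insert:
  assumes "X \<in> Obj C" "Y \<in> Obj C" "finite I" "l \<notin> I" "\<And>k. k \<in> insert l I \<Longrightarrow> mor C X Y (f k)"
  shows "hom_sum C X Y f (insert l I) = Plus C (f l) (hom_sum C X Y f I)"
proof -
  interpret G: comm_group "hom_group C X Y" using assms by (simp add: hom_comm_group)
  have "f \<in> I \<rightarrow> carrier (hom_group C X Y)" "f l \<in> carrier (hom_group C X Y)"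
    using assms by (auto simp: mor_def hom_group_def)
  from G.finprod_insert[OF assms(3,4) this] show ?thesis
    by (simp add: hom_group_def hom_sum_def)
qed

lemma hom_sum_cong:
  assumes "X \<in> Obj C" "Y \<in> Obj C" "\<And>k. k \<in> I \<Longrightarrow> f k = g k" "\<And>k. k \<in> I \<Longrightarrow> mor C X Y (g k)"
  shows "hom_sum C X Y f I = hom_sum C X Y g I"
proof -
  interpret G: comm_group "hom_group C X Y" using assms by (simp add: hom_comm_group)
  have "g \<in> I \<rightarrow> carrier (hom_group C X Y)"
    using assms by (auto simp: mor_def hom_group_def)
  from G.finprod_cong'[OF refl this assms(3)] show ?thesis
    by (simp add: hom_sum_def)
qed

lemma comp_hom_sum:
  assumes "finite I" "X \<in> Obj C" "mor C Y Z g" "\<And>k. k \<in> I \<Longrightarrow> mor C X Y (f k)"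
  shows "g \<cdot> hom_sum C X Y f I = hom_sum C X Z (\<lambda>k. g \<cdot> f k) I"
  using assms(1,4)
proof (induction I rule: finite_induct)
  case empty
  then show ?case using zero_right assms mor_objD[OF assms(3)] by (simp add: hom_sum_empty)
next
  case (insert l I)
  have o: "Y \<in> Obj C" "Z \<in> Obj C" using assms(3) mor_objD by auto
  have s: "mor C X Y (hom_sum C X Y f I)" by (rule hom_sum_mor) (use insert assms o in auto)
  have "g \<cdot> hom_sum C X Y f (insert l I) = Plus C (g \<cdot> f l) (g \<cdot> hom_sum C X Y f I)"
    using hom_sum_insert[OF assms(2) o(1) insert(1,2), of f] insert(4) plus_right[OF insert(4) s assms(3)] by simp
  also have "\<dots> = hom_sum C X Z (\<lambda>k. g \<cdot> f k) (insert l I)"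
    using hom_sum_insert[OF assms(2) o(2) insert(1,2), of "\<lambda>k. g \<cdot> f k"] insert(3,4) mor_comp[OF insert(4) assms(3)]
    by simp
  finally show ?case .
qed

lemma hom_sum_comp:
  assumes "finite I" "Z \<in> Obj C" "mor C X Y g" "\<And>k. k \<in> I \<Longrightarrow> mor C Y Z (f k)"
  shows "hom_sum C Y Z f I \<cdot> g = hom_sum C X Z (\<lambda>k. f k \<cdot> g) I"
  using preadditive_category.comp_hom_sum[OF preadditive_op, of I Z Y X g f] assms by simp

lemma hom_sum_single:
  assumes "finite I" "l \<in> I" "mor C X Y (f l)" "\<And>k. k \<in> I \<Longrightarrow> k \<noteq> l \<Longrightarrow> f k = Zero C X Y"
  shows "hom_sum C X Y f I = f l"
proof -
  have o: "X \<in> Obj C" "Y \<in> Obj C" using assms mor_objD by auto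
  interpret G: comm_group "hom_group C X Y" using o by (simp add: hom_comm_group)
  have z: "mor C X Y (Zero C X Y)" using mor_zero o by auto
  have "hom_sum C X Y f I = hom_sum C X Y (\<lambda>k. if l = k then f k else Zero C X Y) I"
    using assms o z by (intro hom_sum_cong) auto
  also have "\<dots> = finprod (hom_group C X Y) (\<lambda>k. if l = k then f k else one (hom_group C X Y)) I"
  proof -
    have "one (hom_group C X Y) = Zero C X Y" by (simp add: hom_group_def)
    then show ?thesis by (simp only: hom_sum_def)
  qed
  also have "\<dots> = f l"
    using assms(3,4) o z
    by (intro G.finprod_singleton[OF assms(2,1)]) (fastforce simp: hom_group_def mor_def)
  finally show ?thesis .
qed

section \<open>Direct sums and additive closures\<close>

lemma ds_cong:
  assumes "\<And>k. k \<in> I \<Longrightarrow> X k = X' k" "\<And>k. k \<in> I \<Longrightarrow> inc k = inc' k" "\<And>k. k \<in> I \<Longrightarrow> prj k = prj' k"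
  shows "direct_sum C I X S inc prj \<Longrightarrow> direct_sum C I X' S inc' prj'"
proof -
  assume d: "direct_sum C I X S inc prj"
  have S: "S \<in> Obj C" using d by (auto simp: direct_sum_def)
  have "hom_sum C S S (\<lambda>k. inc k \<cdot> prj k) I = hom_sum C S S (\<lambda>k. inc' k \<cdot> prj' k) I"
  proof (rule hom_sum_cong)
    fix k assume k: "k \<in> I"
    then have "mor C (X k) S (inc k)" "mor C S (X k) (prj k)" using d by (auto simp: direct_sum_def mor_def)
    then show "mor C S S (inc' k \<cdot> prj' k)" using mor_comp assms(1-3)[OF k] by simp
  qed (use S assms in auto)
  then show "direct_sum C I X' S inc' prj'" using d assms(1-3) by (simp add: direct_sum_def)
qed

lemma ds_mor:
  assumes "direct_sum C I X S inc prj" "k \<in> I"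
  shows "mor C (X k) S (inc k)" "mor C S (X k) (prj k)"
  using assms by (auto simp: direct_sum_def mor_def)

lemma ds_obj:
  assumes "direct_sum C I X S inc prj"
  shows "S \<in> Obj C" "finite I" "k \<in> I \<Longrightarrow> X k \<in> Obj C"
  using assms by (auto simp: direct_sum_def)

lemma ds_prj_inc:
  assumes "direct_sum C I X S inc prj" "k \<in> I" "l \<in> I"
  shows "prj k \<cdot> inc l = (if k = l then Ident C (X k) else Zero C (X l) (X k))"
  using assms by (auto simp: direct_sum_def)

lemma ds_prj_inc_comp:
  assumes d: "direct_sum C I X S inc prj" and kl: "k \<in> I" "l \<in> I" and f: "mor C W (X l) f"
  shows "prj k \<cdot> (inc l \<cdot> f) = (if k = l then f else Zero C W (X k))"
proof -
  have "prj k \<cdot> (inc l \<cdot> f) = (if k = l then Ident C (X k) else Zero C (X l) (X k)) \<cdot> f"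
    by (rule comp_cong[OF f ds_mor(1)[OF d kl(2)] ds_mor(2)[OF d kl(1)] ds_prj_inc[OF d kl]])
  then show ?thesis using f id_left[OF f] zero_left[OF f] ds_obj(3)[OF d kl(1)] by auto
qed

text \<open>
  Composing the identity of \<open>S\<close>, written as the sum of the \<open>inc k \<cdot> prj k\<close>, with \<open>u\<close> expresses \<open>u\<close>
  through its components.  With the next lemmas this makes \<open>S\<close> a product and a coproduct, so that
  morphisms into and out of \<open>S\<close> can be compared without computing with sums.
\<close>

lemma ds_eq_prj:
  assumes d: "direct_sum C I X S inc prj" and u: "mor C W S u" and v: "mor C W S v"
    and e: "\<And>k. k \<in> I \<Longrightarrow> prj k \<cdot> u = prj k \<cdot> v"
  shows "u = v"
proof -
  have o: "W \<in> Obj C" "S \<in> Obj C" using u mor_objD by auto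
  have m: "mor C S S (inc k \<cdot> prj k)" if "k \<in> I" for k using mor_comp ds_mor[OF d that] by blast
  have s: "hom_sum C S S (\<lambda>k. inc k \<cdot> prj k) I = Ident C S" and fin: "finite I"
    using d by (auto simp: direct_sum_def)
  have *: "w = hom_sum C W S (\<lambda>k. inc k \<cdot> (prj k \<cdot> w)) I" if w: "mor C W S w" for w
  proof -
    have a: "(inc k \<cdot> prj k) \<cdot> w = inc k \<cdot> (prj k \<cdot> w)" if "k \<in> I" for k
      using assoc[OF w] ds_mor[OF d that] by blast
    have b: "mor C W S (inc k \<cdot> (prj k \<cdot> w))" if "k \<in> I" for k
      using w ds_mor[OF d that] mor_comp by blast
    have "w = hom_sum C S S (\<lambda>k. inc k \<cdot> prj k) I \<cdot> w" using s id_left[OF w] by simp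
    also have "\<dots> = hom_sum C W S (\<lambda>k. (inc k \<cdot> prj k) \<cdot> w) I"
      using hom_sum_comp[OF fin o(2) w m] .
    also have "\<dots> = hom_sum C W S (\<lambda>k. inc k \<cdot> (prj k \<cdot> w)) I"
      using hom_sum_cong[OF o a b] .
    finally show ?thesis .
  qed
  have "hom_sum C W S (\<lambda>k. inc k \<cdot> (prj k \<cdot> u)) I = hom_sum C W S (\<lambda>k. inc k \<cdot> (prj k \<cdot> v)) I"
  proof (rule hom_sum_cong[OF o])
    show "mor C W S (inc k \<cdot> (prj k \<cdot> v))" if "k \<in> I" for k
      using v ds_mor[OF d that] mor_comp by blast
  qed (simp add: e)
  then show ?thesis using *[OF u] *[OF v] by simp
qed

lemma ds_pair_hom_sum:
  assumes d: "direct_sum C I X S inc prj" and W: "W \<in> Obj C"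
    and f: "\<And>k. k \<in> I \<Longrightarrow> mor C W (X k) (f k)"
  shows "mor C W S (hom_sum C W S (\<lambda>k. inc k \<cdot> f k) I)"
    and "l \<in> I \<Longrightarrow> prj l \<cdot> hom_sum C W S (\<lambda>k. inc k \<cdot> f k) I = f l"
proof -
  have m: "mor C W S (inc k \<cdot> f k)" if "k \<in> I" for k using mor_comp f ds_mor[OF d] that by blast
  show "mor C W S (hom_sum C W S (\<lambda>k. inc k \<cdot> f k) I)"
    using hom_sum_mor[OF W ds_obj(1)[OF d] m] .
  assume l: "l \<in> I"
  have "prj l \<cdot> hom_sum C W S (\<lambda>k. inc k \<cdot> f k) I = hom_sum C W (X l) (\<lambda>k. prj l \<cdot> (inc k \<cdot> f k)) I"
    by (rule comp_hom_sum[OF ds_obj(2)[OF d] W ds_mor(2)[OF d l] m])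
  also have "\<dots> = prj l \<cdot> (inc l \<cdot> f l)"
    by (rule hom_sum_single[OF ds_obj(2)[OF d] l])
       (use ds_prj_inc_comp[OF d l _ f] l f in auto)
  finally show "prj l \<cdot> hom_sum C W S (\<lambda>k. inc k \<cdot> f k) I = f l"
    using ds_prj_inc_comp[OF d l l f[OF l]] by simp
qed

lemma ds_pair:
  assumes d: "direct_sum C I X S inc prj" and W: "W \<in> Obj C" and f: "\<forall>k\<in>I. mor C W (X k) (f k)"
  shows "\<exists>u. mor C W S u \<and> (\<forall>k\<in>I. prj k \<cdot> u = f k)"
  using ds_pair_hom_sum[OF d W, of f] f by blast

lemma ds_eq_inc:
  assumes "direct_sum C I X S inc prj" "mor C S W u" "mor C S W v"
    and "\<And>k. k \<in> I \<Longrightarrow> u \<cdot> inc k = v \<cdot> inc k"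
  shows "u = v"
  using preadditive_category.ds_eq_prj[OF preadditive_op, of I X S prj inc W u v] assms by simp

lemma ds_copair:
  assumes "direct_sum C I X S inc prj" "W \<in> Obj C" "\<forall>k\<in>I. mor C (X k) W (f k)"
  shows "\<exists>u. mor C S W u \<and> (\<forall>k\<in>I. u \<cdot> inc k = f k)"
  using preadditive_category.ds_pair[OF preadditive_op, of I X S prj inc W f] assms by simp

text \<open>
  The sum of the \<open>inc k \<cdot> prj k\<close> has the same components as the identity, so it equals the identity
  when the projections are jointly monic.
\<close>

lemma direct_sumI:
  assumes fin: "finite I" and S: "S \<in> Obj C"
    and m: "\<And>k. k \<in> I \<Longrightarrow> mor C (X k) S (inc k)" "\<And>k. k \<in> I \<Longrightarrow> mor C S (X k) (prj k)"
    and e: "\<And>k. k \<in> I \<Longrightarrow> prj k \<cdot> inc k = Ident C (X k)"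
    and z: "\<And>k l. k \<in> I \<Longrightarrow> l \<in> I \<Longrightarrow> k \<noteq> l \<Longrightarrow> prj k \<cdot> inc l = Zero C (X l) (X k)"
    and j: "\<And>u v. mor C S S u \<Longrightarrow> mor C S S v \<Longrightarrow> (\<And>k. k \<in> I \<Longrightarrow> prj k \<cdot> u = prj k \<cdot> v) \<Longrightarrow> u = v"
  shows "direct_sum C I X S inc prj"
proof -
  have mm: "mor C S S (inc k \<cdot> prj k)" if "k \<in> I" for k using mor_comp m that by blast
  have "hom_sum C S S (\<lambda>k. inc k \<cdot> prj k) I = Ident C S"
  proof (rule j)
    show "mor C S S (hom_sum C S S (\<lambda>k. inc k \<cdot> prj k) I)" using hom_sum_mor[OF S S mm] .
    fix l assume l: "l \<in> I"
    have c: "prj l \<cdot> (inc k \<cdot> prj k) = (if k = l then prj l else Zero C S (X l))" if k: "k \<in> I" for k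
    proof (cases "k = l")
      case True
      then show ?thesis
        using comp_cong[OF m(2)[OF l] m(1)[OF l] m(2)[OF l] e[OF l]] id_left[OF m(2)[OF l]] by simp
    next
      case False
      then show ?thesis
        using comp_cong[OF m(2)[OF k] m(1)[OF k] m(2)[OF l] z[OF l k]]
          zero_left[OF m(2)[OF k] mor_objD(2)[OF m(2)[OF l]]] by simp
    qed
    have "prj l \<cdot> hom_sum C S S (\<lambda>k. inc k \<cdot> prj k) I = hom_sum C S (X l) (\<lambda>k. prj l \<cdot> (inc k \<cdot> prj k)) I"
      by (rule comp_hom_sum[OF fin S m(2)[OF l] mm])
    also have "\<dots> = prj l \<cdot> (inc l \<cdot> prj l)"
      by (rule hom_sum_single[OF fin l]) (use c l m in auto)
    finally show "prj l \<cdot> hom_sum C S S (\<lambda>k. inc k \<cdot> prj k) I = prj l \<cdot> Ident C S"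
      using c[OF l] id_right[OF m(2)[OF l]] by simp
  qed (rule mor_id[OF S])
  then show ?thesis using fin S m e z by (auto simp: direct_sum_def mor_def)
qed

lemma ds_reindex:
  assumes d: "direct_sum C I X S inc prj" and h: "bij_betw h J I"
  shows "direct_sum C J (\<lambda>j. X (h j)) S (\<lambda>j. inc (h j)) (\<lambda>j. prj (h j))"
proof -
  have hI: "h j \<in> I" if "j \<in> J" for j using h that bij_betwE by blast
  have inj: "h j = h l \<longleftrightarrow> j = l" if "j \<in> J" "l \<in> J" for j l
    using h that by (auto simp: bij_betw_def inj_on_def)
  show ?thesis
  proof (rule direct_sumI)
    show "finite J" using h ds_obj(2)[OF d] by (simp add: bij_betw_finite)
    fix u v assume uv: "mor C S S u" "mor C S S v" "\<And>j. j \<in> J \<Longrightarrow> prj (h j) \<cdot> u = prj (h j) \<cdot> v"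
    have "prj k \<cdot> u = prj k \<cdot> v" if k: "k \<in> I" for k
    proof -
      obtain j where "j \<in> J" "k = h j" using h k unfolding bij_betw_def by blast
      then show ?thesis using uv by simp
    qed
    then show "u = v" using ds_eq_prj[OF d uv(1,2)] by blast
  qed (use ds_obj[OF d] ds_mor[OF d] ds_prj_inc[OF d] hI inj in auto)
qed

lemma ds_is_dsum:
  assumes d: "direct_sum C I X S inc prj"
  obtains Xs where "set Xs = X ` I" "is_dsum C Xs S"
proof -
  obtain h where h: "bij_betw h {0..<card I} I" using ex_bij_betw_nat_finite[OF ds_obj(2)[OF d]] by blast
  define Xs where "Xs = map (\<lambda>j. X (h j)) [0..<card I]"
  have "X ` I = X ` (h ` {0..<card I})" using h by (simp add: bij_betw_def)
  then have s: "set Xs = X ` I" by (auto simp: Xs_def)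
  have "direct_sum C {0..<card I} (\<lambda>k. Xs ! k) S (\<lambda>j. inc (h j)) (\<lambda>j. prj (h j))"
    by (rule ds_cong[OF _ _ _ ds_reindex[OF d h]]) (auto simp: Xs_def)
  then have "is_dsum C Xs S" unfolding is_dsum_def by (auto simp: Xs_def lessThan_atLeast0)
  then show thesis using that s by blast
qed

lemma is_dsum_pairI:
  assumes d: "direct_sum C UNIV (\<lambda>b. if b then X else Y) S inc prj"
  shows "is_dsum C [X, Y] S"
proof -
  have h: "bij_betw (\<lambda>n::nat. n = 0) {..<length [X, Y]} UNIV"
    by (rule bij_betwI[of _ _ _ "\<lambda>b. if b then 0 else 1"]) (auto simp: less_Suc_eq)
  show ?thesis unfolding is_dsum_def
    using ds_cong[OF _ _ _ ds_reindex[OF d h], of "\<lambda>k. [X, Y] ! k" _ _]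
    by (force simp: less_Suc_eq)
qed

lemma is_dsum_pair_retract:
  assumes "is_dsum C [X, Y] S" obtains i r where "retract C X S i r"
proof -
  obtain inc prj where d: "direct_sum C {..<length [X, Y]} (\<lambda>k. [X, Y] ! k) S inc prj"
    using assms unfolding is_dsum_def by blast
  have "retract C X S (inc 0) (prj 0)"
    using ds_mor[OF d, of 0] ds_prj_inc[OF d, of 0 0] by (simp add: retract_def)
  then show thesis by (rule that)
qed

text \<open>
  Since \<open>p\<close> kills \<open>1 - s p\<close>, this endomorphism factors as \<open>i r\<close>; the factor \<open>r\<close> is the missing
  projection.
\<close>

lemma split_direct_sum:
  assumes p: "mor C E X p" and s: "mor C X E s" and ps: "p \<cdot> s = Ident C X"
    and i: "is_kernel C E X p Y i"
  obtains r where "direct_sum C UNIV (\<lambda>b. if b then Y else X) E (\<lambda>b. if b then i else s) (\<lambda>b. if b then r else p)"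
proof -
  have im: "mor C Y E i" and pi: "p \<cdot> i = Zero C Y X" and mon: "monic C Y E i" using kernel_mor[OF i] by auto
  have o: "E \<in> Obj C" "X \<in> Obj C" "Y \<in> Obj C" using p im mor_objD by auto
  have sp: "mor C E E (s \<cdot> p)" using mor_comp[OF p s] .
  obtain d where d: "mor C E E d" "Plus C d (s \<cdot> p) = Ident C E"
    and dz: "\<forall>W h. mor C W E h \<longrightarrow> (d \<cdot> h = Zero C W E \<longleftrightarrow> Ident C E \<cdot> h = (s \<cdot> p) \<cdot> h)"
    and zd: "\<forall>Z h. mor C E Z h \<longrightarrow> (h \<cdot> d = Zero C E Z \<longleftrightarrow> h \<cdot> Ident C E = h \<cdot> (s \<cdot> p))"
    using difference[OF mor_id[OF o(1)] sp] by blast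
  have "p \<cdot> (s \<cdot> p) = p" using comp_cong[OF p s p ps] id_left[OF p] by simp
  then have "p \<cdot> d = Zero C E X" using zd[rule_format, OF p] id_right[OF p] by simp
  then obtain r where r: "mor C E Y r" "i \<cdot> r = d" using kernel_lift[OF i d(1)] by blast
  have "Plus C (d \<cdot> i) ((s \<cdot> p) \<cdot> i) = i" using plus_left[OF im d(1) sp] d(2) id_left[OF im] by simp
  moreover have "(s \<cdot> p) \<cdot> i = Zero C Y E" using assoc[OF im p s] pi zero_right[OF s o(3)] by simp
  ultimately have "d \<cdot> i = i" using plus_zero[OF mor_comp[OF im d(1)]] by simp
  then have "i \<cdot> (r \<cdot> i) = i \<cdot> Ident C Y" using assoc[OF im r(1) im] r(2) id_right[OF im] by simp
  then have ri: "r \<cdot> i = Ident C Y" using monic_cancel[OF mon mor_comp[OF im r(1)] mor_id[OF o(3)]] by simp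
  have "(s \<cdot> p) \<cdot> s = s" using assoc[OF s p s] ps id_right[OF s] by simp
  then have "d \<cdot> s = Zero C X E" using dz[rule_format, OF s] id_left[OF s] by simp
  then have "i \<cdot> (r \<cdot> s) = Zero C X E" using assoc[OF s r(1) im] r(2) by simp
  then have rs: "r \<cdot> s = Zero C X Y" using monic_zero[OF mon mor_comp[OF s r(1)]] by simp
  have "direct_sum C UNIV (\<lambda>b. if b then Y else X) E (\<lambda>b. if b then i else s) (\<lambda>b. if b then r else p)"
  proof (rule direct_sumI)
    fix u v assume u: "mor C E E u" and v: "mor C E E v"
      and e: "\<And>k. k \<in> UNIV \<Longrightarrow> (if k then r else p) \<cdot> u = (if k then r else p) \<cdot> v"
    have *: "w = Plus C (i \<cdot> (r \<cdot> w)) (s \<cdot> (p \<cdot> w))" if w: "mor C E E w" for w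
      using plus_left[OF w d(1) sp] d(2) id_left[OF w] r assoc[OF w r(1) im] assoc[OF w p s] by simp
    have "r \<cdot> u = r \<cdot> v" "p \<cdot> u = p \<cdot> v" using e[of True] e[of False] by auto
    then show "u = v" using *[OF u] *[OF v] by simp
  qed (use im s r p o ri rs pi ps in \<open>auto split: if_splits\<close>)
  then show thesis by (rule that)
qed

lemma ds_nested:
  assumes d: "direct_sum C I X S inc prj"
    and d': "\<And>k. k \<in> I \<Longrightarrow> direct_sum C (J k) (Y k) (X k) (inc' k) (prj' k)"
  shows "direct_sum C (Sigma I J) (\<lambda>(k, l). Y k l) S (\<lambda>(k, l). inc k \<cdot> inc' k l) (\<lambda>(k, l). prj' k l \<cdot> prj k)"
proof -
  have c: "(prj' k l \<cdot> prj k) \<cdot> (inc k' \<cdot> inc' k' l') =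
      (if k = k' \<and> l = l' then Ident C (Y k l) else Zero C (Y k' l') (Y k l))"
    if k: "k \<in> I" "l \<in> J k" and k': "k' \<in> I" "l' \<in> J k'" for k l k' l'
  proof -
    note m = ds_mor[OF d k(1)] ds_mor[OF d'[OF k(1)] k(2)] ds_mor[OF d k'(1)] ds_mor[OF d'[OF k'(1)] k'(2)]
    have "(prj' k l \<cdot> prj k) \<cdot> (inc k' \<cdot> inc' k' l') = prj' k l \<cdot> (prj k \<cdot> (inc k' \<cdot> inc' k' l'))"
      using assoc[OF mor_comp[OF m(7,5)] m(2,4)] .
    also have "\<dots> = prj' k l \<cdot> (if k = k' then inc' k' l' else Zero C (Y k' l') (X k))"
      using ds_prj_inc_comp[OF d k(1) k'(1) m(7)] by simp
    also have "\<dots> = (if k = k' \<and> l = l' then Ident C (Y k l) else Zero C (Y k' l') (Y k l))"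
      using ds_prj_inc[OF d'[OF k(1)] k(2), of l'] k k' zero_right[OF m(4)] ds_obj(3)[OF d'[OF k'(1)] k'(2)] by auto
    finally show ?thesis .
  qed
  show ?thesis
  proof (rule direct_sumI)
    fix u v assume u: "mor C S S u" and v: "mor C S S v"
      and e: "\<And>q. q \<in> Sigma I J \<Longrightarrow> (case q of (k, l) \<Rightarrow> prj' k l \<cdot> prj k) \<cdot> u = (case q of (k, l) \<Rightarrow> prj' k l \<cdot> prj k) \<cdot> v"
    show "u = v"
    proof (rule ds_eq_prj[OF d u v])
      fix k assume k: "k \<in> I"
      note m = ds_mor(2)[OF d k]
      show "prj k \<cdot> u = prj k \<cdot> v"
      proof (rule ds_eq_prj[OF d'[OF k] mor_comp[OF u m] mor_comp[OF v m]])
        fix l assume l: "l \<in> J k"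
        show "prj' k l \<cdot> (prj k \<cdot> u) = prj' k l \<cdot> (prj k \<cdot> v)"
          using e[of "(k, l)"] k l assoc[OF u m ds_mor(2)[OF d'[OF k] l]]
            assoc[OF v m ds_mor(2)[OF d'[OF k] l]] by simp
      qed
    qed
  next
    fix q assume "q \<in> Sigma I J"
    then obtain k l where q: "q = (k, l)" "k \<in> I" "l \<in> J k" by auto
    show "mor C (case q of (k, l) \<Rightarrow> Y k l) S (case q of (k, l) \<Rightarrow> inc k \<cdot> inc' k l)"
      "mor C S (case q of (k, l) \<Rightarrow> Y k l) (case q of (k, l) \<Rightarrow> prj' k l \<cdot> prj k)"
      using q mor_comp ds_mor[OF d q(2)] ds_mor[OF d'[OF q(2)] q(3)] by auto
  qed (use c ds_obj[OF d] ds_obj[OF d'] in \<open>auto split: if_split_asm\<close>)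
qed

lemma ds_retract:
  assumes d: "direct_sum C I X S inc prj" and d': "direct_sum C I Y S' inc' prj'"
    and ir: "\<And>k. k \<in> I \<Longrightarrow> retract C (X k) (Y k) (i k) (r k)"
  obtains i' r' where "retract C S S' i' r'"
proof -
  have m: "mor C (X k) (Y k) (i k)" "mor C (Y k) (X k) (r k)" "r k \<cdot> i k = Ident C (X k)" if "k \<in> I" for k
    using ir[OF that] by (auto simp: retract_def)
  have a: "\<forall>k\<in>I. mor C S (Y k) (i k \<cdot> prj k)" using mor_comp ds_mor[OF d] m by blast
  have b: "\<forall>k\<in>I. mor C S' (X k) (r k \<cdot> prj' k)" using mor_comp ds_mor[OF d'] m by blast
  obtain i' where i': "mor C S S' i'" "\<forall>k\<in>I. prj' k \<cdot> i' = i k \<cdot> prj k"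
    using ds_pair[OF d' ds_obj(1)[OF d] a] by blast
  obtain r' where r': "mor C S' S r'" "\<forall>k\<in>I. prj k \<cdot> r' = r k \<cdot> prj' k"
    using ds_pair[OF d ds_obj(1)[OF d'] b] by blast
  have "r' \<cdot> i' = Ident C S"
  proof (rule ds_eq_prj[OF d mor_comp[OF i'(1) r'(1)] mor_id[OF ds_obj(1)[OF d]]])
    fix k assume k: "k \<in> I"
    note n = m[OF k] ds_mor[OF d k] ds_mor[OF d' k]
    have "prj k \<cdot> (r' \<cdot> i') = (r k \<cdot> prj' k) \<cdot> i'" by (rule comp_cong[OF i'(1) r'(1) n(5) bspec[OF r'(2) k]])
    also have "\<dots> = r k \<cdot> (i k \<cdot> prj k)" using assoc[OF i'(1) n(7,2)] bspec[OF i'(2) k] by simp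
    also have "\<dots> = prj k" using comp_cong[OF n(5,1,2,3)] id_left[OF n(5)] by simp
    finally show "prj k \<cdot> (r' \<cdot> i') = prj k \<cdot> Ident C S" using id_right[OF n(5)] by simp
  qed
  then show thesis using that i'(1) r'(1) by (simp add: retract_def)
qed

text \<open>
  The two composites of \<open>Z\<close> with the summands add up to the identity, so the map into the direct
  sum with components \<open>f, g\<close> is split by the one out of it with components \<open>f', g'\<close>.
\<close>

lemma retract_pairI:
  assumes d: "direct_sum C UNIV (\<lambda>b. if b then X else Y) S inc prj"
    and f: "mor C Z X f" "mor C Z Y g" "mor C X Z f'" "mor C Y Z g'"
    and e: "Plus C (f' \<cdot> f) (g' \<cdot> g) = Ident C Z"
  obtains i r where "retract C Z S i r"
proof -
  have Z: "Z \<in> Obj C" using f mor_objD by auto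
  let ?h = "\<lambda>b. if b then f else g"
  let ?u = "hom_sum C Z S (\<lambda>k. inc k \<cdot> ?h k) UNIV"
  have h: "mor C Z (if b then X else Y) (?h b)" for b using f by simp
  have u: "mor C Z S ?u" using ds_pair_hom_sum(1)[OF d Z h] .
  have fg: "\<forall>b\<in>UNIV. mor C (if b then X else Y) Z (if b then f' else g')" using f by simp
  obtain v where v: "mor C S Z v" "\<forall>b\<in>UNIV. v \<cdot> inc b = (if b then f' else g')"
    using ds_copair[OF d Z fg] by blast
  have m: "mor C Z S (inc k \<cdot> ?h k)" for k using mor_comp[OF h[of k] ds_mor(1)[OF d]] by blast
  have n: "mor C Z Z (v \<cdot> (inc k \<cdot> ?h k))" for k using mor_comp[OF m v(1)] .
  have w: "v \<cdot> (inc k \<cdot> ?h k) = (if k then f' \<cdot> f else g' \<cdot> g)" for k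
    using comp_cong[OF h[of k] ds_mor(1)[OF d, of k] v(1) bspec[OF v(2)]] by auto
  have U: "(UNIV :: bool set) = insert True {False}" by auto
  have "v \<cdot> ?u = hom_sum C Z Z (\<lambda>k. v \<cdot> (inc k \<cdot> ?h k)) UNIV" by (rule comp_hom_sum[OF _ Z v(1) m]) simp
  also have "\<dots> = Plus C (v \<cdot> (inc True \<cdot> ?h True)) (hom_sum C Z Z (\<lambda>k. v \<cdot> (inc k \<cdot> ?h k)) {False})"
    unfolding U by (rule hom_sum_insert[OF Z Z]) (use n in auto)
  also have "hom_sum C Z Z (\<lambda>k. v \<cdot> (inc k \<cdot> ?h k)) {False} = v \<cdot> (inc False \<cdot> ?h False)"
    by (rule hom_sum_single) (use n[of False] in auto)
  finally have "v \<cdot> ?u = Ident C Z" using w[of True] w[of False] e by simp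
  then show thesis using that u v(1) by (simp add: retract_def)
qed

lemma additive_sum:
  assumes a: "additive_subcategory C \<T>" and d: "direct_sum C I X S inc prj" and "\<And>k. k \<in> I \<Longrightarrow> X k \<in> \<T>"
  shows "S \<in> \<T>"
proof -
  obtain Xs where "set Xs = X ` I" "is_dsum C Xs S" using ds_is_dsum[OF d] .
  then have "S \<in> direct_sums C \<T>"
    using assms(3) unfolding direct_sums_def by (intro CollectI exI[of _ Xs]) auto
  then show ?thesis using a by (auto simp: additive_subcategory_def)
qed

text \<open>
  Together with \<open>add_subcatI\<close> below, membership in an additive closure means to be a retract of a
  finite direct sum.  In this form no complement has to be carried along, and the direct sum may be
  indexed by any finite set.
\<close>

lemma add_subcatD:
  assumes "X \<in> add_subcat C \<G>"
  shows "\<exists>(n::nat) G S inc prj i r. direct_sum C {..<n} G S inc prj \<and> (\<forall>k<n. G k \<in> \<G>) \<and> retract C X S i r"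
proof -
  obtain Y S Xs where 1: "set Xs \<subseteq> \<G>" "is_dsum C Xs S" "is_dsum C [X, Y] S"
    using assms by (auto simp: add_subcat_def direct_sums_def summands_def)
  then obtain inc prj where 2: "direct_sum C {..<length Xs} (\<lambda>k. Xs ! k) S inc prj" by (auto simp: is_dsum_def)
  obtain i r where 3: "retract C X S i r" using is_dsum_pair_retract[OF 1(3)] .
  have "\<forall>k<length Xs. Xs ! k \<in> \<G>" using 1(1) nth_mem by blast
  then show ?thesis using 2 3 by blast
qed

end

context abelian_category
begin

lemma ex_direct_sum:
  assumes "finite I" "\<And>k. k \<in> I \<Longrightarrow> X k \<in> Obj C"
  obtains S inc prj where "direct_sum C I X S inc prj"
proof -
  obtain h where h: "bij_betw h I {0..<card I}" using ex_bij_betw_finite_nat[OF assms(1)] by blast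
  define g where "g = inv_into I h"
  have g: "g (h k) = k" if "k \<in> I" for k using h that by (simp add: g_def bij_betw_def)
  have gI: "g j \<in> I" if "j < card I" for j
    using h that by (auto simp: g_def bij_betw_def intro!: inv_into_into)
  let ?Xs = "map (\<lambda>j. X (g j)) [0..<card I]"
  have "set ?Xs \<subseteq> Obj C" using gI assms(2) by auto
  then obtain S inc prj where "direct_sum C {..<length ?Xs} (\<lambda>k. ?Xs ! k) S inc prj"
    using direct_sum_exists unfolding is_dsum_def by blast
  then have d: "direct_sum C {0..<card I} (\<lambda>k. ?Xs ! k) S inc prj" by (simp add: lessThan_atLeast0)
  have hI: "h k < card I" if "k \<in> I" for k using h that bij_betwE by fastforce
  have "direct_sum C I X S (\<lambda>k. inc (h k)) (\<lambda>k. prj (h k))"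
    by (rule ds_cong[OF _ _ _ ds_reindex[OF d h]]) (use g hI in auto)
  then show thesis by (rule that)
qed

text \<open>
  Idempotents split in an abelian category: the complement is the kernel of the retraction.
\<close>

lemma retract_summand:
  assumes "retract C X S i r" obtains Y where "is_dsum C [X, Y] S"
proof -
  have ir: "mor C X S i" "mor C S X r" "r \<cdot> i = Ident C X" using assms by (auto simp: retract_def)
  then obtain K k where K: "is_kernel C S X r K k" using kernel_exists unfolding mor_def by blast
  obtain q where d: "direct_sum C UNIV (\<lambda>b. if b then K else X) S (\<lambda>b. if b then k else i) (\<lambda>b. if b then q else r)"
    using split_direct_sum[OF ir(2,1,3) K] .
  have "bij_betw Not UNIV UNIV" by (rule bij_betwI[of _ _ _ Not]) auto
  from ds_reindex[OF d this] have "direct_sum C UNIV (\<lambda>b. if b then X else K) S (\<lambda>b. if b then i else k) (\<lambda>b. if b then r else q)"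
    by (rule ds_cong[OF _ _ _, rotated -1]) auto
  then have "is_dsum C [X, K] S" by (rule is_dsum_pairI)
  then show thesis by (rule that)
qed

lemma additive_retract:
  assumes "additive_subcategory C \<T>" "retract C X S i r" "S \<in> \<T>" shows "X \<in> \<T>"
proof -
  obtain Y where "is_dsum C [X, Y] S" using retract_summand[OF assms(2)] .
  then have "X \<in> summands C \<T>" using assms(3) unfolding summands_def by (intro CollectI exI bexI)
  then show ?thesis using assms(1) by (auto simp: additive_subcategory_def)
qed

lemma add_subcatI:
  assumes d: "direct_sum C I G S inc prj" and "\<And>k. k \<in> I \<Longrightarrow> G k \<in> \<G>" and "retract C X S i r"
  shows "X \<in> add_subcat C \<G>"
proof -
  obtain Xs where "set Xs = G ` I" "is_dsum C Xs S" using ds_is_dsum[OF d] .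
  then have S: "S \<in> direct_sums C \<G>"
    using assms(2) unfolding direct_sums_def by (intro CollectI exI[of _ Xs]) auto
  obtain Y where "is_dsum C [X, Y] S" using retract_summand[OF assms(3)] .
  then show ?thesis using S unfolding add_subcat_def summands_def by (intro CollectI exI bexI)
qed

text \<open>
  A finite direct sum of retracts of direct sums is a retract of a nested direct sum.
\<close>

lemma additive_add_subcat: "additive_subcategory C (add_subcat C \<G>)"
  unfolding additive_subcategory_def
proof (intro conjI subsetI)
  fix X assume "X \<in> add_subcat C \<G>"
  then show "X \<in> Obj C" using add_subcatD unfolding retract_def mor_def by blast
next
  fix X assume "X \<in> summands C (add_subcat C \<G>)"
  then obtain Y S where S: "S \<in> add_subcat C \<G>" "is_dsum C [X, Y] S" by (auto simp: summands_def)
  obtain i r where ir: "retract C X S i r" using is_dsum_pair_retract[OF S(2)] .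
  obtain n :: nat and G S' inc prj i' r' where *: "direct_sum C {..<n} G S' inc prj" "\<forall>k<n. G k \<in> \<G>" "retract C S S' i' r'"
    using add_subcatD[OF S(1)] by blast
  show "X \<in> add_subcat C \<G>"
    by (rule add_subcatI[OF *(1) _ retract_trans[OF ir *(3)]]) (use * in auto)
next
  fix S assume "S \<in> direct_sums C (add_subcat C \<G>)"
  then obtain Xs inc prj where Xs: "set Xs \<subseteq> add_subcat C \<G>" and d: "direct_sum C {..<length Xs} (\<lambda>k. Xs ! k) S inc prj"
    by (auto simp: direct_sums_def is_dsum_def)
  have "\<exists>n G S' inc' prj' i r. direct_sum C {..<n::nat} G S' inc' prj' \<and> (\<forall>l<n. G l \<in> \<G>) \<and> retract C (Xs ! k) S' i r"
    if "k < length Xs" for k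
  proof -
    have "Xs ! k \<in> add_subcat C \<G>" using Xs that by auto
    from add_subcatD[OF this] show ?thesis .
  qed
  then obtain n G S' inc' prj' i r where
    *: "\<And>k. k < length Xs \<Longrightarrow> direct_sum C {..<n k :: nat} (G k) (S' k) (inc' k) (prj' k)"
      "\<And>k l. k < length Xs \<Longrightarrow> l < n k \<Longrightarrow> G k l \<in> \<G>"
      "\<And>k. k < length Xs \<Longrightarrow> retract C (Xs ! k) (S' k) (i k) (r k)"
    by metis
  obtain R incR prjR where R: "direct_sum C {..<length Xs} S' R incR prjR"
    using ex_direct_sum[of "{..<length Xs}" S'] ds_obj(1)[OF *(1)] by auto
  have N: "direct_sum C (SIGMA k:{..<length Xs}. {..<n k}) (\<lambda>(k, l). G k l) R
      (\<lambda>(k, l). incR k \<cdot> inc' k l) (\<lambda>(k, l). prj' k l \<cdot> prjR k)"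
    by (rule ds_nested[OF R]) (use *(1) in auto)
  obtain i' r' where "retract C S R i' r'" using ds_retract[OF d R] *(3) by (metis lessThan_iff)
  then show "S \<in> add_subcat C \<G>" by (rule add_subcatI[OF N, rotated]) (use *(2) in auto)
qed

end

section \<open>Abelian categories\<close>

context preadditive_category
begin

lemma kernel_direct_sum_bool:
  assumes d: "direct_sum C UNIV X S inc prj"
  shows "is_kernel C S (X (\<not> b)) (prj (\<not> b)) (X b) (inc b)"
proof -
  note m = ds_mor[OF d UNIV_I]
  have e: "prj k \<cdot> (inc l \<cdot> f) = (if k = l then f else Zero C W (X k))" if "mor C W (X l) f" for k l W f
    using ds_prj_inc_comp[OF d UNIV_I UNIV_I that] .
  show ?thesis
  proof (rule kernelI)
    show "monic C (X b) S (inc b)"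
    proof (rule monicI[OF m(1)])
      fix W g assume g: "mor C W (X b) g" "inc b \<cdot> g = Zero C W S"
      then have "prj b \<cdot> (inc b \<cdot> g) = Zero C W (X b)" using zero_right[OF m(2)] mor_objD by auto
      then show "g = Zero C W (X b)" using e[OF g(1), of b] by simp
    qed
    show "prj (\<not> b) \<cdot> inc b = Zero C (X b) (X (\<not> b))" using ds_prj_inc[OF d UNIV_I UNIV_I, of "\<not> b" b] by simp
    fix W h assume h: "mor C W S h" and z: "prj (\<not> b) \<cdot> h = Zero C W (X (\<not> b))"
    have u: "mor C W (X b) (prj b \<cdot> h)" using mor_comp[OF h m(2)] .
    have "inc b \<cdot> (prj b \<cdot> h) = h"
    proof (rule ds_eq_prj[OF d mor_comp[OF u m(1)] h])
      fix k show "prj k \<cdot> (inc b \<cdot> (prj b \<cdot> h)) = prj k \<cdot> h"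
        using e[OF u, of k] z by (cases "k = b") auto
    qed
    then show "\<exists>u. mor C W (X b) u \<and> inc b \<cdot> u = h" using u by blast
  qed (rule m)
qed

lemma cokernel_direct_sum_bool:
  assumes d: "direct_sum C UNIV X S inc prj"
  shows "is_cokernel C (X b) S (inc b) (X (\<not> b)) (prj (\<not> b))"
  using preadditive_category.kernel_direct_sum_bool[OF preadditive_op, of X S prj inc "\<not> b"] d by simp

lemma dsum_singleton:
  assumes "X \<in> Obj C" shows "is_dsum C [X] X"
proof -
  have "direct_sum C {..<length [X]} (\<lambda>k. [X] ! k) X (\<lambda>_. Ident C X) (\<lambda>_. Ident C X)"
    by (rule direct_sumI) (use assms in \<open>auto simp: mor_id id_left[OF mor_id] id_left\<close>)
  then show ?thesis unfolding is_dsum_def by blast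
qed

lemma epic_direct_sum:
  assumes d: "direct_sum C I X S inc prj" and d': "direct_sum C I Y S' inc' prj'"
    and e: "\<And>k. k \<in> I \<Longrightarrow> epic C (X k) (Y k) (e k)"
  obtains f where "epic C S S' f"
proof -
  have m: "\<forall>k\<in>I. mor C (X k) S' (inc' k \<cdot> e k)"
    using mor_comp epicD[OF e] ds_mor(1)[OF d'] by blast
  obtain f where f: "mor C S S' f" "\<forall>k\<in>I. f \<cdot> inc k = inc' k \<cdot> e k"
    using ds_copair[OF d ds_obj(1)[OF d'] m] by blast
  have "epic C S S' f"
  proof (rule epicI[OF f(1)])
    fix Z g assume g: "mor C S' Z g" and z: "g \<cdot> f = Zero C S Z"
    have Z: "Z \<in> Obj C" using g mor_objD by auto
    show "g = Zero C S' Z"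
    proof (rule ds_eq_inc[OF d' g mor_zero[OF ds_obj(1)[OF d'] Z]])
      fix k assume k: "k \<in> I"
      note n = ds_mor[OF d k] ds_mor[OF d' k] epicD[OF e[OF k]]
      have "(g \<cdot> inc' k) \<cdot> e k = g \<cdot> (f \<cdot> inc k)" using assoc[OF n(5,3) g] bspec[OF f(2) k] assoc[OF n(1) f(1) g] by simp
      also have "\<dots> = Zero C (X k) Z" using comp_cong[OF n(1) f(1) g z] zero_left[OF n(1) Z] by simp
      finally have "g \<cdot> inc' k = Zero C (Y k) Z" using epic_zero[OF e[OF k] mor_comp[OF n(3) g]] by simp
      then show "g \<cdot> inc' k = Zero C S' Z \<cdot> inc' k" using zero_left[OF n(3) Z] by simp
    qed
  qed
  then show thesis by (rule that)
qed

end

context abelian_category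
begin

lemma abelian_op: "abelian_category (op_cat C)"
proof (rule abelian_category.intro[OF preadditive_op], unfold_locales)
  fix Xs assume "set Xs \<subseteq> Obj (op_cat C)"
  then obtain S where "is_dsum C Xs S" using direct_sum_exists by auto
  then show "\<exists>S. is_dsum (op_cat C) Xs S" unfolding is_dsum_def direct_sum_op by blast
qed (auto intro: kernel_exists cokernel_exists dest: monic_is_kernel epic_is_cokernel)

lemma ex_direct_sum_pair:
  assumes "X \<in> Obj C" "Y \<in> Obj C"
  obtains S inc prj where "direct_sum C UNIV (\<lambda>b. if b then X else Y) S inc prj"
proof -
  have "(if b then X else Y) \<in> Obj C" for b using assms by simp
  then show thesis using ex_direct_sum[of UNIV "\<lambda>b. if b then X else Y"] that by (metis finite_code)
qed

lemma ex_kernel: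
  assumes "mor C X Y f" obtains K k where "is_kernel C X Y f K k"
  using kernel_exists assms unfolding mor_def by blast

lemma ex_cokernel:
  assumes "mor C X Y f" obtains K c where "is_cokernel C X Y f K c"
  using cokernel_exists assms unfolding mor_def by blast

text \<open>
  An epimorphism is the cokernel of some \<open>g\<close>, and \<open>g\<close> factors through the kernel \<open>k\<close>; so a morphism
  that kills \<open>k\<close> also kills \<open>g\<close>.
\<close>

lemma epic_cokernel_of_kernel:
  assumes e: "epic C X Y e" and k: "is_kernel C X Y e K k" shows "is_cokernel C K X k Y e"
proof -
  obtain W g where g: "is_cokernel C W X g Y e" using epic_is_cokernel[OF e] by blast
  obtain g' where g': "mor C W K g'" "k \<cdot> g' = g"
    using kernel_lift[OF k cokernel_mor(1)[OF g] cokernel_mor(3)[OF g]] .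
  show ?thesis
  proof (rule cokernelI[OF kernel_mor(2)[OF k] e kernel_mor(3)[OF k]])
    fix Z h assume h: "mor C X Z h" and z: "h \<cdot> k = Zero C K Z"
    have "h \<cdot> g = Zero C W Z"
      using comp_cong[OF g'(1) kernel_mor(2)[OF k] h z] g'(2) zero_left[OF g'(1)] mor_objD[OF h] by simp
    then show "\<exists>u. mor C Y Z u \<and> u \<cdot> e = h" using cokernel_desc[OF g h] by blast
  qed
qed

lemma monic_kernel_of_cokernel:
  assumes "monic C X Y m" "is_cokernel C X Y m K c" shows "is_kernel C Y K c X m"
  using abelian_category.epic_cokernel_of_kernel[OF abelian_op, of Y X m K c] assms by simp

text \<open>
  Image factorization.  Let \<open>m\<close> be the kernel of the cokernel \<open>c\<close> of \<open>f\<close>, and \<open>f = m e\<close>.  If \<open>t e = 0\<close>,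
  then \<open>f\<close> factors through the subobject \<open>m n\<close> where \<open>n\<close> is the kernel of \<open>t\<close>.  As \<open>m n\<close> is a kernel
  of some \<open>g\<close> that kills \<open>f\<close>, and hence factors through \<open>c\<close>, also \<open>m\<close> factors through \<open>m n\<close>; so \<open>n\<close>
  is a split epimorphism and \<open>t = 0\<close>.
\<close>

lemma exact_at_cokernel:
  assumes c: "is_cokernel C X Y f Z c" shows "exact_at C X Y Z f c"
proof -
  note cm = cokernel_mor[OF c]
  obtain I m where m: "is_kernel C Y Z c I m" using ex_kernel[OF cm(2)] .
  note mm = kernel_mor[OF m]
  obtain e where e: "mor C X I e" "m \<cdot> e = f" using kernel_lift[OF m cm(1,3)] .
  have "epic C X I e"
  proof (rule epicI[OF e(1)])
    fix W t assume t: "mor C I W t" and z: "t \<cdot> e = Zero C X W"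
    obtain J n where n: "is_kernel C I W t J n" using ex_kernel[OF t] .
    note nm = kernel_mor[OF n]
    obtain e' where e': "mor C X J e'" "n \<cdot> e' = e" using kernel_lift[OF n e(1) z] .
    have mn: "monic C J Y (m \<cdot> n)" using monic_comp[OF nm(4) mm(4)] .
    obtain V g where g: "is_kernel C Y V g J (m \<cdot> n)" using monic_is_kernel[OF mn] by blast
    note gm = kernel_mor[OF g]
    have fe: "f = (m \<cdot> n) \<cdot> e'" using assoc[OF e'(1) nm(2) mm(2)] e' e by simp
    have V: "V \<in> Obj C" using gm mor_objD by auto
    have "g \<cdot> f = Zero C X V" using comp_cong[OF e'(1) gm(2,1,3)] fe zero_left[OF e'(1) V] by simp
    then obtain w where w: "mor C Z V w" "w \<cdot> c = g" using cokernel_desc[OF c gm(1)] by blast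
    have "g \<cdot> m = w \<cdot> (c \<cdot> m)" using assoc[OF mm(2) cm(2) w(1)] w(2) by simp
    also have "\<dots> = Zero C I V" using mm(3) zero_right[OF w(1)] mor_objD[OF mm(2)] by simp
    finally obtain s where s: "mor C I J s" "(m \<cdot> n) \<cdot> s = m" using kernel_lift[OF g mm(2)] by blast
    have "m \<cdot> (n \<cdot> s) = m \<cdot> Ident C I" using assoc[OF s(1) nm(2) mm(2)] s(2) id_right[OF mm(2)] by simp
    then have ns: "n \<cdot> s = Ident C I"
      using monic_cancel[OF mm(4) mor_comp[OF s(1) nm(2)] mor_id] mor_objD[OF t] by simp
    have "t = t \<cdot> (n \<cdot> s)" using ns id_right[OF t] by simp
    also have "\<dots> = Zero C I W" using comp_cong[OF s(1) nm(2) t nm(3)] zero_left[OF s(1)] mor_objD[OF t] by simp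
    finally show "t = Zero C I W" .
  qed
  then show ?thesis using m e cm(1) unfolding exact_at_def mor_def by blast
qed

lemma cokernel_exact_at:
  assumes x: "exact_at C X Y Z f g" and g: "epic C Y Z g" and X: "X \<in> Obj C" shows "is_cokernel C X Y f Z g"
proof -
  obtain K k e where k: "is_kernel C Y Z g K k" and e: "epic C X K e" and f: "f = k \<cdot> e"
    using x by (auto simp: exact_at_def)
  note km = kernel_mor[OF k] and em = epicD[OF e]
  have c: "is_cokernel C K Y k Z g" using epic_cokernel_of_kernel[OF g k] .
  show ?thesis
  proof (rule cokernelI[OF _ g])
    show "mor C X Y f" using mor_comp[OF em km(2)] f by simp
    show "g \<cdot> f = Zero C X Z" using comp_cong[OF em km(2,1,3)] f zero_left[OF em] mor_objD[OF km(1)] by simp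
    fix W h assume h: "mor C Y W h" and z: "h \<cdot> f = Zero C X W"
    have "(h \<cdot> k) \<cdot> e = Zero C X W" using z f assoc[OF em km(2) h] by simp
    then have "h \<cdot> k = Zero C K W" using epic_zero[OF e mor_comp[OF km(2) h]] by simp
    then show "\<exists>u. mor C Z W u \<and> u \<cdot> g = h" using cokernel_desc[OF c h] by blast
  qed
qed

lemma joint_equalizer:
  assumes "finite I" "S \<in> Obj C" "\<forall>c\<in>I. mor C S (Y c) (f c)" "\<forall>c\<in>I. mor C S (Y c) (g c)"
  shows "\<exists>K k. monic C K S k \<and> (\<forall>c\<in>I. f c \<cdot> k = g c \<cdot> k) \<and>
    (\<forall>W h. mor C W S h \<longrightarrow> (\<forall>c\<in>I. f c \<cdot> h = g c \<cdot> h) \<longrightarrow> (\<exists>u. mor C W K u \<and> k \<cdot> u = h))"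
  using assms(1,3,4)
proof (induction I rule: finite_induct)
    case empty
    have "monic C S S (Ident C S)" by (rule monicI) (auto simp: mor_id assms(2) id_left)
    then show ?case using id_left by blast
  next
    case (insert c I)
    then obtain K k where k: "monic C K S k" "\<forall>c\<in>I. f c \<cdot> k = g c \<cdot> k"
      "\<And>W h. mor C W S h \<Longrightarrow> \<forall>c\<in>I. f c \<cdot> h = g c \<cdot> h \<Longrightarrow> \<exists>u. mor C W K u \<and> k \<cdot> u = h" by auto
    have fg: "mor C S (Y c) (f c)" "mor C S (Y c) (g c)" using insert by auto
    obtain d where d: "mor C S (Y c) d"
        and dz: "\<forall>W h. mor C W S h \<longrightarrow> (d \<cdot> h = Zero C W (Y c) \<longleftrightarrow> f c \<cdot> h = g c \<cdot> h)"
      using difference[OF fg] by blast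
    note km = monicD[OF k(1)]
    obtain K' k' where k': "is_kernel C K (Y c) (d \<cdot> k) K' k'" using ex_kernel[OF mor_comp[OF km d(1)]] .
    note km' = kernel_mor[OF k']
    have kk: "mor C K' S (k \<cdot> k')" using mor_comp[OF km'(2) km] .
    have e: "f l \<cdot> (k \<cdot> k') = g l \<cdot> (k \<cdot> k')" if l: "l \<in> insert c I" for l
    proof (cases "l = c")
      case True
      have "d \<cdot> (k \<cdot> k') = Zero C K' (Y c)" using km'(3) assoc[OF km'(2) km d(1)] by simp
      then show ?thesis using dz[rule_format, OF kk] True by simp
    next
      case False
      then have "l \<in> I" using l by simp
      then show ?thesis using comp_square[OF km'(2) km _ km, of "Y l" "f l" "g l"] insert(4,5) k(2) by auto
    qed
    have u: "\<exists>u. mor C W K' u \<and> (k \<cdot> k') \<cdot> u = h" if h: "mor C W S h" and eh: "\<forall>c\<in>insert c I. f c \<cdot> h = g c \<cdot> h" for W h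
    proof -
      obtain u where u: "mor C W K u" "k \<cdot> u = h" using k(3)[OF h] eh by blast
      have "(d \<cdot> k) \<cdot> u = Zero C W (Y c)" using assoc[OF u(1) km d(1)] u(2) dz[rule_format, OF h] eh by simp
      then obtain u' where "mor C W K' u'" "k' \<cdot> u' = u" using kernel_lift[OF k' u(1)] by blast
      then show ?thesis using assoc[OF _ km'(2) km] u(2) by blast
    qed
    show ?case using monic_comp[OF km'(4) k(1)] e u by blast
qed

text \<open>
  The pullback is the kernel of \<open>D = (f, -g)\<close> on the direct sum of \<open>X\<close> and \<open>Y\<close>.  A morphism from \<open>Y\<close>
  that kills the projection \<open>q\<close> extends by zero to the direct sum, where it kills the kernel of the
  epimorphism \<open>D\<close>; so it factors through \<open>D\<close>, by a morphism that vanishes on the image of \<open>f\<close>.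

  The statement is used as a local lifting principle: an equation involving an epimorphism can be
  solved for elements of \<open>Y\<close> after covering \<open>Y\<close> by an epimorphism.
\<close>

lemma epic_pullback:
  assumes f: "epic C X Z f" and g: "mor C Y Z g"
  obtains P q p where "epic C P Y q" "mor C P X p" "f \<cdot> p = g \<cdot> q"
proof -
  note fm = epicD[OF f]
  have o: "X \<in> Obj C" "Y \<in> Obj C" "Z \<in> Obj C" using fm g mor_objD by auto
  obtain S inc prj where d: "direct_sum C UNIV (\<lambda>b. if b then X else Y) S inc prj"
    using ex_direct_sum_pair[OF o(1,2)] .
  have m: "mor C X S (inc True)" "mor C Y S (inc False)" "mor C S X (prj True)" "mor C S Y (prj False)"
    using ds_mor[OF d UNIV_I, of True] ds_mor[OF d UNIV_I, of False] by simp_all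
  have pi: "prj True \<cdot> inc True = Ident C X" "prj False \<cdot> inc True = Zero C X Y" "prj False \<cdot> inc False = Ident C Y"
    using ds_prj_inc[OF d UNIV_I UNIV_I] by simp_all
  obtain D where D: "mor C S Z D" and Dp: "Plus C D (g \<cdot> prj False) = f \<cdot> prj True"
    and Dz: "\<forall>W h. mor C W S h \<longrightarrow> (D \<cdot> h = Zero C W Z \<longleftrightarrow> (f \<cdot> prj True) \<cdot> h = (g \<cdot> prj False) \<cdot> h)"
    using difference[OF mor_comp[OF m(3) fm] mor_comp[OF m(4) g]] by blast
  have "Plus C (D \<cdot> inc True) ((g \<cdot> prj False) \<cdot> inc True) = (f \<cdot> prj True) \<cdot> inc True"
    using plus_left[OF m(1) D mor_comp[OF m(4) g]] Dp by simp
  then have Di: "D \<cdot> inc True = f"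
    using assoc[OF m(1,4) g] assoc[OF m(1,3) fm] pi zero_right[OF g o(1)] id_right[OF fm]
      plus_zero[OF mor_comp[OF m(1) D]] by simp
  have De: "epic C S Z D" using epic_if_comp_epic[OF m(1) D] Di f by simp
  obtain P k where k: "is_kernel C S Z D P k" using ex_kernel[OF D] .
  note km = kernel_mor[OF k]
  have c: "is_cokernel C P S k Z D" using epic_cokernel_of_kernel[OF De k] .
  have q: "mor C P Y (prj False \<cdot> k)" using mor_comp[OF km(2) m(4)] .
  have "epic C P Y (prj False \<cdot> k)"
  proof (rule epicI[OF q])
    fix W t assume t: "mor C Y W t" and z: "t \<cdot> (prj False \<cdot> k) = Zero C P W"
    have W: "W \<in> Obj C" using t mor_objD by auto
    have "(t \<cdot> prj False) \<cdot> k = Zero C P W" using z assoc[OF km(2) m(4) t] by simp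
    then obtain w where w: "mor C Z W w" "w \<cdot> D = t \<cdot> prj False" using cokernel_desc[OF c mor_comp[OF m(4) t]] by blast
    have "w \<cdot> f = (w \<cdot> D) \<cdot> inc True" using assoc[OF m(1) D w(1)] Di by simp
    also have "\<dots> = Zero C X W" using w(2) assoc[OF m(1,4) t] pi(2) zero_right[OF t o(1)] by simp
    finally have "w = Zero C Z W" using epic_zero[OF f w(1)] by simp
    then have "t \<cdot> prj False = Zero C S W" using w(2) zero_left[OF D W] by simp
    then have "(t \<cdot> prj False) \<cdot> inc False = Zero C Y W" using zero_left[OF m(2) W] by simp
    then show "t = Zero C Y W" using assoc[OF m(2,4) t] pi(3) id_right[OF t] by simp
  qed
  moreover have "f \<cdot> (prj True \<cdot> k) = g \<cdot> (prj False \<cdot> k)"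
    using Dz[rule_format, OF km(2)]
      km(3) assoc[OF km(2) m(3) fm] assoc[OF km(2) m(4) g] by simp
  ultimately show thesis using that mor_comp[OF km(2) m(3)] by blast
qed

lemma joint_local_lift:
  assumes "finite I" "W \<in> Obj C" "\<And>c. c \<in> I \<Longrightarrow> epic C (A c) (B c) (e c)" "\<And>c. c \<in> I \<Longrightarrow> mor C W (B c) (x c)"
  shows "\<exists>W' q m. epic C W' W q \<and> (\<forall>c\<in>I. mor C W' (A c) (m c) \<and> e c \<cdot> m c = x c \<cdot> q)"
  using assms(1,3,4)
proof (induction I rule: finite_induct)
    case empty
    then show ?case using epic_id[OF assms(2)] by blast
  next
    case (insert c I)
    then obtain W' q m where q: "epic C W' W q" and m: "\<forall>c\<in>I. mor C W' (A c) (m c) \<and> e c \<cdot> m c = x c \<cdot> q" by auto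
    have ec: "epic C (A c) (B c) (e c)" and xc: "mor C W (B c) (x c)" using insert by auto
    obtain P r p where r: "epic C P W' r" and p: "mor C P (A c) p" "e c \<cdot> p = (x c \<cdot> q) \<cdot> r"
      using epic_pullback[OF ec mor_comp[OF epicD[OF q] xc]] .
    let ?m = "\<lambda>l. if l = c then p else m l \<cdot> r"
    have "mor C P (A l) (?m l) \<and> e l \<cdot> ?m l = x l \<cdot> (q \<cdot> r)" if l: "l \<in> insert c I" for l
    proof (cases "l = c")
      case True
      then show ?thesis using p assoc[OF epicD[OF r] epicD[OF q] xc] by simp
    next
      case False
      then have ml: "mor C W' (A l) (m l)" "e l \<cdot> m l = x l \<cdot> q" using m l by auto
      have el: "mor C (A l) (B l) (e l)" and xl: "mor C W (B l) (x l)" using insert l epicD by auto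
      show ?thesis using False mor_comp[OF epicD[OF r] ml(1)] comp_square[OF epicD[OF r] ml(1) el epicD[OF q] xl ml(2)] by simp
    qed
    then show ?case
      by (intro exI[of _ P] exI[of _ "q \<cdot> r"] exI[of _ ?m] conjI ballI epic_comp[OF r q]) blast+
qed

subsection \<open>Extensions\<close>

lemma trivial_extension:
  assumes "X \<in> Obj C" "Y \<in> Obj C"
  obtains E i p s where "(E, i, p) \<in> extensions C X Y" "mor C X E s" "p \<cdot> s = Ident C X"
proof -
  obtain S inc prj where d: "direct_sum C UNIV (\<lambda>b. if b then Y else X) S inc prj"
    using ex_direct_sum_pair[OF assms(2,1)] .
  have "short_exact C Y S X (inc True) (prj False)"
    using kernel_direct_sum_bool[OF d, of True] cokernel_direct_sum_bool[OF d, of True]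
    by (simp add: short_exact_def)
  then show thesis
    using that[of S "inc True" "prj False" "inc False"] ds_mor[OF d UNIV_I, of False] ds_prj_inc[OF d UNIV_I UNIV_I, of False False]
    by (simp add: extensions_def)
qed

text \<open>
  The set of classes has one element, so an extension is equivalent to the trivial one, and the
  section of the latter can be transported.
\<close>

lemma Ext1_vanishes_splits:
  assumes v: "Ext1_vanishes C X Y" and k: "is_kernel C E X p Y i" and p: "epic C E X p"
  obtains s where "mor C X E s" "p \<cdot> s = Ident C X"
proof -
  have o: "X \<in> Obj C" "Y \<in> Obj C" "E \<in> Obj C" using kernel_mor[OF k] mor_objD by auto
  have E: "(E, i, p) \<in> extensions C X Y"
    using k epic_cokernel_of_kernel[OF p k] by (simp add: extensions_def short_exact_def)
  obtain F j q s where F: "(F, j, q) \<in> extensions C X Y" "mor C X F s" "q \<cdot> s = Ident C X"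
    using trivial_extension[OF o(1,2)] .
  obtain a where a: "Ext1 C X Y = {a}" using v by (auto simp: Ext1_vanishes_def is_singleton_def)
  have "extension_equiv C X Y `` {z} = a" if "z \<in> extensions C X Y" for z
    using quotientI[OF that, of "extension_equiv C X Y"] a unfolding Ext1_def by blast
  then have "extension_equiv C X Y `` {(F, j, q)} = extension_equiv C X Y `` {(E, i, p)}"
    using E F(1) by simp
  moreover have "isomorphism C E E (Ident C E)"
    using o mor_id[OF o(3)] id_left[OF mor_id[OF o(3)]] by (auto simp: isomorphism_def mor_def)
  then have "((E, i, p), (E, i, p)) \<in> extension_equiv C X Y"
    using E id_left[OF kernel_mor(2)[OF k]] id_right[OF kernel_mor(1)[OF k]] by (auto simp: extension_equiv_def)
  ultimately have "((F, j, q), (E, i, p)) \<in> extension_equiv C X Y" by blast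
  then obtain h where h: "mor C F E h" "p \<cdot> h = q" by (auto simp: extension_equiv_def isomorphism_def mor_def)
  have "p \<cdot> (h \<cdot> s) = Ident C X" using comp_cong[OF F(2) h(1) kernel_mor(1)[OF k] h(2)] F(3) by simp
  then show thesis using that mor_comp[OF F(2) h(1)] by blast
qed

text \<open>
  A section makes the middle term of an extension a direct sum of its ends, and two such direct sums
  are isomorphic over both ends; so any two extensions are equivalent.
\<close>

lemma Ext1_vanishesI:
  assumes o: "X \<in> Obj C" "Y \<in> Obj C"
    and sp: "\<And>E i p. is_kernel C E X p Y i \<Longrightarrow> epic C E X p \<Longrightarrow> \<exists>s. mor C X E s \<and> p \<cdot> s = Ident C X"
  shows "Ext1_vanishes C X Y"
proof -
  have ds: "\<exists>s r. direct_sum C UNIV (\<lambda>b. if b then Y else X) E (\<lambda>b. if b then i else s) (\<lambda>b. if b then r else p)"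
    if "(E, i, p) \<in> extensions C X Y" for E i p
  proof -
    have k: "is_kernel C E X p Y i" "epic C E X p"
      using that cokernel_mor by (auto simp: extensions_def short_exact_def)
    obtain s where s: "mor C X E s" "p \<cdot> s = Ident C X" using sp[OF k] by blast
    show ?thesis using split_direct_sum[OF kernel_mor(1)[OF k(1)] s k(1)] by blast
  qed
  have comparison: "\<exists>h. mor C E E' h \<and> h \<cdot> i = i' \<and> h \<cdot> s = s' \<and> p' \<cdot> h = p"
    if d: "direct_sum C UNIV (\<lambda>b. if b then Y else X) E (\<lambda>b. if b then i else s) (\<lambda>b. if b then r else p)"
      and d': "direct_sum C UNIV (\<lambda>b. if b then Y else X) E' (\<lambda>b. if b then i' else s') (\<lambda>b. if b then r' else p')"
    for E i s r p E' i' s' r' p'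
  proof -
    have "\<forall>b\<in>UNIV. mor C (if b then Y else X) E' (if b then i' else s')" using ds_mor(1)[OF d'] by blast
    then obtain h where h: "mor C E E' h" "\<forall>b\<in>UNIV. h \<cdot> (if b then i else s) = (if b then i' else s')"
      using ds_copair[OF d ds_obj(1)[OF d'], of "\<lambda>b. if b then i' else s'"] by blast
    have m: "mor C E X p" "mor C E' X p'" using ds_mor(2)[OF d UNIV_I, of False] ds_mor(2)[OF d' UNIV_I, of False] by simp_all
    have "p' \<cdot> h = p"
    proof (rule ds_eq_inc[OF d mor_comp[OF h(1) m(2)] m(1)])
      fix b
      show "(p' \<cdot> h) \<cdot> (if b then i else s) = p \<cdot> (if b then i else s)"
        using assoc[OF ds_mor(1)[OF d UNIV_I, of b] h(1) m(2)] bspec[OF h(2) UNIV_I, of b]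
          ds_prj_inc[OF d UNIV_I UNIV_I, of False b] ds_prj_inc[OF d' UNIV_I UNIV_I, of False b] by simp
    qed
    then show ?thesis using h(1) bspec[OF h(2) UNIV_I, of True] bspec[OF h(2) UNIV_I, of False] by auto
  qed
  have eq: "(x, y) \<in> extension_equiv C X Y" if xy: "x \<in> extensions C X Y" "y \<in> extensions C X Y" for x y
  proof -
    obtain E i p E' i' p' where x: "x = (E, i, p)" and y: "y = (E', i', p')" by (cases x, cases y) auto
    obtain s r s' r' where
      d: "direct_sum C UNIV (\<lambda>b. if b then Y else X) E (\<lambda>b. if b then i else s) (\<lambda>b. if b then r else p)" and
      d': "direct_sum C UNIV (\<lambda>b. if b then Y else X) E' (\<lambda>b. if b then i' else s') (\<lambda>b. if b then r' else p')"
      using ds[of E i p] ds[of E' i' p'] xy x y by blast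
    obtain h where h: "mor C E E' h" "h \<cdot> i = i'" "h \<cdot> s = s'" "p' \<cdot> h = p" using comparison[OF d d'] by blast
    obtain g where g: "mor C E' E g" "g \<cdot> i' = i" "g \<cdot> s' = s" using comparison[OF d' d] by blast
    note m = ds_mor(1)[OF d UNIV_I] ds_mor(1)[OF d' UNIV_I]
    have gh: "g \<cdot> h = Ident C E"
    proof (rule ds_eq_inc[OF d mor_comp[OF h(1) g(1)] mor_id[OF ds_obj(1)[OF d]]])
      fix b show "(g \<cdot> h) \<cdot> (if b then i else s) = Ident C E \<cdot> (if b then i else s)"
        using assoc[OF m(1)[of b] h(1) g(1)] id_left[OF m(1)[of b]] h g by (cases b) auto
    qed
    have hg: "h \<cdot> g = Ident C E'"
    proof (rule ds_eq_inc[OF d' mor_comp[OF g(1) h(1)] mor_id[OF ds_obj(1)[OF d']]])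
      fix b show "(h \<cdot> g) \<cdot> (if b then i' else s') = Ident C E' \<cdot> (if b then i' else s')"
        using assoc[OF m(2)[of b] g(1) h(1)] id_left[OF m(2)[of b]] h g by (cases b) auto
    qed
    have "isomorphism C E E' h" using h(1) g(1) gh hg by (auto simp: isomorphism_def mor_def)
    then show ?thesis using xy x y h by (auto simp: extension_equiv_def)
  qed
  obtain x where x: "x \<in> extensions C X Y" using trivial_extension[OF o] by blast
  have "extension_equiv C X Y `` {y} = extensions C X Y" if "y \<in> extensions C X Y" for y
    using eq that by (auto simp: extension_equiv_def)
  then have "Ext1 C X Y = {extensions C X Y}" using x by (auto simp: Ext1_def quotient_def)
  then show ?thesis by (simp add: Ext1_vanishes_def)
qed

text \<open>
  The simultaneous equations \<open>D c \<cdot> s = t c\<close> are solvable over a cover \<open>q\<close> of \<open>M\<close>.  The solutions form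
  the object \<open>G\<close> of pairs of an element of \<open>E\<close> and an element of \<open>M\<close> satisfying the equations.  Local
  solvability makes \<open>G\<close> an extension of \<open>M\<close> by the joint kernel \<open>K\<close> of the \<open>D c\<close>, and a section
  of this extension is a global solution.
\<close>

lemma lift_if_local_lift:
  assumes I: "finite I"
    and D: "\<And>c. c \<in> I \<Longrightarrow> mor C E (Y c) (D c)" and t: "\<And>c. c \<in> I \<Longrightarrow> mor C M (Y c) (t c)"
    and k: "monic C K E k" "\<And>c. c \<in> I \<Longrightarrow> D c \<cdot> k = Zero C K (Y c)"
      "\<And>W h. mor C W E h \<Longrightarrow> (\<And>c. c \<in> I \<Longrightarrow> D c \<cdot> h = Zero C W (Y c)) \<Longrightarrow> \<exists>u. mor C W K u \<and> k \<cdot> u = h"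
    and ext: "Ext1_vanishes C M K"
    and q: "epic C M' M q" and y: "mor C M' E y" and yq: "\<And>c. c \<in> I \<Longrightarrow> D c \<cdot> y = t c \<cdot> q"
  shows "\<exists>s. mor C M E s \<and> (\<forall>c\<in>I. D c \<cdot> s = t c)"
proof -
  have o: "E \<in> Obj C" "M \<in> Obj C" "M' \<in> Obj C" "K \<in> Obj C"
    using monicD[OF k(1)] epicD[OF q] mor_objD by auto
  obtain B inc prj where d: "direct_sum C UNIV (\<lambda>b. if b then E else M) B inc prj"
    using ex_direct_sum_pair[OF o(1,2)] .
  have m: "mor C B E (prj True)" "mor C B M (prj False)"
    using ds_mor[OF d UNIV_I, of True] ds_mor[OF d UNIV_I, of False] by simp_all
  have pair: "\<exists>u. mor C W B u \<and> prj True \<cdot> u = f \<and> prj False \<cdot> u = g" if fgm: "mor C W E f" "mor C W M g" for W f g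
  proof -
    have fg: "\<forall>b\<in>UNIV. mor C W (if b then E else M) (if b then f else g)" using fgm by simp
    obtain u where "mor C W B u" "\<forall>b\<in>UNIV. prj b \<cdot> u = (if b then f else g)"
      using ds_pair[OF d mor_objD(1)[OF fgm(1)] fg] by blast
    then show ?thesis by auto
  qed
  obtain G g where g: "monic C G B g" "\<And>c. c \<in> I \<Longrightarrow> (D c \<cdot> prj True) \<cdot> g = (t c \<cdot> prj False) \<cdot> g"
    "\<And>W h. mor C W B h \<Longrightarrow> (\<And>c. c \<in> I \<Longrightarrow> (D c \<cdot> prj True) \<cdot> h = (t c \<cdot> prj False) \<cdot> h) \<Longrightarrow> \<exists>u. mor C W G u \<and> g \<cdot> u = h"
  proof -
    have "\<forall>c\<in>I. mor C B (Y c) (D c \<cdot> prj True)" "\<forall>c\<in>I. mor C B (Y c) (t c \<cdot> prj False)"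
      using mor_comp[OF m(1) D] mor_comp[OF m(2) t] by auto
    from joint_equalizer[OF I ds_obj(1)[OF d] this] show thesis using that by blast
  qed
  note gm = monicD[OF g(1)]
  have lift: "\<exists>u. mor C W G u \<and> prj True \<cdot> (g \<cdot> u) = a \<and> prj False \<cdot> (g \<cdot> u) = b"
    if ab: "mor C W E a" "mor C W M b" "\<And>c. c \<in> I \<Longrightarrow> D c \<cdot> a = t c \<cdot> b" for W a b
  proof -
    obtain h where h: "mor C W B h" "prj True \<cdot> h = a" "prj False \<cdot> h = b" using pair[OF ab(1,2)] by blast
    have "(D c \<cdot> prj True) \<cdot> h = (t c \<cdot> prj False) \<cdot> h" if "c \<in> I" for c
      using assoc[OF h(1) m(1) D[OF that]] assoc[OF h(1) m(2) t[OF that]] h ab(3)[OF that] by simp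
    then show ?thesis using g(3)[OF h(1)] h by blast
  qed
  define a where "a = prj True \<cdot> g"
  define p where "p = prj False \<cdot> g"
  have am: "mor C G E a" and pm: "mor C G M p" using mor_comp gm m by (auto simp: a_def p_def)
  have ap: "prj True \<cdot> (g \<cdot> u) = a \<cdot> u" "prj False \<cdot> (g \<cdot> u) = p \<cdot> u" if "mor C W G u" for W u
    using assoc[OF that gm m(1)] assoc[OF that gm m(2)] by (auto simp: a_def p_def)
  have Da: "D c \<cdot> a = t c \<cdot> p" if "c \<in> I" for c
    using g(2)[OF that] assoc[OF gm m(1) D[OF that]] assoc[OF gm m(2) t[OF that]] by (simp add: a_def p_def)
  have eqG: "u = v" if u: "mor C W G u" and v: "mor C W G v" and e: "a \<cdot> u = a \<cdot> v" "p \<cdot> u = p \<cdot> v" for W u v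
  proof (rule monic_cancel[OF g(1) u v], rule ds_eq_prj[OF d mor_comp[OF u gm] mor_comp[OF v gm]])
    fix b show "prj b \<cdot> (g \<cdot> u) = prj b \<cdot> (g \<cdot> v)" using ap[OF u] ap[OF v] e by (cases b) auto
  qed
  have p: "epic C G M p"
  proof -
    obtain u where u: "mor C M' G u" "prj False \<cdot> (g \<cdot> u) = q" using lift[OF y epicD[OF q] yq] by blast
    then show ?thesis using epic_if_comp_epic[OF u(1) pm] ap[OF u(1)] q by simp
  qed
  have zK: "mor C K M (Zero C K M)" using mor_zero o by blast
  obtain i where i: "mor C K G i" and ai: "a \<cdot> i = k" and pi: "p \<cdot> i = Zero C K M"
  proof -
    have "D c \<cdot> k = t c \<cdot> Zero C K M" if "c \<in> I" for c using k(2)[OF that] zero_right[OF t[OF that] o(4)] by simp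
    from lift[OF monicD[OF k(1)] zK this] show thesis using that ap by metis
  qed
  have ker: "is_kernel C G M p K i"
  proof (rule kernelI[OF pm _ pi])
    show "monic C K G i"
    proof (rule monicI[OF i])
      fix W h assume h: "mor C W K h" and z: "i \<cdot> h = Zero C W G"
      have "k \<cdot> h = a \<cdot> (i \<cdot> h)" using assoc[OF h i am] ai by simp
      then have "k \<cdot> h = Zero C W E" using z zero_right[OF am] mor_objD[OF h] by simp
      then show "h = Zero C W K" using monic_zero[OF k(1) h] by simp
    qed
    fix W h assume h: "mor C W G h" and z: "p \<cdot> h = Zero C W M"
    have "D c \<cdot> (a \<cdot> h) = Zero C W (Y c)" if "c \<in> I" for c
      using comp_square[OF h am D[OF that] pm t[OF that] Da[OF that]] z zero_right[OF t[OF that]] mor_objD[OF h] by simp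
    then obtain u where u: "mor C W K u" "k \<cdot> u = a \<cdot> h" using k(3)[OF mor_comp[OF h am]] by blast
    have "i \<cdot> u = h"
    proof (rule eqG[OF mor_comp[OF u(1) i] h])
      show "a \<cdot> (i \<cdot> u) = a \<cdot> h" using comp_cong[OF u(1) i am ai] u(2) by simp
      show "p \<cdot> (i \<cdot> u) = p \<cdot> h" using comp_cong[OF u(1) i pm pi] z zero_left[OF u(1) o(2)] by simp
    qed
    then show "\<exists>u. mor C W K u \<and> i \<cdot> u = h" using u by blast
  qed
  obtain s where s: "mor C M G s" "p \<cdot> s = Ident C M" using Ext1_vanishes_splits[OF ext ker p] .
  have "D c \<cdot> (a \<cdot> s) = t c" if "c \<in> I" for c
    using comp_square[OF s(1) am D[OF that] pm t[OF that] Da[OF that]] s(2) id_right[OF t[OF that]] by simp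
  then show ?thesis using mor_comp[OF s(1) am] by blast
qed

subsection \<open>Support tau-tilting subcategories\<close>

lemma Fac_direct_sum:
  assumes a: "additive_subcategory C \<T>" and d: "direct_sum C I X S inc prj" and X: "\<And>k. k \<in> I \<Longrightarrow> X k \<in> Fac C \<T>"
  shows "S \<in> Fac C \<T>"
proof -
  have "\<exists>A e. A \<in> \<T> \<and> epic C A (X k) e" if "k \<in> I" for k using X[OF that] by (auto simp: Fac_def)
  then obtain A e where A: "\<And>k. k \<in> I \<Longrightarrow> A k \<in> \<T>" "\<And>k. k \<in> I \<Longrightarrow> epic C (A k) (X k) (e k)" by metis
  have "A k \<in> Obj C" if "k \<in> I" for k using A(2)[OF that] epicD mor_objD by blast
  then obtain S' inc' prj' where d': "direct_sum C I A S' inc' prj'" using ex_direct_sum[OF ds_obj(2)[OF d]] by metis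
  obtain f where "epic C S' S f" using epic_direct_sum[OF d' d A(2)] .
  then show ?thesis using additive_sum[OF a d' A(1)] by (auto simp: Fac_def)
qed

text \<open>
  The definition speaks of quotients of finite direct sums of copies of a single object of \<open>\<T>\<close>.
  For additive \<open>\<T>\<close> these exhaust \<open>Fac \<T>\<close>.
\<close>

lemma tilting_Ext1_Fac:
  assumes t: "support_tau_tilting C \<T>" and M: "M \<in> \<T>" and Y: "Y \<in> Fac C \<T>"
  shows "Ext1_vanishes C M Y"
proof -
  obtain X e where X: "X \<in> \<T>" "epic C X Y e" using Y by (auto simp: Fac_def)
  then have "X \<in> Obj C" using epicD mor_objD by blast
  then have "X \<in> direct_sums C {X}" using dsum_singleton unfolding direct_sums_def by (intro CollectI exI[of _ "[X]"]) auto
  then have "Y \<in> Fac_obj C X" using X(2) by (auto simp: Fac_obj_def Fac_def)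
  then show ?thesis using t M X(1) by (auto simp: support_tau_tilting_def)
qed

text \<open>
  Two left approximations factor through each other, say \<open>u f = f0\<close> and \<open>w f0 = f\<close>.  On cokernels
  they induce \<open>u'\<close> and \<open>w'\<close>, and \<open>1 - w u\<close> kills \<open>f\<close>, hence equals \<open>v c\<close>.  Then
  \<open>w' u' + c v\<close> is the identity of \<open>Z\<close>, because it becomes \<open>c w u + c (1 - w u) = c\<close> after
  composition with \<open>c\<close>.  So \<open>Z\<close> is a retract of the direct sum of \<open>T1\<close> and \<open>X\<close>.
\<close>

lemma tilting_cokernel_left_approximation:
  assumes t: "support_tau_tilting C \<T>" and P: "projective C P" and f: "left_approximation C \<T> P X f"
    and c: "is_cokernel C P X f Z c"
  shows "Z \<in> \<T>"
proof -
  have add: "additive_subcategory C \<T>" using t by (simp add: support_tau_tilting_def)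
  have To: "\<T> \<subseteq> Obj C" using add by (simp add: additive_subcategory_def)
  have PO: "P \<in> Obj C" using P by (simp add: projective_def)
  obtain T0 T1 f0 g0 where T: "T0 \<in> \<T>" "T1 \<in> \<T>" and f0: "left_approximation C \<T> P T0 f0"
    and ex: "exact_at C P T0 T1 f0 g0" and g0: "epic C T0 T1 g0"
    using t P unfolding support_tau_tilting_def by blast
  have c0: "is_cokernel C P T0 f0 T1 g0" using cokernel_exact_at[OF ex g0 PO] .
  note cm = cokernel_mor[OF c] and cm0 = cokernel_mor[OF c0]
  have X: "X \<in> \<T>" using f by (simp add: left_approximation_def)
  have o: "X \<in> Obj C" "T0 \<in> Obj C" "Z \<in> Obj C" "T1 \<in> Obj C" using cm cm0 mor_objD by auto
  obtain u where u: "mor C X T0 u" "u \<cdot> f = f0"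
    using f T(1) cm0(1) o unfolding left_approximation_def mor_def by blast
  obtain w where w: "mor C T0 X w" "w \<cdot> f0 = f"
    using f0 X cm(1) o unfolding left_approximation_def mor_def by blast
  have "(g0 \<cdot> u) \<cdot> f = Zero C P T1" using assoc[OF cm(1) u(1) cm0(2)] u(2) cm0(3) by simp
  then obtain u' where u': "mor C Z T1 u'" "u' \<cdot> c = g0 \<cdot> u" using cokernel_desc[OF c mor_comp[OF u(1) cm0(2)]] by blast
  have "(c \<cdot> w) \<cdot> f0 = Zero C P Z" using assoc[OF cm0(1) w(1) cm(2)] w(2) cm(3) by simp
  then obtain w' where w': "mor C T1 Z w'" "w' \<cdot> g0 = c \<cdot> w" using cokernel_desc[OF c0 mor_comp[OF w(1) cm(2)]] by blast
  have wu: "mor C X X (w \<cdot> u)" using mor_comp[OF u(1) w(1)] .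
  obtain d where d: "mor C X X d" "Plus C d (w \<cdot> u) = Ident C X"
    and dz: "\<forall>W h. mor C W X h \<longrightarrow> (d \<cdot> h = Zero C W X \<longleftrightarrow> Ident C X \<cdot> h = (w \<cdot> u) \<cdot> h)"
    using difference[OF mor_id[OF o(1)] wu] by blast
  have "d \<cdot> f = Zero C P X" using dz[rule_format, OF cm(1)] id_left[OF cm(1)] assoc[OF cm(1) u(1) w(1)] u(2) w(2) by simp
  then obtain v where v: "mor C Z X v" "v \<cdot> c = d" using cokernel_desc[OF c d(1)] by blast
  have wu': "mor C Z Z (w' \<cdot> u')" and cv: "mor C Z Z (c \<cdot> v)" using mor_comp u' w' v cm by blast+
  have "Plus C (w' \<cdot> u') (c \<cdot> v) = Ident C Z"
  proof (rule epic_cancel[OF cm(4) mor_plus[OF wu' cv] mor_id[OF o(3)]])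
    have "(w' \<cdot> u') \<cdot> c = c \<cdot> (w \<cdot> u)"
      using assoc[OF cm(2) u'(1) w'(1)] u'(2) comp_square[OF u(1) cm0(2) w'(1) w(1) cm(2) w'(2)] by simp
    moreover have "(c \<cdot> v) \<cdot> c = c \<cdot> d" using assoc[OF cm(2) v(1) cm(2)] v(2) by simp
    ultimately have "Plus C (w' \<cdot> u') (c \<cdot> v) \<cdot> c = Plus C (c \<cdot> (w \<cdot> u)) (c \<cdot> d)"
      using plus_left[OF cm(2) wu' cv] by simp
    also have "\<dots> = c \<cdot> Plus C d (w \<cdot> u)"
      using plus_right[OF d(1) wu cm(2)] plus_comm[OF mor_comp[OF d(1) cm(2)] mor_comp[OF wu cm(2)]] by simp
    finally show "Plus C (w' \<cdot> u') (c \<cdot> v) \<cdot> c = Ident C Z \<cdot> c" using d(2) id_left[OF cm(2)] id_right[OF cm(2)] by simp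
  qed
  moreover obtain S inc prj where ds: "direct_sum C UNIV (\<lambda>b. if b then T1 else X) S inc prj"
    using ex_direct_sum_pair[OF o(4,1)] .
  ultimately obtain i r where "retract C Z S i r" using retract_pairI[OF ds u'(1) v(1) w'(1) cm(2)] by blast
  moreover have "S \<in> \<T>" using additive_sum[OF add ds] T(2) X by simp
  ultimately show ?thesis using additive_retract[OF add] by blast
qed

end

section \<open>Representations form an abelian category\<close>

definition op_quiver :: "('v, 'a) pre_digraph \<Rightarrow> ('v, 'a) pre_digraph" where
  "op_quiver Q = \<lparr>verts = verts Q, arcs = arcs Q, tail = head Q, head = tail Q\<rparr>"

lemma op_quiver_simps [simp]:
  "verts (op_quiver Q) = verts Q" "arcs (op_quiver Q) = arcs Q"
  "tail (op_quiver Q) = head Q" "head (op_quiver Q) = tail Q"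
  by (simp_all add: op_quiver_def)

lemma Rep_simps:
  "Ident (Rep Q C) X = (\<lambda>i\<in>verts Q. Ident C (at_vert X i))"
  "\<psi> \<cdot>\<^bsub>Rep Q C\<^esub> \<phi> = (\<lambda>i\<in>verts Q. \<psi> i \<cdot>\<^bsub>C\<^esub> \<phi> i)"
  "Plus (Rep Q C) \<phi> \<psi> = (\<lambda>i\<in>verts Q. Plus C (\<phi> i) (\<psi> i))"
  "Zero (Rep Q C) X Y = (\<lambda>i\<in>verts Q. Zero C (at_vert X i) (at_vert Y i))"
  by (simp_all add: Rep_def)

text \<open>
  Reversing arcs and morphisms gives literally the same representations with the same families of
  morphisms, so every result below has a dual.
\<close>

lemma Rep_op: "Rep (op_quiver Q) (op_cat C) = op_cat (Rep Q C)"
  by (rule preadd_cat.equality) (auto simp: Rep_def op_cat_def fun_eq_iff)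

locale quiver_rep = abelian_category C for C :: "('o, 'm) preadd_cat" (structure) +
  fixes Q :: "('v, 'a) pre_digraph"
  assumes quiver: "wf_digraph Q"
begin

abbreviation R :: "(('v, 'a, 'o, 'm) rep, 'v \<Rightarrow> 'm) preadd_cat" where "R \<equiv> Rep Q C"

abbreviation rep_comp (infixr "\<odot>" 70) where "\<psi> \<odot> \<phi> \<equiv> \<psi> \<cdot>\<^bsub>R\<^esub> \<phi>"

abbreviation at_head where "at_head X a \<equiv> at_vert X (head Q a)"

lemma arc_verts: "a \<in> arcs Q \<Longrightarrow> tail Q a \<in> verts Q" "a \<in> arcs Q \<Longrightarrow> head Q a \<in> verts Q"
  using wf_digraph.tail_in_verts[OF quiver] wf_digraph.head_in_verts[OF quiver] by auto

lemma obj_vert: "X \<in> Obj R \<Longrightarrow> i \<in> verts Q \<Longrightarrow> at_vert X i \<in> Obj C"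
  by (auto simp: Rep_def)

lemma obj_arc: "X \<in> Obj R \<Longrightarrow> a \<in> arcs Q \<Longrightarrow> mor C (at_vert X (tail Q a)) (at_head X a) (at_arc X a)"
  using arc_verts[of a] by (auto simp: Rep_def mor_def)

lemma obj_intro:
  assumes "\<forall>i\<in>verts Q. V i \<in> Obj C" "\<forall>a\<in>arcs Q. mor C (V (tail Q a)) (V (head Q a)) (v a)"
  shows "\<lparr>at_vert = restrict V (verts Q), at_arc = restrict v (arcs Q)\<rparr> \<in> Obj R"
  using assms arc_verts by (auto simp: Rep_def mor_def)

lemma mor_obj: "mor R X Y \<phi> \<Longrightarrow> X \<in> Obj R" "mor R X Y \<phi> \<Longrightarrow> Y \<in> Obj R"
  by (auto simp: mor_def)

lemma mor_vert: "mor R X Y \<phi> \<Longrightarrow> i \<in> verts Q \<Longrightarrow> mor C (at_vert X i) (at_vert Y i) (\<phi> i)"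
  using obj_vert by (auto simp: mor_def) (auto simp: Rep_def)

lemma mor_arc: "mor R X Y \<phi> \<Longrightarrow> a \<in> arcs Q \<Longrightarrow> \<phi> (head Q a) \<cdot> at_arc X a = at_arc Y a \<cdot> \<phi> (tail Q a)"
  by (auto simp: mor_def Rep_def)

lemma mor_intro:
  assumes "X \<in> Obj R" "Y \<in> Obj R" "\<forall>i\<in>verts Q. mor C (at_vert X i) (at_vert Y i) (\<phi> i)"
    "\<forall>a\<in>arcs Q. \<phi> (head Q a) \<cdot> at_arc X a = at_arc Y a \<cdot> \<phi> (tail Q a)"
  shows "mor R X Y (restrict \<phi> (verts Q))"
  using assms arc_verts by (auto simp: mor_def) (auto simp: Rep_def)

lemma mor_eqI:
  assumes "mor R X Y \<phi>" "mor R X Y \<psi>" "\<And>i. i \<in> verts Q \<Longrightarrow> \<phi> i = \<psi> i" shows "\<phi> = \<psi>"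
proof -
  have "\<phi> \<in> extensional (verts Q)" "\<psi> \<in> extensional (verts Q)"
    using assms(1,2) by (auto simp: mor_def Rep_def PiE_def)
  then show ?thesis using assms(3) by (rule extensionalityI)
qed

lemma preadditive_Rep: "preadditive_category R"
proof (rule preadditive_category.intro)
  fix X assume X: "X \<in> Obj R"
  then have "mor R X X (Ident R X)" unfolding Rep_simps
    by (intro mor_intro ballI) (auto simp: obj_vert mor_id id_left[OF obj_arc] id_right[OF obj_arc])
  then show "Ident R X \<in> Hom R X X" by (simp add: mor_def)
next
  fix X Y Z f g assume a: "X \<in> Obj R" "Y \<in> Obj R" "Z \<in> Obj R" "f \<in> Hom R X Y" "g \<in> Hom R Y Z"
  then have f: "mor R X Y f" and g: "mor R Y Z g" by (auto simp: mor_def)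
  have "mor R X Z (g \<odot> f)" unfolding Rep_simps
  proof (intro mor_intro ballI a)
    fix i assume i: "i \<in> verts Q"
    show "mor C (at_vert X i) (at_vert Z i) (g i \<cdot> f i)" using mor_comp mor_vert f g i by blast
  next
    fix c assume c: "c \<in> arcs Q"
    note t = arc_verts(1)[OF c] and h = arc_verts(2)[OF c]
    have "(g (head Q c) \<cdot> f (head Q c)) \<cdot> at_arc X c = g (head Q c) \<cdot> (at_arc Y c \<cdot> f (tail Q c))"
      using assoc[OF obj_arc[OF a(1) c] mor_vert[OF f h] mor_vert[OF g h]] mor_arc[OF f c] by simp
    also have "\<dots> = at_arc Z c \<cdot> (g (tail Q c) \<cdot> f (tail Q c))"
      by (rule comp_square[OF mor_vert[OF f t] obj_arc[OF a(2) c] mor_vert[OF g h] mor_vert[OF g t] obj_arc[OF a(3) c] mor_arc[OF g c]])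
    finally show "(g (head Q c) \<cdot> f (head Q c)) \<cdot> at_arc X c = at_arc Z c \<cdot> (g (tail Q c) \<cdot> f (tail Q c))" .
  qed
  then show "g \<odot> f \<in> Hom R X Z" by (simp add: mor_def)
next
  fix X Y f assume "X \<in> Obj R" "Y \<in> Obj R" "f \<in> Hom R X Y"
  then have f: "mor R X Y f" by (simp add: mor_def)
  then have e: "f \<in> extensional (verts Q)" by (auto simp: mor_def Rep_def PiE_def)
  show "Ident R Y \<odot> f = f" "f \<odot> Ident R X = f" unfolding Rep_simps
    by (rule extensionalityI[OF _ e]; simp add: id_left[OF mor_vert[OF f]] id_right[OF mor_vert[OF f]])+
next
  fix W X Y Z f g h assume "W \<in> Obj R" "X \<in> Obj R" "Y \<in> Obj R" "Z \<in> Obj R" "f \<in> Hom R W X" "g \<in> Hom R X Y" "h \<in> Hom R Y Z"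
  then have "mor R W X f" "mor R X Y g" "mor R Y Z h" by (auto simp: mor_def)
  then show "(h \<odot> g) \<odot> f = h \<odot> (g \<odot> f)" unfolding Rep_simps
    by (intro restrict_ext) (auto intro: assoc mor_vert)
next
  fix X Y Z f g h assume "X \<in> Obj R" "Y \<in> Obj R" "Z \<in> Obj R" "f \<in> Hom R X Y" "g \<in> Hom R Y Z" "h \<in> Hom R Y Z"
  then have "mor R X Y f" "mor R Y Z g" "mor R Y Z h" by (auto simp: mor_def)
  then show "Plus R g h \<odot> f = Plus R (g \<odot> f) (h \<odot> f)" unfolding Rep_simps
    by (intro restrict_ext) (auto intro: plus_left mor_vert)
next
  fix X Y Z f g h assume "X \<in> Obj R" "Y \<in> Obj R" "Z \<in> Obj R" "f \<in> Hom R X Y" "g \<in> Hom R X Y" "h \<in> Hom R Y Z"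
  then have "mor R X Y f" "mor R X Y g" "mor R Y Z h" by (auto simp: mor_def)
  then show "h \<odot> Plus R f g = Plus R (h \<odot> f) (h \<odot> g)" unfolding Rep_simps
    by (intro restrict_ext) (auto intro: plus_right mor_vert)
next
  fix X Y assume XY: "X \<in> Obj R" "Y \<in> Obj R"
  have H: "f \<in> Hom R X Y \<longleftrightarrow> mor R X Y f" for f using XY by (simp add: mor_def)
  have car: "carrier (hom_group R X Y) = {f. mor R X Y f}" "mult (hom_group R X Y) = Plus R"
    "one (hom_group R X Y) = Zero R X Y" using H by (auto simp: hom_group_def)
  have pm: "mor R X Y (Plus R f g)" if f: "mor R X Y f" and g: "mor R X Y g" for f g unfolding Rep_simps
  proof (intro mor_intro ballI XY)
    fix i assume "i \<in> verts Q"
    then show "mor C (at_vert X i) (at_vert Y i) (Plus C (f i) (g i))" using mor_plus mor_vert f g by blast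
  next
    fix c assume c: "c \<in> arcs Q"
    note t = arc_verts(1)[OF c] and h = arc_verts(2)[OF c]
    show "Plus C (f (head Q c)) (g (head Q c)) \<cdot> at_arc X c = at_arc Y c \<cdot> Plus C (f (tail Q c)) (g (tail Q c))"
      using plus_left[OF obj_arc[OF XY(1) c] mor_vert[OF f h] mor_vert[OF g h]]
        plus_right[OF mor_vert[OF f t] mor_vert[OF g t] obj_arc[OF XY(2) c]] mor_arc[OF f c] mor_arc[OF g c] by simp
  qed
  have zm: "mor R X Y (Zero R X Y)" unfolding Rep_simps
    by (intro mor_intro ballI XY)
      (use XY obj_vert mor_zero arc_verts zero_left[OF obj_arc] zero_right[OF obj_arc] in auto)
  have inv: "\<exists>g. mor R X Y g \<and> Plus R g f = Zero R X Y" if f: "mor R X Y f" for f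
  proof -
    have "\<exists>d. mor C (at_vert X i) (at_vert Y i) d \<and> Plus C d (f i) = Zero C (at_vert X i) (at_vert Y i)"
      if i: "i \<in> verts Q" for i
      using difference[OF mor_zero[OF obj_vert obj_vert] mor_vert[OF f i], OF XY(1) i XY(2) i] by blast
    then obtain d where d: "\<And>i. i \<in> verts Q \<Longrightarrow> mor C (at_vert X i) (at_vert Y i) (d i)"
      "\<And>i. i \<in> verts Q \<Longrightarrow> Plus C (d i) (f i) = Zero C (at_vert X i) (at_vert Y i)" by metis
    have dm: "mor R X Y (restrict d (verts Q))"
    proof (intro mor_intro ballI XY)
      fix c assume c: "c \<in> arcs Q"
      note t = arc_verts(1)[OF c] and h = arc_verts(2)[OF c] and x = obj_arc[OF XY(1) c] and y = obj_arc[OF XY(2) c]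
      have dh: "mor C (at_vert X (tail Q c)) (at_head Y c) (d (head Q c) \<cdot> at_arc X c)"
        and dt: "mor C (at_vert X (tail Q c)) (at_head Y c) (at_arc Y c \<cdot> d (tail Q c))"
        and fh: "mor C (at_vert X (tail Q c)) (at_head Y c) (f (head Q c) \<cdot> at_arc X c)"
        using mor_comp x y d(1)[OF t] d(1)[OF h] mor_vert[OF f h] by blast+
      have "Plus C (d (head Q c) \<cdot> at_arc X c) (f (head Q c) \<cdot> at_arc X c)
          = Zero C (at_vert X (tail Q c)) (at_head Y c)"
        using plus_left[OF x d(1)[OF h] mor_vert[OF f h]] d(2)[OF h] zero_left[OF x obj_vert[OF XY(2) h]] by simp
      moreover have "Plus C (at_arc Y c \<cdot> d (tail Q c)) (f (head Q c) \<cdot> at_arc X c)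
          = Zero C (at_vert X (tail Q c)) (at_head Y c)"
        using plus_right[OF d(1)[OF t] mor_vert[OF f t] y] mor_arc[OF f c] d(2)[OF t] zero_right[OF y obj_vert[OF XY(1) t]]
        by simp
      ultimately have "Plus C (d (head Q c) \<cdot> at_arc X c) (f (head Q c) \<cdot> at_arc X c)
          = Plus C (at_arc Y c \<cdot> d (tail Q c)) (f (head Q c) \<cdot> at_arc X c)" by simp
      then show "d (head Q c) \<cdot> at_arc X c = at_arc Y c \<cdot> d (tail Q c)" by (rule plus_cancel[OF dh dt fh])
    qed (use d in auto)
    moreover have "Plus R (restrict d (verts Q)) f = Zero R X Y" unfolding Rep_simps
      by (rule restrict_ext) (use d in auto)
    ultimately show ?thesis by blast
  qed
  have gr: "Plus C (Plus C a b) c = Plus C a (Plus C b c)"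
    if "mor C U V a" "mor C U V b" "mor C U V c" for U V a b c
  proof -
    interpret G: comm_group "hom_group C U V" using that(1) by (simp add: hom_comm_group mor_def)
    show ?thesis using G.m_assoc[of a b c] that by (simp add: hom_group_def mor_def)
  qed
  show "comm_group (hom_group R X Y)"
  proof (rule comm_groupI; unfold car mem_Collect_eq)
    fix f g h assume m: "mor R X Y f" "mor R X Y g" "mor R X Y h"
    show "Plus R (Plus R f g) h = Plus R f (Plus R g h)" unfolding Rep_simps
      by (rule restrict_ext) (simp add: gr[OF mor_vert[OF m(1)] mor_vert[OF m(2)] mor_vert[OF m(3)]])
  next
    fix f g assume m: "mor R X Y f" "mor R X Y g"
    show "Plus R f g = Plus R g f" unfolding Rep_simps
      by (rule restrict_ext) (rule plus_comm[OF mor_vert[OF m(1)] mor_vert[OF m(2)]])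
  next
    fix f assume m: "mor R X Y f"
    then have e: "f \<in> extensional (verts Q)" by (auto simp: mor_def Rep_def PiE_def)
    show "Plus R (Zero R X Y) f = f" unfolding Rep_simps
      by (rule extensionalityI[OF _ e]) (use plus_zero[OF mor_vert[OF m]] in auto)
    show "\<exists>g\<in>{f. mor R X Y f}. Plus R g f = Zero R X Y" using inv[OF m] by blast
  qed (use pm zm in auto)
qed

end

sublocale quiver_rep \<subseteq> R: preadditive_category "Rep Q C"
  by (rule preadditive_Rep)

context quiver_rep
begin

lemma comp_vert [simp]: "i \<in> verts Q \<Longrightarrow> (\<psi> \<odot> \<phi>) i = \<psi> i \<cdot> \<phi> i"
  and ident_vert [simp]: "i \<in> verts Q \<Longrightarrow> Ident R X i = Ident C (at_vert X i)"
  and zero_vert [simp]: "i \<in> verts Q \<Longrightarrow> Zero R X Y i = Zero C (at_vert X i) (at_vert Y i)"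
  by (simp_all add: Rep_simps)

lemma quiver_rep_op: "quiver_rep (op_cat C) (op_quiver Q)"
  by (intro quiver_rep.intro abelian_op quiver_rep_axioms.intro wf_digraph.intro) (use arc_verts in auto)

lemma rep_kernelI:
  assumes \<phi>: "mor R X Y \<phi>" and k: "mor R K X k"
    and v: "\<forall>i\<in>verts Q. is_kernel C (at_vert X i) (at_vert Y i) (\<phi> i) (at_vert K i) (k i)"
  shows "is_kernel R X Y \<phi> K k"
proof (rule R.kernelI[OF \<phi>])
  show mon: "monic R K X k"
  proof (rule R.monicI[OF k])
    fix W g assume g: "mor R W K g" and z: "k \<odot> g = Zero R W X"
    show "g = Zero R W K"
    proof (rule mor_eqI[OF g R.mor_zero])
      fix i assume i: "i \<in> verts Q"
      have "k i \<cdot> g i = Zero C (at_vert W i) (at_vert X i)" using fun_cong[OF z, of i] i by simp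
      then show "g i = Zero R W K i" using monic_zero[OF kernel_mor(4) mor_vert[OF g i]] v i by auto
    qed (use g mor_obj in auto)
  qed
  show "\<phi> \<odot> k = Zero R K Y"
    by (rule mor_eqI[OF R.mor_comp[OF k \<phi>] R.mor_zero]) (use v kernel_mor(3) mor_obj[OF k] mor_obj[OF \<phi>] in auto)
  fix W h assume h: "mor R W X h" and z: "\<phi> \<odot> h = Zero R W Y"
  have "\<exists>u. mor C (at_vert W i) (at_vert K i) u \<and> k i \<cdot> u = h i" if i: "i \<in> verts Q" for i
  proof -
    have "\<phi> i \<cdot> h i = Zero C (at_vert W i) (at_vert Y i)" using fun_cong[OF z, of i] i by simp
    then show ?thesis using kernel_lift[OF bspec[OF v i] mor_vert[OF h i]] by blast
  qed
  then obtain u where u: "\<And>i. i \<in> verts Q \<Longrightarrow> mor C (at_vert W i) (at_vert K i) (u i)"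
    "\<And>i. i \<in> verts Q \<Longrightarrow> k i \<cdot> u i = h i" by metis
  have W: "W \<in> Obj R" and K: "K \<in> Obj R" using h k mor_obj by auto
  have um: "mor R W K (restrict u (verts Q))"
  proof (intro mor_intro ballI W K)
    fix a assume a: "a \<in> arcs Q"
    note t = arc_verts(1)[OF a] and hd = arc_verts(2)[OF a]
    note kt = mor_vert[OF k t] and kh = mor_vert[OF k hd] and Wa = obj_arc[OF W a] and Ka = obj_arc[OF K a]
    show "u (head Q a) \<cdot> at_arc W a = at_arc K a \<cdot> u (tail Q a)"
    proof (rule monic_cancel[OF kernel_mor(4)[OF bspec[OF v hd]] mor_comp[OF Wa u(1)[OF hd]] mor_comp[OF u(1)[OF t] Ka]])
      have "k (head Q a) \<cdot> (u (head Q a) \<cdot> at_arc W a) = at_arc X a \<cdot> h (tail Q a)"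
        using comp_cong[OF Wa u(1)[OF hd] kh u(2)[OF hd]] mor_arc[OF h a] by simp
      also have "\<dots> = k (head Q a) \<cdot> (at_arc K a \<cdot> u (tail Q a))"
        using comp_square[OF u(1)[OF t] Ka kh kt obj_arc[OF mor_obj(2)[OF k] a] mor_arc[OF k a]] u(2)[OF t] by simp
      finally show "k (head Q a) \<cdot> (u (head Q a) \<cdot> at_arc W a) = k (head Q a) \<cdot> (at_arc K a \<cdot> u (tail Q a))" .
    qed
  qed (use u in auto)
  have "k \<odot> restrict u (verts Q) = h"
    by (rule mor_eqI[OF R.mor_comp[OF um k] h]) (use u in auto)
  then show "\<exists>u. mor R W K u \<and> k \<odot> u = h" using um by blast
qed

lemma rep_kernel_exists:
  assumes \<phi>: "mor R X Y \<phi>"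
  shows "\<exists>K k. is_kernel R X Y \<phi> K k \<and>
    (\<forall>i\<in>verts Q. is_kernel C (at_vert X i) (at_vert Y i) (\<phi> i) (at_vert K i) (k i))"
proof -
  have X: "X \<in> Obj R" and Y: "Y \<in> Obj R" using \<phi> mor_obj by auto
  have "\<exists>K k. is_kernel C (at_vert X i) (at_vert Y i) (\<phi> i) K k" if "i \<in> verts Q" for i
    using ex_kernel[OF mor_vert[OF \<phi> that]] by blast
  then obtain K k where k: "\<And>i. i \<in> verts Q \<Longrightarrow> is_kernel C (at_vert X i) (at_vert Y i) (\<phi> i) (K i) (k i)" by metis
  have "\<exists>u. mor C (K (tail Q a)) (K (head Q a)) u \<and> k (head Q a) \<cdot> u = at_arc X a \<cdot> k (tail Q a)" if a: "a \<in> arcs Q" for a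
  proof -
    note t = arc_verts(1)[OF a] and hd = arc_verts(2)[OF a]
    note kt = kernel_mor[OF k[OF t]] and Xa = obj_arc[OF X a] and Ya = obj_arc[OF Y a]
    have "\<phi> (head Q a) \<cdot> (at_arc X a \<cdot> k (tail Q a)) = at_arc Y a \<cdot> (\<phi> (tail Q a) \<cdot> k (tail Q a))"
      by (rule comp_square[OF kt(2) Xa mor_vert[OF \<phi> hd] kt(1) Ya mor_arc[OF \<phi> a]])
    also have "\<dots> = Zero C (K (tail Q a)) (at_head Y a)"
      using kt(3) zero_right[OF Ya] mor_objD[OF kt(2)] by simp
    finally show ?thesis using kernel_lift[OF k[OF hd] mor_comp[OF kt(2) Xa]] by blast
  qed
  then obtain v where v: "\<And>a. a \<in> arcs Q \<Longrightarrow> mor C (K (tail Q a)) (K (head Q a)) (v a)"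
    "\<And>a. a \<in> arcs Q \<Longrightarrow> k (head Q a) \<cdot> v a = at_arc X a \<cdot> k (tail Q a)" by metis
  define K' :: "('v, 'a, 'o, 'm) rep" where "K' = \<lparr>at_vert = restrict K (verts Q), at_arc = restrict v (arcs Q)\<rparr>"
  have K': "K' \<in> Obj R" unfolding K'_def
    by (rule obj_intro) (use v mor_objD(1)[OF kernel_mor(2)[OF k]] in auto)
  have K's: "at_vert K' i = K i" if "i \<in> verts Q" for i using that by (simp add: K'_def)
  have k': "mor R K' X (restrict k (verts Q))"
    by (intro mor_intro K' X ballI) (use K's kernel_mor(2)[OF k] v in \<open>auto simp: K'_def\<close>)
  have "\<forall>i\<in>verts Q. is_kernel C (at_vert X i) (at_vert Y i) (\<phi> i) (at_vert K' i) (restrict k (verts Q) i)"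
    using k K's by simp
  then show ?thesis using rep_kernelI[OF \<phi> k'] by blast
qed

text \<open>
  A monomorphism has zero kernel, and the kernel is computed vertexwise.
\<close>

lemma rep_monic_vert:
  assumes m: "monic R X Y \<phi>" and i: "i \<in> verts Q" shows "monic C (at_vert X i) (at_vert Y i) (\<phi> i)"
proof -
  note \<phi> = R.monicD[OF m]
  obtain K k where k: "is_kernel R X Y \<phi> K k" "is_kernel C (at_vert X i) (at_vert Y i) (\<phi> i) (at_vert K i) (k i)"
    using rep_kernel_exists[OF \<phi>] i by blast
  note km = R.kernel_mor[OF k(1)] and kv = kernel_mor[OF k(2)]
  have "k = Zero R K X" using R.monic_zero[OF m km(2,3)] .
  then have z: "k i = Zero C (at_vert K i) (at_vert X i)" using i by simp
  show ?thesis
  proof (rule monicI[OF kv(1)])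
    fix W g assume g: "mor C W (at_vert X i) g" "\<phi> i \<cdot> g = Zero C W (at_vert Y i)"
    then obtain u where "mor C W (at_vert K i) u" "k i \<cdot> u = g" using kernel_lift[OF k(2)] by blast
    then show "g = Zero C W (at_vert X i)" using z zero_left mor_objD[OF kv(1)] by metis
  qed
qed

lemma rep_monicI:
  assumes \<phi>: "mor R X Y \<phi>" and v: "\<forall>i\<in>verts Q. monic C (at_vert X i) (at_vert Y i) (\<phi> i)" shows "monic R X Y \<phi>"
proof (rule R.monicI[OF \<phi>])
  fix W g assume g: "mor R W X g" and z: "\<phi> \<odot> g = Zero R W Y"
  show "g = Zero R W X"
  proof (rule mor_eqI[OF g R.mor_zero])
    fix i assume i: "i \<in> verts Q"
    have "\<phi> i \<cdot> g i = Zero C (at_vert W i) (at_vert Y i)" using fun_cong[OF z, of i] i by simp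
    then show "g i = Zero R W X i" using monic_zero[OF bspec[OF v i] mor_vert[OF g i]] i by simp
  qed (use g mor_obj in auto)
qed

text \<open>
  Some kernel is vertexwise a kernel, by construction, and any other one is isomorphic to it.
\<close>

lemma rep_kernel_vert:
  assumes k: "is_kernel R X Y \<phi> K k" and i: "i \<in> verts Q"
  shows "is_kernel C (at_vert X i) (at_vert Y i) (\<phi> i) (at_vert K i) (k i)"
proof -
  note km = R.kernel_mor[OF k]
  obtain K' k' where k': "is_kernel R X Y \<phi> K' k'" "is_kernel C (at_vert X i) (at_vert Y i) (\<phi> i) (at_vert K' i) (k' i)"
    using rep_kernel_exists[OF km(1)] i by blast
  note km' = R.kernel_mor[OF k'(1)]
  obtain u where u: "mor R K' K u" "k \<odot> u = k'" using R.kernel_lift[OF k km'(2,3)] .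
  have ui: "k i \<cdot> u i = k' i" using fun_cong[OF u(2), of i] i by simp
  show ?thesis
  proof (rule kernelI[OF mor_vert[OF km(1) i] rep_monic_vert[OF km(4) i]])
    show "\<phi> i \<cdot> k i = Zero C (at_vert K i) (at_vert Y i)" using fun_cong[OF km(3), of i] i by simp
    fix W h assume "mor C W (at_vert X i) h" "\<phi> i \<cdot> h = Zero C W (at_vert Y i)"
    then obtain w where w: "mor C W (at_vert K' i) w" "k' i \<cdot> w = h" using kernel_lift[OF k'(2)] by blast
    then have "k i \<cdot> (u i \<cdot> w) = h" using comp_cong[OF w(1) mor_vert[OF u(1) i] mor_vert[OF km(2) i] ui] by simp
    then show "\<exists>u. mor C W (at_vert K i) u \<and> k i \<cdot> u = h" using mor_comp[OF w(1) mor_vert[OF u(1) i]] by blast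
  qed
qed

lemma rep_epic_vert: "epic R X Y \<phi> \<Longrightarrow> i \<in> verts Q \<Longrightarrow> epic C (at_vert X i) (at_vert Y i) (\<phi> i)"
  using quiver_rep.rep_monic_vert[OF quiver_rep_op, of Y X \<phi> i] by (simp add: Rep_op)

lemma rep_epicI:
  "mor R X Y \<phi> \<Longrightarrow> \<forall>i\<in>verts Q. epic C (at_vert X i) (at_vert Y i) (\<phi> i) \<Longrightarrow> epic R X Y \<phi>"
  using quiver_rep.rep_monicI[OF quiver_rep_op, of Y X \<phi>] by (simp add: Rep_op)

lemma rep_cokernel_vert:
  "is_cokernel R X Y \<phi> K k \<Longrightarrow> i \<in> verts Q \<Longrightarrow>
    is_cokernel C (at_vert X i) (at_vert Y i) (\<phi> i) (at_vert K i) (k i)"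
  using quiver_rep.rep_kernel_vert[OF quiver_rep_op, of Y X \<phi> K k i] by (simp add: Rep_op)

lemma rep_cokernel_exists:
  assumes "mor R X Y \<phi>" shows "\<exists>K k. is_cokernel R X Y \<phi> K k"
proof -
  have "\<exists>K k. is_kernel (op_cat R) Y X \<phi> K k"
    using quiver_rep.rep_kernel_exists[OF quiver_rep_op, of Y X \<phi>] assms unfolding Rep_op by auto
  then show ?thesis by simp
qed

lemma rep_monic_is_kernel:
  assumes m: "monic R X Y \<phi>" shows "\<exists>Z g. is_kernel R Y Z g X \<phi>"
proof -
  note \<phi> = R.monicD[OF m]
  obtain Z g where g: "is_cokernel R X Y \<phi> Z g" using rep_cokernel_exists[OF \<phi>] by blast
  have "is_kernel R Y Z g X \<phi>"
    by (rule rep_kernelI[OF R.cokernel_mor(2)[OF g] \<phi>])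
      (use monic_kernel_of_cokernel rep_monic_vert[OF m] rep_cokernel_vert[OF g] in blast)
  then show ?thesis by blast
qed

lemma rep_direct_sum_exists:
  assumes I: "finite I" and X: "\<forall>k\<in>I. X k \<in> Obj R"
  shows "\<exists>S inc prj. direct_sum R I X S inc prj"
proof -
  have "\<exists>S inc prj. direct_sum C I (\<lambda>k. at_vert (X k) i) S inc prj" if "i \<in> verts Q" for i
    using ex_direct_sum[OF I, of "\<lambda>k. at_vert (X k) i"] X obj_vert that by metis
  then obtain S inc prj where
    d: "\<And>i. i \<in> verts Q \<Longrightarrow> direct_sum C I (\<lambda>k. at_vert (X k) i) (S i) (inc i) (prj i)" by metis
  have "\<exists>s. mor C (S (tail Q a)) (S (head Q a)) s \<and>
    (\<forall>k\<in>I. prj (head Q a) k \<cdot> s = at_arc (X k) a \<cdot> prj (tail Q a) k)" if a: "a \<in> arcs Q" for a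
  proof (rule ds_pair[OF d[OF arc_verts(2)[OF a]] ds_obj(1)[OF d[OF arc_verts(1)[OF a]]]], rule ballI)
    fix k assume k: "k \<in> I"
    show "mor C (S (tail Q a)) (at_head (X k) a) (at_arc (X k) a \<cdot> prj (tail Q a) k)"
      using mor_comp ds_mor(2)[OF d[OF arc_verts(1)[OF a]] k] obj_arc[OF bspec[OF X k] a] by blast
  qed
  then obtain s where s: "\<And>a. a \<in> arcs Q \<Longrightarrow> mor C (S (tail Q a)) (S (head Q a)) (s a)"
    "\<And>a. a \<in> arcs Q \<Longrightarrow> \<forall>k\<in>I. prj (head Q a) k \<cdot> s a = at_arc (X k) a \<cdot> prj (tail Q a) k" by metis
  define S' :: "('v, 'a, 'o, 'm) rep" where "S' = \<lparr>at_vert = restrict S (verts Q), at_arc = restrict s (arcs Q)\<rparr>"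
  have S': "S' \<in> Obj R" unfolding S'_def by (rule obj_intro) (use s ds_obj(1)[OF d] in auto)
  have S's: "at_vert S' i = S i" if "i \<in> verts Q" for i using that by (simp add: S'_def)
  have S'a: "at_arc S' a = s a" if "a \<in> arcs Q" for a using that by (simp add: S'_def)
  define inc' where "inc' k = restrict (\<lambda>i. inc i k) (verts Q)" for k
  define prj' where "prj' k = restrict (\<lambda>i. prj i k) (verts Q)" for k
  have p: "mor R S' (X k) (prj' k)" if k: "k \<in> I" for k unfolding prj'_def
    by (intro mor_intro S' ballI) (use k X S's S'a ds_mor(2)[OF d k] s(2) arc_verts in auto)
  have i: "mor R (X k) S' (inc' k)" if k: "k \<in> I" for k unfolding inc'_def
  proof (intro mor_intro S' ballI)
    fix a assume a: "a \<in> arcs Q"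
    note t = d[OF arc_verts(1)[OF a]] and h = d[OF arc_verts(2)[OF a]]
    note Xk = obj_arc[OF bspec[OF X k] a]
    have "inc (head Q a) k \<cdot> at_arc (X k) a = s a \<cdot> inc (tail Q a) k"
    proof (rule ds_eq_prj[OF h mor_comp[OF Xk ds_mor(1)[OF h k]] mor_comp[OF ds_mor(1)[OF t k] s(1)[OF a]]])
      fix l assume l: "l \<in> I"
      have "prj (head Q a) l \<cdot> (s a \<cdot> inc (tail Q a) k) = at_arc (X l) a \<cdot> (prj (tail Q a) l \<cdot> inc (tail Q a) k)"
        by (rule comp_square[OF ds_mor(1)[OF t k] s(1)[OF a] ds_mor(2)[OF h l] ds_mor(2)[OF t l] obj_arc[OF bspec[OF X l] a] bspec[OF s(2)[OF a] l]])
      then show "prj (head Q a) l \<cdot> (inc (head Q a) k \<cdot> at_arc (X k) a) = prj (head Q a) l \<cdot> (s a \<cdot> inc (tail Q a) k)"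
        using ds_prj_inc_comp[OF h l k Xk] ds_prj_inc[OF t l k] id_right[OF Xk] zero_right[OF obj_arc[OF bspec[OF X l] a]]
          mor_objD(1)[OF Xk] by auto
    qed
    then show "inc (head Q a) k \<cdot> at_arc (X k) a = at_arc S' a \<cdot> inc (tail Q a) k" using S'a[OF a] by simp
  qed (use k X S's ds_mor(1)[OF d k] in auto)
  have "direct_sum R I X S' inc' prj'"
  proof (rule R.direct_sumI[OF I S' i p])
    fix k assume k: "k \<in> I"
    show "prj' k \<odot> inc' k = Ident R (X k)"
      by (rule mor_eqI[OF R.mor_comp[OF i[OF k] p[OF k]] R.mor_id])
        (use X k ds_prj_inc[OF d k k] in \<open>auto simp: inc'_def prj'_def\<close>)
    fix l assume l: "l \<in> I" and kl: "k \<noteq> l"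
    show "prj' k \<odot> inc' l = Zero R (X l) (X k)"
      by (rule mor_eqI[OF R.mor_comp[OF i[OF l] p[OF k]] R.mor_zero])
        (use X k l kl ds_prj_inc[OF d k l] in \<open>auto simp: inc'_def prj'_def\<close>)
  next
    fix u v assume u: "mor R S' S' u" and v: "mor R S' S' v" and e: "\<And>k. k \<in> I \<Longrightarrow> prj' k \<odot> u = prj' k \<odot> v"
    show "u = v"
    proof (rule mor_eqI[OF u v])
      fix j assume j: "j \<in> verts Q"
      show "u j = v j"
      proof (rule ds_eq_prj[OF d[OF j]])
        show "mor C (at_vert S' j) (S j) (u j)" "mor C (at_vert S' j) (S j) (v j)" using mor_vert u v j S's by metis+
        fix k assume "k \<in> I"
        then show "prj j k \<cdot> u j = prj j k \<cdot> v j" using fun_cong[OF e, of k j] j by (simp add: prj'_def)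
      qed
    qed
  qed
  then show ?thesis by blast
qed

lemma abelian_Rep: "abelian_category R"
proof (rule abelian_category.intro[OF preadditive_Rep], rule abelian_category_axioms.intro)
  fix Xs assume "set Xs \<subseteq> Obj R"
  then have "\<forall>k\<in>{..<length Xs}. Xs ! k \<in> Obj R" using nth_mem by fastforce
  then show "\<exists>S. is_dsum R Xs S" using rep_direct_sum_exists[of "{..<length Xs}"] unfolding is_dsum_def by blast
next
  fix X Y f assume "X \<in> Obj R" "Y \<in> Obj R" "f \<in> Hom R X Y"
  then have f: "mor R X Y f" by (simp add: mor_def)
  show "\<exists>K k. is_kernel R X Y f K k" using rep_kernel_exists[OF f] by blast
  show "\<exists>K c. is_cokernel R X Y f K c" using rep_cokernel_exists[OF f] .
next
  fix X Y f assume "epic R X Y f"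
  then show "\<exists>W g. is_cokernel R W X g Y f"
    using quiver_rep.rep_monic_is_kernel[OF quiver_rep_op, of Y X f] by (simp add: Rep_op)
qed (rule rep_monic_is_kernel)

lemma rep_hom_sum_vert:
  assumes "finite I" and o: "X \<in> Obj R" "Y \<in> Obj R" and "\<forall>k\<in>I. mor R X Y (f k)" and i: "i \<in> verts Q"
  shows "hom_sum R X Y f I i = hom_sum C (at_vert X i) (at_vert Y i) (\<lambda>k. f k i) I"
  using assms(1,4)
proof (induction I rule: finite_induct)
  case empty
  show ?case unfolding R.hom_sum_empty[OF o] hom_sum_empty[OF obj_vert[OF o(1) i] obj_vert[OF o(2) i]] using i by simp
next
  case (insert l I)
  have "hom_sum R X Y f (insert l I) = Plus R (f l) (hom_sum R X Y f I)"
    by (rule R.hom_sum_insert[OF o insert(1,2)]) (use insert(4) in auto)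
  then have "hom_sum R X Y f (insert l I) i = Plus C (f l i) (hom_sum C (at_vert X i) (at_vert Y i) (\<lambda>k. f k i) I)"
    using insert(3,4) i by (simp add: Rep_simps)
  also have "\<dots> = hom_sum C (at_vert X i) (at_vert Y i) (\<lambda>k. f k i) (insert l I)"
    by (rule hom_sum_insert[symmetric, OF obj_vert[OF o(1) i] obj_vert[OF o(2) i] insert(1,2)])
      (use insert(4) mor_vert i in auto)
  finally show ?case .
qed

lemma rep_direct_sum_vert:
  assumes d: "direct_sum R I X S inc prj" and i: "i \<in> verts Q"
  shows "direct_sum C I (\<lambda>k. at_vert (X k) i) (at_vert S i) (\<lambda>k. inc k i) (\<lambda>k. prj k i)"
proof -
  note S = R.ds_obj(1)[OF d] and fin = R.ds_obj(2)[OF d]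
  have m: "\<forall>k\<in>I. mor R S S (inc k \<odot> prj k)" using R.mor_comp R.ds_mor[OF d] by blast
  have "hom_sum R S S (\<lambda>k. inc k \<odot> prj k) I = Ident R S" using d by (simp add: direct_sum_def)
  from fun_cong[OF this, of i] have s: "hom_sum C (at_vert S i) (at_vert S i) (\<lambda>k. inc k i \<cdot> prj k i) I = Ident C (at_vert S i)"
    using rep_hom_sum_vert[OF fin S S m i] i by simp
  have p: "prj k i \<cdot> inc l i = (if k = l then Ident C (at_vert (X k) i) else Zero C (at_vert (X l) i) (at_vert (X k) i))"
    if "k \<in> I" "l \<in> I" for k l
    using fun_cong[OF R.ds_prj_inc[OF d that], of i] i by (cases "k = l") auto
  show ?thesis unfolding direct_sum_def
    using fin obj_vert[OF S i] R.ds_mor[OF d, THEN mor_vert, OF _ i] p s by (auto simp: mor_def)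
qed

end

section \<open>Paths and the right adjoints of evaluation\<close>

text \<open>
  The head comes first: well-founded induction along this relation may use the heads of the arcs
  that start at a vertex when it treats that vertex.
\<close>

definition arc_rel :: "('v, 'a) pre_digraph \<Rightarrow> ('v \<times> 'v) set" where
  "arc_rel Q = {(head Q a, tail Q a) | a. a \<in> arcs Q}"

lemma arc_rel_op: "arc_rel (op_quiver Q) = (arc_rel Q)\<inverse>"
  by (auto simp: arc_rel_def)

lemma paths_Nil: "[] \<in> paths Q j i \<longleftrightarrow> j = i \<and> i \<in> verts Q"
  by (auto simp: paths_def pre_digraph.awalk_def pre_digraph.cas.simps)

lemma paths_Cons:
  assumes "wf_digraph Q"
  shows "a # p \<in> paths Q j i \<longleftrightarrow> a \<in> arcs Q \<and> tail Q a = j \<and> p \<in> paths Q (head Q a) i"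
  using wf_digraph.tail_in_verts[OF assms, of a] wf_digraph.head_in_verts[OF assms, of a]
  by (auto simp: paths_def pre_digraph.awalk_def pre_digraph.cas.simps)

lemma acyclic_arc_rel:
  assumes Q: "wf_digraph Q" and ac: "acyclic_quiver Q" shows "acyclic (arc_rel Q)"
proof -
  interpret wf_digraph Q by fact
  have w: "\<exists>p. p \<noteq> [] \<and> awalk v p u" if "(u, v) \<in> (arc_rel Q)\<^sup>+" for u v
    using that
  proof (induction rule: trancl_induct)
    case (base v)
    then obtain a where a: "a \<in> arcs Q" "v = tail Q a" "u = head Q a" by (auto simp: arc_rel_def)
    then have "awalk v [a] u" by (auto simp: awalk_def)
    then show ?case by blast
  next
    case (step v w)
    then obtain p where p: "p \<noteq> []" "awalk v p u" by blast
    from step obtain a where a: "a \<in> arcs Q" "w = tail Q a" "v = head Q a" by (auto simp: arc_rel_def)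
    then have "awalk w (a # p) u" using p by (auto simp: awalk_def)
    then show ?case by blast
  qed
  show ?thesis
  proof (rule acyclicI, rule allI, rule notI)
    fix u assume "(u, u) \<in> (arc_rel Q)\<^sup>+"
    then obtain p where "p \<noteq> []" "awalk u p u" using w by blast
    then have "closed_w p" by (auto simp: closed_w_def)
    then show False using closed_w_imp_cycle ac by (auto simp: acyclic_quiver_def)
  qed
qed

locale acyclic_quiver_rep = quiver_rep C Q
  for C :: "('o, 'm) preadd_cat" (structure) and Q :: "('v, 'a) pre_digraph" +
  assumes finite_verts: "finite (verts Q)" and finite_arcs: "finite (arcs Q)"
    and acyclic: "acyclic (arc_rel Q)"
begin

sublocale R: abelian_category "Rep Q C"
  by (rule abelian_Rep)

lemma finite_arc_rel: "finite (arc_rel Q)"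
proof -
  have "arc_rel Q = (\<lambda>a. (head Q a, tail Q a)) ` arcs Q" by (auto simp: arc_rel_def)
  then show ?thesis using finite_arcs by simp
qed

lemma wf_arc_rel: "wf (arc_rel Q)"
  by (rule finite_acyclic_wf[OF finite_arc_rel acyclic])

lemma acyclic_quiver_rep_op: "acyclic_quiver_rep (op_cat C) (op_quiver Q)"
  by (intro acyclic_quiver_rep.intro quiver_rep_op acyclic_quiver_rep_axioms.intro)
    (simp_all add: finite_verts finite_arcs arc_rel_op acyclic)

lemma finite_out_arcs: "finite (out_arcs Q j)"
  by (rule finite_subset[OF _ finite_arcs]) (auto simp: out_arcs_def)

lemma vertex_induct [consumes 1, case_names vertex]:
  assumes j: "j \<in> verts Q"
    and step: "\<And>j. j \<in> verts Q \<Longrightarrow> (\<And>a. a \<in> out_arcs Q j \<Longrightarrow> P (head Q a)) \<Longrightarrow> P j"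
  shows "P j"
  using j
proof (induction j rule: wf_induct_rule[OF wf_arc_rel])
  case (1 j)
  show ?case
    by (rule step[OF 1(2)]) (use 1 arc_verts in \<open>auto simp: arc_rel_def out_arcs_def\<close>)
qed

lemma finite_paths:
  assumes "j \<in> verts Q" shows "finite (paths Q j i)"
  using assms
proof (induction j rule: vertex_induct)
  case (vertex j)
  have "paths Q j i \<subseteq> insert [] (\<Union>a\<in>out_arcs Q j. (#) a ` paths Q (head Q a) i)"
  proof
    fix p assume p: "p \<in> paths Q j i"
    then show "p \<in> insert [] (\<Union>a\<in>out_arcs Q j. (#) a ` paths Q (head Q a) i)"
      using paths_Cons[OF quiver] by (cases p) auto
  qed
  moreover have "finite (insert [] (\<Union>a\<in>out_arcs Q j. (#) a ` paths Q (head Q a) i))"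
    using vertex(2) finite_out_arcs by simp
  ultimately show ?case by (rule finite_subset)
qed

text \<open>
  Commutation with an arc that starts at \<open>j\<close> relates the component at \<open>j\<close> to the component at the head
  of the arc.  So the components can be chosen recursively along the arcs, and the only requirement
  at \<open>j\<close> is to lift the given components at the heads; \<open>P\<close> records further conditions on the
  components.
\<close>

lemma mor_by_recursion:
  assumes X: "X \<in> Obj R" and M: "M \<in> Obj R"
    and step: "\<And>j \<psi>. j \<in> verts Q \<Longrightarrow>
      \<forall>a\<in>out_arcs Q j. mor C (at_head X a) (at_head M a) (\<psi> (head Q a)) \<and> P (head Q a) (\<psi> (head Q a)) \<Longrightarrow>
      \<exists>f. mor C (at_vert X j) (at_vert M j) f \<and> P j f \<and>
        (\<forall>a\<in>out_arcs Q j. at_arc M a \<cdot> f = \<psi> (head Q a) \<cdot> at_arc X a)"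
  shows "\<exists>\<phi>. mor R X M \<phi> \<and> (\<forall>j\<in>verts Q. P j (\<phi> j))"
proof -
  define S where "S \<psi> j f \<longleftrightarrow> (j \<in> verts Q \<longrightarrow> mor C (at_vert X j) (at_vert M j) f \<and> P j f \<and>
        (\<forall>a\<in>out_arcs Q j. at_arc M a \<cdot> f = \<psi> (head Q a) \<cdot> at_arc X a))" for \<psi> j f
  have "\<exists>\<phi>. \<forall>j. S \<phi> j (\<phi> j)"
  proof (rule dependent_wf_choice[OF wf_arc_rel])
    fix f g :: "'v \<Rightarrow> 'm" and j r assume e: "\<And>z. (z, j) \<in> arc_rel Q \<Longrightarrow> f z = g z"
    have "f (head Q a) = g (head Q a)" if "a \<in> out_arcs Q j" for a
      using e that by (auto simp: arc_rel_def out_arcs_def)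
    then show "S f j r = S g j r" by (simp add: S_def)
  next
    fix j \<psi> assume e: "\<And>y. (y, j) \<in> arc_rel Q \<Longrightarrow> S \<psi> y (\<psi> y)"
    show "\<exists>r. S \<psi> j r"
    proof (cases "j \<in> verts Q")
      case True
      have "mor C (at_head X a) (at_head M a) (\<psi> (head Q a)) \<and> P (head Q a) (\<psi> (head Q a))"
        if "a \<in> out_arcs Q j" for a
        using e[of "head Q a"] that arc_verts by (auto simp: arc_rel_def out_arcs_def S_def)
      then show ?thesis using step[OF True, of \<psi>] by (auto simp: S_def)
    qed (simp add: S_def)
  qed
  then obtain \<phi> where \<phi>: "\<And>j. S \<phi> j (\<phi> j)" by blast
  have "mor R X M (restrict \<phi> (verts Q))"
    by (intro mor_intro X M ballI) (use \<phi> arc_verts in \<open>auto simp: S_def out_arcs_def\<close>)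
  then show ?thesis using \<phi> by (intro exI[of _ "restrict \<phi> (verts Q)"]) (auto simp: S_def)
qed

lemma copower_direct_sum:
  assumes "finite I" "A \<in> Obj C"
  shows "direct_sum C I (\<lambda>_. A) (copower C I A) (copower_inc C I A) (copower_prj C I A)"
proof -
  obtain S inc prj where "direct_sum C I (\<lambda>_. A) S inc prj" using ex_direct_sum[OF assms(1), of "\<lambda>_. A"] assms(2) by blast
  then have "\<exists>x. case x of (S, inc, prj) \<Rightarrow> direct_sum C I (\<lambda>_. A) S inc prj" by (intro exI[of _ "(S, inc, prj)"]) simp
  then have "case copower_data C I A of (S, inc, prj) \<Rightarrow> direct_sum C I (\<lambda>_. A) S inc prj"
    unfolding copower_data_def by (rule someI_ex)
  then show ?thesis by (auto simp: copower_def copower_inc_def copower_prj_def split: prod.splits)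
qed

abbreviation einc where "einc i A j \<equiv> copower_inc C (paths Q j i) A"
abbreviation eprj where "eprj i A j \<equiv> copower_prj C (paths Q j i) A"

lemma e_rho_ds:
  assumes "A \<in> Obj C" "j \<in> verts Q"
  shows "direct_sum C (paths Q j i) (\<lambda>_. A) (at_vert (e_rho Q C i A) j) (einc i A j) (eprj i A j)"
  using copower_direct_sum[OF finite_paths[OF assms(2)] assms(1)] assms(2) by (simp add: e_rho_def)

lemma e_rho_arc:
  assumes A: "A \<in> Obj C" and a: "a \<in> arcs Q"
  shows "mor C (at_vert (e_rho Q C i A) (tail Q a)) (at_head (e_rho Q C i A) a) (at_arc (e_rho Q C i A) a)"
    and "q \<in> paths Q (head Q a) i \<Longrightarrow>
      eprj i A (head Q a) q \<cdot> at_arc (e_rho Q C i A) a = eprj i A (tail Q a) (a # q)"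
proof -
  note t = arc_verts(1)[OF a] and h = arc_verts(2)[OF a]
  have v: "at_vert (e_rho Q C i A) j = copower C (paths Q j i) A" if "j \<in> verts Q" for j using that by (simp add: e_rho_def)
  have e: "at_arc (e_rho Q C i A) a = hom_sum C (at_vert (e_rho Q C i A) (tail Q a)) (at_head (e_rho Q C i A) a)
      (\<lambda>q. einc i A (head Q a) q \<cdot> eprj i A (tail Q a) (a # q)) (paths Q (head Q a) i)"
    using a v t h by (simp add: e_rho_def)
  have m: "mor C (at_vert (e_rho Q C i A) (tail Q a)) A (eprj i A (tail Q a) (a # q))" if "q \<in> paths Q (head Q a) i" for q
    using ds_mor(2)[OF e_rho_ds[OF A t]] paths_Cons[OF quiver] a that by blast
  note * = ds_pair_hom_sum[OF e_rho_ds[OF A h] ds_obj(1)[OF e_rho_ds[OF A t]], where f="\<lambda>q. eprj i A (tail Q a) (a # q)"]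
  show "mor C (at_vert (e_rho Q C i A) (tail Q a)) (at_head (e_rho Q C i A) a) (at_arc (e_rho Q C i A) a)"
    unfolding e by (rule *(1)) (rule m)
  show "eprj i A (head Q a) q \<cdot> at_arc (e_rho Q C i A) a = eprj i A (tail Q a) (a # q)" if "q \<in> paths Q (head Q a) i"
    unfolding e by (rule *(2)) (use m that in auto)
qed

lemma e_rho_obj:
  assumes A: "A \<in> Obj C" shows "e_rho Q C i A \<in> Obj R"
proof -
  let ?V = "e_rho Q C i A"
  have "\<lparr>at_vert = restrict (at_vert ?V) (verts Q), at_arc = restrict (at_arc ?V) (arcs Q)\<rparr> \<in> Obj R"
    by (intro obj_intro ballI ds_obj(1)[OF e_rho_ds[OF A]] e_rho_arc(1)[OF A])
  then show ?thesis by (simp add: e_rho_def restrict_def cong: if_cong)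
qed

text \<open>
  The arc \<open>a\<close> forgets the copies of \<open>A\<close> at paths that do not begin with \<open>a\<close>, and moves the copy at
  \<open>a # q\<close> to the copy at \<open>q\<close>.
\<close>

lemma e_rho_arc_inc:
  assumes A: "A \<in> Obj C" and a: "a \<in> arcs Q" and p: "p \<in> paths Q (tail Q a) i"
  shows "at_arc (e_rho Q C i A) a \<cdot> einc i A (tail Q a) p =
    (if p \<noteq> [] \<and> hd p = a then einc i A (head Q a) (tl p) else Zero C A (at_head (e_rho Q C i A) a))"
proof -
  note t = e_rho_ds[OF A arc_verts(1)[OF a], of i] and h = e_rho_ds[OF A arc_verts(2)[OF a], of i]
  note Va = e_rho_arc[OF A a, where i=i]
  have pt: "tl p \<in> paths Q (head Q a) i" if "p \<noteq> []" "hd p = a" using p paths_Cons[OF quiver] that by (cases p) auto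
  show ?thesis
  proof (rule ds_eq_prj[OF h mor_comp[OF ds_mor(1)[OF t p] Va(1)]])
    show "mor C A (at_head (e_rho Q C i A) a)
       (if p \<noteq> [] \<and> hd p = a then einc i A (head Q a) (tl p) else Zero C A (at_head (e_rho Q C i A) a))"
      using ds_mor(1)[OF h pt] mor_zero[OF A ds_obj(1)[OF h]] by auto
    fix q assume q: "q \<in> paths Q (head Q a) i"
    then have aq: "a # q \<in> paths Q (tail Q a) i" using paths_Cons[OF quiver] a by blast
    have "eprj i A (head Q a) q \<cdot> (at_arc (e_rho Q C i A) a \<cdot> einc i A (tail Q a) p)
        = (if a # q = p then Ident C A else Zero C A A)"
      using comp_cong[OF ds_mor(1)[OF t p] Va(1) ds_mor(2)[OF h q] Va(2)[OF q]] ds_prj_inc[OF t aq p] by simp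
    also have "\<dots> = eprj i A (head Q a) q \<cdot>
       (if p \<noteq> [] \<and> hd p = a then einc i A (head Q a) (tl p) else Zero C A (at_head (e_rho Q C i A) a))"
      using ds_prj_inc[OF h q pt] zero_right[OF ds_mor(2)[OF h q] A] by (cases p) auto
    finally show "eprj i A (head Q a) q \<cdot> (at_arc (e_rho Q C i A) a \<cdot> einc i A (tail Q a) p) = eprj i A (head Q a) q \<cdot>
       (if p \<noteq> [] \<and> hd p = a then einc i A (head Q a) (tl p) else Zero C A (at_head (e_rho Q C i A) a))" .
  qed
qed

abbreviation ecounit where "ecounit i A \<equiv> eprj i A i []"

lemma ecounit_mor:
  assumes "A \<in> Obj C" "i \<in> verts Q" shows "mor C (at_vert (e_rho Q C i A) i) A (ecounit i A)"
  using ds_mor(2)[OF e_rho_ds[OF assms]] assms(2) by (simp add: paths_Nil)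

text \<open>
  Existence and, in \<open>e_rho_unique\<close>, uniqueness of the transpose of \<open>f\<close>.  The component of the
  transpose at a path \<open>a # q\<close> is forced by the component at \<open>q\<close>, because the projection at \<open>a # q\<close> is
  the arc followed by the projection at \<open>q\<close>; only the component at the empty path is free.
\<close>

lemma e_rho_universal:
  assumes X: "X \<in> Obj R" and i: "i \<in> verts Q" and f: "mor C (at_vert X i) A f"
  shows "\<exists>\<phi>. mor R X (e_rho Q C i A) \<phi> \<and> ecounit i A \<cdot> \<phi> i = f"
proof -
  have A: "A \<in> Obj C" using f mor_objD by auto
  note V = e_rho_obj[OF A, of i]
  have "\<exists>\<phi>. mor R X (e_rho Q C i A) \<phi> \<and> (\<forall>j\<in>verts Q. j = i \<longrightarrow> ecounit i A \<cdot> \<phi> j = f)"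
  proof (rule mor_by_recursion[OF X V])
    fix j \<psi> assume j: "j \<in> verts Q"
      and \<psi>: "\<forall>a\<in>out_arcs Q j. mor C (at_head X a) (at_head (e_rho Q C i A) a) (\<psi> (head Q a)) \<and>
        (head Q a = i \<longrightarrow> ecounit i A \<cdot> \<psi> (head Q a) = f)"
    define g where "g p = (case p of [] \<Rightarrow> f | a # q \<Rightarrow> eprj i A (head Q a) q \<cdot> (\<psi> (head Q a) \<cdot> at_arc X a))" for p
    have "\<forall>p\<in>paths Q j i. mor C (at_vert X j) A (g p)"
    proof
      fix p assume p: "p \<in> paths Q j i"
      show "mor C (at_vert X j) A (g p)"
      proof (cases p)
        case Nil
        then show ?thesis using p f by (auto simp: g_def paths_Nil)
      next
        case (Cons a q)
        then have a: "a \<in> arcs Q" "tail Q a = j" "q \<in> paths Q (head Q a) i" using p paths_Cons[OF quiver] by auto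
        have "mor C (at_head X a) (at_head (e_rho Q C i A) a) (\<psi> (head Q a))"
          using \<psi> a by (auto simp: out_arcs_def)
        from mor_comp[OF mor_comp[OF obj_arc[OF X a(1)] this] ds_mor(2)[OF e_rho_ds[OF A arc_verts(2)[OF a(1)]] a(3)]]
        show ?thesis using a(2) Cons by (simp add: g_def)
      qed
    qed
    from ds_pair[OF e_rho_ds[OF A j] obj_vert[OF X j] this]
    obtain u where u: "mor C (at_vert X j) (at_vert (e_rho Q C i A) j) u" "\<forall>p\<in>paths Q j i. eprj i A j p \<cdot> u = g p" by blast
    have "at_arc (e_rho Q C i A) a \<cdot> u = \<psi> (head Q a) \<cdot> at_arc X a" if a: "a \<in> out_arcs Q j" for a
    proof -
      have a': "a \<in> arcs Q" "tail Q a = j" using a by (auto simp: out_arcs_def)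
      note h = e_rho_ds[OF A arc_verts(2)[OF a'(1)], of i] and Va = e_rho_arc[OF A a'(1), where i=i, unfolded a'(2)]
      have \<psi>a: "mor C (at_head X a) (at_head (e_rho Q C i A) a) (\<psi> (head Q a))" using \<psi> a by blast
      show ?thesis
      proof (rule ds_eq_prj[OF h mor_comp[OF u(1) Va(1)] mor_comp[OF obj_arc[OF X a'(1), unfolded a'(2)] \<psi>a]])
        fix q assume q: "q \<in> paths Q (head Q a) i"
        then have "a # q \<in> paths Q j i" using paths_Cons[OF quiver] a' by blast
        then show "eprj i A (head Q a) q \<cdot> (at_arc (e_rho Q C i A) a \<cdot> u) = eprj i A (head Q a) q \<cdot> (\<psi> (head Q a) \<cdot> at_arc X a)"
          using comp_cong[OF u(1) Va(1) ds_mor(2)[OF h q] Va(2)[OF q]] u(2) by (simp add: g_def)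
      qed
    qed
    moreover have "j = i \<longrightarrow> ecounit i A \<cdot> u = f" using u(2) i by (auto simp: g_def paths_Nil)
    ultimately show "\<exists>h. mor C (at_vert X j) (at_vert (e_rho Q C i A) j) h \<and> (j = i \<longrightarrow> ecounit i A \<cdot> h = f) \<and>
        (\<forall>a\<in>out_arcs Q j. at_arc (e_rho Q C i A) a \<cdot> h = \<psi> (head Q a) \<cdot> at_arc X a)" using u(1) by blast
  qed
  then show ?thesis using i by blast
qed

lemma e_rho_unique:
  assumes A: "A \<in> Obj C" and i: "i \<in> verts Q" and \<phi>: "mor R X (e_rho Q C i A) \<phi>" and \<phi>': "mor R X (e_rho Q C i A) \<phi>'"
    and e: "ecounit i A \<cdot> \<phi> i = ecounit i A \<cdot> \<phi>' i"
  shows "\<phi> = \<phi>'"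
proof -
  note X = mor_obj(1)[OF \<phi>]
  have "eprj i A j p \<cdot> \<phi> j = eprj i A j p \<cdot> \<phi>' j" if "p \<in> paths Q j i" "j \<in> verts Q" for p j
    using that
  proof (induction p arbitrary: j)
    case Nil
    then show ?case using e by (simp add: paths_Nil)
  next
    case (Cons a q)
    then have a: "a \<in> arcs Q" "tail Q a = j" and q: "q \<in> paths Q (head Q a) i" using paths_Cons[OF quiver] by auto
    note h = arc_verts(2)[OF a(1)]
    note Va = e_rho_arc[OF A a(1), where i=i, unfolded a(2)]
    note pq = ds_mor(2)[OF e_rho_ds[OF A h] q]
    have *: "eprj i A j (a # q) \<cdot> \<chi> j = (eprj i A (head Q a) q \<cdot> \<chi> (head Q a)) \<cdot> at_arc X a"
      if \<chi>: "mor R X (e_rho Q C i A) \<chi>" for \<chi>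
    proof -
      have "eprj i A j (a # q) \<cdot> \<chi> j = eprj i A (head Q a) q \<cdot> (at_arc (e_rho Q C i A) a \<cdot> \<chi> j)"
        using comp_cong[OF mor_vert[OF \<chi> Cons(3)] Va(1) pq Va(2)[OF q]] by simp
      also have "\<dots> = eprj i A (head Q a) q \<cdot> (\<chi> (head Q a) \<cdot> at_arc X a)" using mor_arc[OF \<chi> a(1)] a(2) by simp
      finally show ?thesis using assoc[OF obj_arc[OF X a(1)] mor_vert[OF \<chi> h] pq] by simp
    qed
    show ?case using *[OF \<phi>] *[OF \<phi>'] Cons.IH[OF q h] by simp
  qed
  then show ?thesis
    by (intro mor_eqI[OF \<phi> \<phi>'] ds_eq_prj[OF e_rho_ds[OF A] mor_vert[OF \<phi>] mor_vert[OF \<phi>']]) auto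
qed

lemma e_rho_map:
  assumes u: "mor C A B u"
  shows "\<exists>U. mor R (e_rho Q C i A) (e_rho Q C i B) U \<and> (\<forall>j\<in>verts Q. \<forall>p\<in>paths Q j i.
    U j \<cdot> einc i A j p = einc i B j p \<cdot> u \<and> eprj i B j p \<cdot> U j = u \<cdot> eprj i A j p)"
proof -
  note AB = mor_objD[OF u]
  note dA = e_rho_ds[OF AB(1), of _ i] and dB = e_rho_ds[OF AB(2), of _ i]
  let ?V = "e_rho Q C i A" and ?W = "e_rho Q C i B"
  have "\<exists>U. mor C (at_vert ?V j) (at_vert ?W j) U \<and> (\<forall>p\<in>paths Q j i. U \<cdot> einc i A j p = einc i B j p \<cdot> u)" if j: "j \<in> verts Q" for j
    by (rule ds_copair[OF dA[OF j] ds_obj(1)[OF dB[OF j]]]) (use mor_comp[OF u ds_mor(1)[OF dB[OF j]]] in blast)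
  then obtain U where U: "\<And>j. j \<in> verts Q \<Longrightarrow> mor C (at_vert ?V j) (at_vert ?W j) (U j)"
    "\<And>j p. j \<in> verts Q \<Longrightarrow> p \<in> paths Q j i \<Longrightarrow> U j \<cdot> einc i A j p = einc i B j p \<cdot> u" by metis
  have Up: "eprj i B j p \<cdot> U j = u \<cdot> eprj i A j p" if j: "j \<in> verts Q" and p: "p \<in> paths Q j i" for j p
  proof (rule ds_eq_inc[OF dA[OF j] mor_comp[OF U(1)[OF j] ds_mor(2)[OF dB[OF j] p]] mor_comp[OF ds_mor(2)[OF dA[OF j] p] u]])
    fix q assume q: "q \<in> paths Q j i"
    note iA = ds_mor(1)[OF dA[OF j] q] and pB = ds_mor(2)[OF dB[OF j] p]
    have "(eprj i B j p \<cdot> U j) \<cdot> einc i A j q = eprj i B j p \<cdot> (einc i B j q \<cdot> u)"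
      using assoc[OF iA U(1)[OF j] pB] U(2)[OF j q] by simp
    also have "\<dots> = u \<cdot> (eprj i A j p \<cdot> einc i A j q)"
      using ds_prj_inc_comp[OF dB[OF j] p q u] ds_prj_inc[OF dA[OF j] p q] id_right[OF u] zero_right[OF u AB(1)] by simp
    finally show "(eprj i B j p \<cdot> U j) \<cdot> einc i A j q = (u \<cdot> eprj i A j p) \<cdot> einc i A j q"
      using assoc[OF iA ds_mor(2)[OF dA[OF j] p] u] by simp
  qed
  have "mor R ?V ?W (restrict U (verts Q))"
  proof (intro mor_intro ballI e_rho_obj AB)
    fix a assume a: "a \<in> arcs Q"
    note t = arc_verts(1)[OF a] and h = arc_verts(2)[OF a]
    note Va = e_rho_arc[OF AB(1) a, where i=i] and Wa = e_rho_arc[OF AB(2) a, where i=i]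
    show "U (head Q a) \<cdot> at_arc ?V a = at_arc ?W a \<cdot> U (tail Q a)"
    proof (rule ds_eq_prj[OF dB[OF h] mor_comp[OF Va(1) U(1)[OF h]] mor_comp[OF U(1)[OF t] Wa(1)]])
      fix q assume q: "q \<in> paths Q (head Q a) i"
      then have aq: "a # q \<in> paths Q (tail Q a) i" using a paths_Cons[OF quiver] by blast
      have "eprj i B (head Q a) q \<cdot> (U (head Q a) \<cdot> at_arc ?V a) = u \<cdot> (eprj i A (head Q a) q \<cdot> at_arc ?V a)"
        by (rule comp_square[OF Va(1) U(1)[OF h] ds_mor(2)[OF dB[OF h] q] ds_mor(2)[OF dA[OF h] q] u Up[OF h q]])
      also have "\<dots> = eprj i B (tail Q a) (a # q) \<cdot> U (tail Q a)" using Va(2)[OF q] Up[OF t aq] by simp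
      also have "\<dots> = eprj i B (head Q a) q \<cdot> (at_arc ?W a \<cdot> U (tail Q a))"
        using comp_cong[OF U(1)[OF t] Wa(1) ds_mor(2)[OF dB[OF h] q] Wa(2)[OF q]] by simp
      finally show "eprj i B (head Q a) q \<cdot> (U (head Q a) \<cdot> at_arc ?V a) = eprj i B (head Q a) q \<cdot> (at_arc ?W a \<cdot> U (tail Q a))" .
    qed
  qed (use U(1) in auto)
  then show ?thesis using U Up by (intro exI[of _ "restrict U (verts Q)"]) auto
qed

text \<open>
  Evaluation has the right adjoint \<open>e_rho\<close>, which preserves epimorphisms.  Thus a lifting problem at
  the vertex \<open>i\<close> is transposed to one in representations, and the solution is transposed back.
\<close>

lemma projective_vert:
  assumes P: "projective R P" and i: "i \<in> verts Q" shows "projective C (at_vert P i)"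
  unfolding projective_def
proof (intro conjI allI impI ballI)
  have PO: "P \<in> Obj R" using P by (simp add: projective_def)
  show "at_vert P i \<in> Obj C" using obj_vert[OF PO i] .
  fix X Y e f assume e: "epic C X Y e" and f: "f \<in> Hom C (at_vert P i) Y"
  note em = epicD[OF e]
  note XY = mor_objD[OF em]
  have f: "mor C (at_vert P i) Y f" using f XY(2) obj_vert[OF PO i] by (simp add: mor_def)
  obtain U where U: "mor R (e_rho Q C i X) (e_rho Q C i Y) U" "\<forall>j\<in>verts Q. \<forall>p\<in>paths Q j i.
    U j \<cdot> einc i X j p = einc i Y j p \<cdot> e \<and> eprj i Y j p \<cdot> U j = e \<cdot> eprj i X j p" using e_rho_map[OF em] by blast
  have "epic R (e_rho Q C i X) (e_rho Q C i Y) U"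
  proof (intro rep_epicI[OF U(1)] ballI)
    fix j assume j: "j \<in> verts Q"
    note dX = e_rho_ds[OF XY(1) j, of i] and dY = e_rho_ds[OF XY(2) j, of i] and Uj = mor_vert[OF U(1) j]
    show "epic C (at_vert (e_rho Q C i X) j) (at_vert (e_rho Q C i Y) j) (U j)"
    proof (rule epicI[OF Uj])
      fix Z g assume g: "mor C (at_vert (e_rho Q C i Y) j) Z g" and z: "g \<cdot> U j = Zero C (at_vert (e_rho Q C i X) j) Z"
      have Z: "Z \<in> Obj C" using g mor_objD by auto
      show "g = Zero C (at_vert (e_rho Q C i Y) j) Z"
      proof (rule ds_eq_inc[OF dY g mor_zero[OF ds_obj(1)[OF dY] Z]])
        fix p assume p: "p \<in> paths Q j i"
        note iX = ds_mor(1)[OF dX p] and iY = ds_mor(1)[OF dY p]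
        have "(g \<cdot> einc i Y j p) \<cdot> e = g \<cdot> (U j \<cdot> einc i X j p)" using assoc[OF em iY g] U(2) j p by simp
        also have "\<dots> = Zero C X Z" using comp_cong[OF iX Uj g z] zero_left[OF iX Z] by simp
        finally have "g \<cdot> einc i Y j p = Zero C Y Z" using epic_zero[OF e mor_comp[OF iY g]] by simp
        then show "g \<cdot> einc i Y j p = Zero C (at_vert (e_rho Q C i Y) j) Z \<cdot> einc i Y j p" using zero_left[OF iY Z] by simp
      qed
    qed
  qed
  moreover obtain \<phi> where \<phi>: "mor R P (e_rho Q C i Y) \<phi>" "ecounit i Y \<cdot> \<phi> i = f" using e_rho_universal[OF PO i f] by blast
  ultimately obtain \<psi> where \<psi>: "mor R P (e_rho Q C i X) \<psi>" "U \<odot> \<psi> = \<phi>"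
    using P mor_obj[OF U(1)] unfolding projective_def mor_def by blast
  have "[] \<in> paths Q i i" using i by (simp add: paths_Nil)
  then have Ui: "ecounit i Y \<cdot> U i = e \<cdot> ecounit i X" using U(2) i by blast
  note cX = ecounit_mor[OF XY(1) i] and cY = ecounit_mor[OF XY(2) i]
  have "e \<cdot> (ecounit i X \<cdot> \<psi> i) = ecounit i Y \<cdot> (U i \<cdot> \<psi> i)"
    using comp_square[OF mor_vert[OF \<psi>(1) i] mor_vert[OF U(1) i] cY cX em Ui] by simp
  also have "\<dots> = f" using fun_cong[OF \<psi>(2), of i] i \<phi>(2) by simp
  finally show "\<exists>g\<in>Hom C (at_vert P i) X. e \<cdot> g = f" using mor_comp[OF mor_vert[OF \<psi>(1) i] cX] unfolding mor_def by blast
qed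

text \<open>
  The left adjoint of evaluation at \<open>i\<close> on \<open>A\<close>, with unit \<open>\<eta>\<close>: the right adjoint for the opposite
  quiver with values in the opposite category.
\<close>

lemma e_lambda_universal:
  assumes A: "A \<in> Obj C" and i: "i \<in> verts Q"
  shows "\<exists>L \<eta>. L \<in> Obj R \<and> mor C A (at_vert L i) \<eta> \<and>
    (\<forall>X f. X \<in> Obj R \<longrightarrow> mor C A (at_vert X i) f \<longrightarrow> (\<exists>\<phi>. mor R L X \<phi> \<and> \<phi> i \<cdot> \<eta> = f)) \<and>
    (\<forall>X \<phi> \<phi>'. mor R L X \<phi> \<longrightarrow> mor R L X \<phi>' \<longrightarrow> \<phi> i \<cdot> \<eta> = \<phi>' i \<cdot> \<eta> \<longrightarrow> \<phi> = \<phi>')"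
proof -
  \<comment> \<open>The universal property of \<open>e_rho\<close> is stated in the dual category and read backwards.\<close>
  interpret O: acyclic_quiver_rep "op_cat C" "op_quiver Q" by (rule acyclic_quiver_rep_op)
  have i': "i \<in> verts (op_quiver Q)" and A': "A \<in> Obj (op_cat C)" using i A by auto
  show ?thesis
    by (rule exI[of _ "e_rho (op_quiver Q) (op_cat C) i A"], rule exI[of _ "O.ecounit i A"])
      (use O.e_rho_obj[OF A', of i] O.ecounit_mor[OF A' i'] O.e_rho_universal[OF _ i', of _ A]
        O.e_rho_unique[OF A' i'] in \<open>auto simp: Rep_op\<close>)
qed

text \<open>
  The free representation on a projective object is projective.  The sum of the free
  representations on covers of the values of \<open>X\<close> maps onto \<open>X\<close>.
\<close>

lemma enough_projectives_Rep:
  assumes ep: "enough_projectives C" shows "enough_projectives R"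
  unfolding enough_projectives_def
proof
  fix X assume X: "X \<in> Obj R"
  have "\<exists>P e. projective C P \<and> epic C P (at_vert X i) e" if "i \<in> verts Q" for i
    using ep obj_vert[OF X that] by (auto simp: enough_projectives_def)
  then obtain P e where P: "\<And>i. i \<in> verts Q \<Longrightarrow> projective C (P i)" "\<And>i. i \<in> verts Q \<Longrightarrow> epic C (P i) (at_vert X i) (e i)" by metis
  have PO: "P i \<in> Obj C" if "i \<in> verts Q" for i using P(1)[OF that] by (simp add: projective_def)
  define free where "free i L \<eta> \<longleftrightarrow> L \<in> Obj R \<and> mor C (P i) (at_vert L i) \<eta> \<and>
    (\<forall>X f. X \<in> Obj R \<longrightarrow> mor C (P i) (at_vert X i) f \<longrightarrow> (\<exists>\<phi>. mor R L X \<phi> \<and> \<phi> i \<cdot> \<eta> = f)) \<and>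
    (\<forall>X \<phi> \<phi>'. mor R L X \<phi> \<longrightarrow> mor R L X \<phi>' \<longrightarrow> \<phi> i \<cdot> \<eta> = \<phi>' i \<cdot> \<eta> \<longrightarrow> \<phi> = \<phi>')" for i L \<eta>
  have "\<exists>L \<eta>. free i L \<eta>" if "i \<in> verts Q" for i
    unfolding free_def by (rule e_lambda_universal[OF PO[OF that] that])
  then obtain L \<eta> where free: "\<And>i. i \<in> verts Q \<Longrightarrow> free i (L i) (\<eta> i)" by metis
  note L = free[unfolded free_def, THEN conjunct1] free[unfolded free_def, THEN conjunct2, THEN conjunct1]
    free[unfolded free_def, THEN conjunct2, THEN conjunct2, THEN conjunct1]
    free[unfolded free_def, THEN conjunct2, THEN conjunct2, THEN conjunct2]
  have "\<forall>i\<in>verts Q. L i \<in> Obj R" using L(1) by blast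
  then obtain F inc prj where F: "direct_sum R (verts Q) L F inc prj" using rep_direct_sum_exists[OF finite_verts] by blast
  have "\<exists>\<phi>. mor R (L i) X \<phi> \<and> \<phi> i \<cdot> \<eta> i = e i" if "i \<in> verts Q" for i
    using L(3)[OF that] X epicD[OF P(2)[OF that]] by blast
  then obtain \<phi> where \<phi>: "\<And>i. i \<in> verts Q \<Longrightarrow> mor R (L i) X (\<phi> i)" "\<And>i. i \<in> verts Q \<Longrightarrow> \<phi> i i \<cdot> \<eta> i = e i" by metis
  obtain q where q: "mor R F X q" "\<forall>i\<in>verts Q. q \<odot> inc i = \<phi> i" using R.ds_copair[OF F X] \<phi>(1) by blast
  have "epic R F X q"
  proof (intro rep_epicI[OF q(1)] ballI)
    fix i assume i: "i \<in> verts Q"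
    note m = mor_vert[OF R.ds_mor(1)[OF F i] i] and qi = mor_vert[OF q(1) i]
    have "q i \<cdot> inc i i = \<phi> i i" using fun_cong[OF bspec[OF q(2) i], of i] i by simp
    then have "q i \<cdot> (inc i i \<cdot> \<eta> i) = e i" using comp_cong[OF L(2)[OF i] m qi] \<phi>(2)[OF i] by simp
    then show "epic C (at_vert F i) (at_vert X i) (q i)"
      using epic_if_comp_epic[OF mor_comp[OF L(2)[OF i] m] qi] P(2)[OF i] by simp
  qed
  moreover have "projective R F"
    unfolding projective_def
  proof (intro conjI allI impI ballI)
    show "F \<in> Obj R" using R.ds_obj(1)[OF F] .
    fix Y Z p h assume p: "epic R Y Z p" and h: "h \<in> Hom R F Z"
    note pm = R.epicD[OF p]
    have h: "mor R F Z h" using h mor_obj[OF pm] R.ds_obj(1)[OF F] by (simp add: mor_def)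
    have "\<exists>g. mor R (L i) Y g \<and> p \<odot> g = h \<odot> inc i" if i: "i \<in> verts Q" for i
    proof -
      have hi: "mor R (L i) Z (h \<odot> inc i)" using R.mor_comp[OF R.ds_mor(1)[OF F i] h] .
      have "mor C (P i) (at_vert Z i) ((h \<odot> inc i) i \<cdot> \<eta> i)" using mor_comp[OF L(2)[OF i] mor_vert[OF hi i]] .
      then obtain k where k: "mor C (P i) (at_vert Y i) k" "p i \<cdot> k = (h \<odot> inc i) i \<cdot> \<eta> i"
        using P(1)[OF i] rep_epic_vert[OF p i] obj_vert[OF mor_obj(1)[OF pm] i] PO[OF i] unfolding projective_def mor_def by blast
      obtain g where g: "mor R (L i) Y g" "g i \<cdot> \<eta> i = k" using L(3)[OF i] mor_obj(1)[OF pm] k(1) by blast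
      have "(p \<odot> g) i \<cdot> \<eta> i = (h \<odot> inc i) i \<cdot> \<eta> i"
        using assoc[OF L(2)[OF i] mor_vert[OF g(1) i] mor_vert[OF pm i]] g(2) k(2) i by simp
      then have "p \<odot> g = h \<odot> inc i" using L(4)[OF i] R.mor_comp[OF g(1) pm] hi by blast
      then show ?thesis using g(1) by blast
    qed
    then obtain g where g: "\<And>i. i \<in> verts Q \<Longrightarrow> mor R (L i) Y (g i)" "\<And>i. i \<in> verts Q \<Longrightarrow> p \<odot> g i = h \<odot> inc i" by metis
    obtain u where u: "mor R F Y u" "\<forall>i\<in>verts Q. u \<odot> inc i = g i"
      using R.ds_copair[OF F mor_obj(1)[OF pm]] g(1) by blast
    have "p \<odot> u = h"
      by (rule R.ds_eq_inc[OF F R.mor_comp[OF u(1) pm] h])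
        (use R.assoc[OF R.ds_mor(1)[OF F] u(1) pm] u(2) g(2) in auto)
    then show "\<exists>g\<in>Hom R F Y. p \<odot> g = h" using u(1) unfolding mor_def by blast
  qed
  ultimately show "\<exists>P e. projective R P \<and> epic R P X e" by blast
qed

text \<open>
  A morphism from \<open>e_rho Q C i A\<close> to \<open>X\<close> is a family of morphisms from \<open>A\<close> to the values of \<open>X\<close>, one
  for each path \<open>p\<close> ending at \<open>i\<close>, such that an arc \<open>a\<close> sends the member at \<open>a # q\<close> to the member at
  \<open>q\<close>, and the member at a path not beginning with \<open>a\<close> to zero.  Such families are the morphisms from
  \<open>A\<close> to an equalizer \<open>K\<close> inside the direct sum of the values of \<open>X\<close> over all these paths.  A right
  \<open>\<T>\<close>-approximation of \<open>K\<close> therefore gives the object \<open>T\<close>.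
\<close>

lemma e_rho_right_approximation:
  assumes X: "X \<in> Obj R" and i: "i \<in> verts Q" and cf: "contravariantly_finite C \<T>" and To: "\<T> \<subseteq> Obj C"
  shows "\<exists>T \<epsilon>. T \<in> \<T> \<and> mor R (e_rho Q C i T) X \<epsilon> \<and> (\<forall>T'\<in>\<T>. \<forall>\<psi>. mor R (e_rho Q C i T') X \<psi> \<longrightarrow>
    (\<exists>u. mor R (e_rho Q C i T') (e_rho Q C i T) u \<and> \<epsilon> \<odot> u = \<psi>))"
proof -
  define J where "J = (SIGMA j:verts Q. paths Q j i)"
  have J: "finite J" unfolding J_def using finite_verts finite_paths by blast
  obtain S inc prj where S: "direct_sum C J (\<lambda>(j, p). at_vert X j) S inc prj"
  proof (rule ex_direct_sum[OF J])
    show "(case c of (j, p) \<Rightarrow> at_vert X j) \<in> Obj C" if "c \<in> J" for c using obj_vert[OF X] that by (auto simp: J_def)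
  qed
  have sp: "mor C S (at_vert X j) (prj (j, p))" if "j \<in> verts Q" "p \<in> paths Q j i" for j p
    using ds_mor(2)[OF S, of "(j, p)"] that by (simp add: J_def)
  define L where "L = (SIGMA a:arcs Q. paths Q (tail Q a) i)"
  have L: "finite L" unfolding L_def using finite_arcs finite_paths arc_verts by blast
  \<comment> \<open>\<open>\<alpha>\<close> and \<open>\<beta>\<close> are the two sides of the condition imposed by the arc \<open>a\<close> on the member at the path \<open>p\<close>.\<close>
  define \<alpha> where "\<alpha> = (\<lambda>(a, p). at_arc X a \<cdot> prj (tail Q a, p))"
  define \<beta> where "\<beta> = (\<lambda>(a, p). if p \<noteq> [] \<and> hd p = a then prj (head Q a, tl p) else Zero C S (at_head X a))"
  have tl: "tl p \<in> paths Q (head Q a) i" if "p \<in> paths Q j i" "p \<noteq> []" "hd p = a" for a p j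
    using that paths_Cons[OF quiver] by (cases p) auto
  have S0: "S \<in> Obj C" using ds_obj(1)[OF S] .
  have ab: "\<forall>c\<in>L. mor C S (at_vert X (head Q (fst c))) (\<alpha> c)" "\<forall>c\<in>L. mor C S (at_vert X (head Q (fst c))) (\<beta> c)"
    using mor_comp[OF sp obj_arc[OF X]] sp arc_verts tl mor_zero[OF S0 obj_vert[OF X]] by (auto simp: L_def \<alpha>_def \<beta>_def)
  from joint_equalizer[OF L S0 ab] obtain K k where k: "monic C K S k" "\<forall>c\<in>L. \<alpha> c \<cdot> k = \<beta> c \<cdot> k"
    "\<forall>W h. mor C W S h \<longrightarrow> (\<forall>c\<in>L. \<alpha> c \<cdot> h = \<beta> c \<cdot> h) \<longrightarrow> (\<exists>u. mor C W K u \<and> k \<cdot> u = h)" by blast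
  note km = monicD[OF k(1)]
  have "K \<in> Obj C" using km mor_objD by auto
  then obtain T t where t: "right_approximation C \<T> K T t" using cf by (auto simp: contravariantly_finite_def)
  then have T: "T \<in> \<T>" "mor C T K t" using To \<open>K \<in> Obj C\<close> by (auto simp: right_approximation_def mor_def)
  have TO: "T \<in> Obj C" using T To by blast
  have kt: "mor C T S (k \<cdot> t)" using mor_comp[OF T(2) km] .
  define \<epsilon>' where "\<epsilon>' j p = prj (j, p) \<cdot> (k \<cdot> t)" for j p
  have \<epsilon>': "mor C T (at_vert X j) (\<epsilon>' j p)" if "j \<in> verts Q" "p \<in> paths Q j i" for j p
    unfolding \<epsilon>'_def using mor_comp[OF kt sp[OF that]] .
  note dT = e_rho_ds[OF TO, of _ i]
  have "\<exists>e. mor C (at_vert (e_rho Q C i T) j) (at_vert X j) e \<and> (\<forall>p\<in>paths Q j i. e \<cdot> einc i T j p = \<epsilon>' j p)" if j: "j \<in> verts Q" for j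
    by (rule ds_copair[OF dT[OF j] obj_vert[OF X j]]) (use \<epsilon>'[OF j] in blast)
  then obtain \<epsilon> where \<epsilon>: "\<And>j. j \<in> verts Q \<Longrightarrow> mor C (at_vert (e_rho Q C i T) j) (at_vert X j) (\<epsilon> j)"
    "\<And>j p. j \<in> verts Q \<Longrightarrow> p \<in> paths Q j i \<Longrightarrow> \<epsilon> j \<cdot> einc i T j p = \<epsilon>' j p" by metis
  have rel: "at_arc X a \<cdot> \<epsilon>' (tail Q a) p = (if p \<noteq> [] \<and> hd p = a then \<epsilon>' (head Q a) (tl p) else Zero C T (at_head X a))"
    if a: "a \<in> arcs Q" and p: "p \<in> paths Q (tail Q a) i" for a p
  proof -
    note t' = arc_verts(1)[OF a] and h = arc_verts(2)[OF a]
    have c: "(a, p) \<in> L" using a p by (simp add: L_def)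
    have e: "\<alpha> (a, p) \<cdot> (k \<cdot> t) = \<beta> (a, p) \<cdot> (k \<cdot> t)"
      by (rule comp_square[OF T(2) km bspec[OF ab(1) c] km bspec[OF ab(2) c] bspec[OF k(2) c]])
    have "\<alpha> (a, p) \<cdot> (k \<cdot> t) = at_arc X a \<cdot> \<epsilon>' (tail Q a) p"
      using assoc[OF kt sp[OF t' p] obj_arc[OF X a]] by (simp add: \<alpha>_def \<epsilon>'_def)
    moreover have "\<beta> (a, p) \<cdot> (k \<cdot> t) = (if p \<noteq> [] \<and> hd p = a then \<epsilon>' (head Q a) (tl p) else Zero C T (at_head X a))"
      using zero_left[OF kt obj_vert[OF X h]] by (simp add: \<beta>_def \<epsilon>'_def)
    ultimately show ?thesis using e by simp
  qed
  have \<epsilon>m: "mor R (e_rho Q C i T) X (restrict \<epsilon> (verts Q))"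
  proof (intro mor_intro ballI e_rho_obj[OF TO] X)
    fix a assume a: "a \<in> arcs Q"
    note t' = arc_verts(1)[OF a] and h = arc_verts(2)[OF a] and Va = e_rho_arc(1)[OF TO a, where i=i]
    show "\<epsilon> (head Q a) \<cdot> at_arc (e_rho Q C i T) a = at_arc X a \<cdot> \<epsilon> (tail Q a)"
    proof (rule ds_eq_inc[OF dT[OF t'] mor_comp[OF Va \<epsilon>(1)[OF h]] mor_comp[OF \<epsilon>(1)[OF t'] obj_arc[OF X a]]])
      fix p assume p: "p \<in> paths Q (tail Q a) i"
      note ip = ds_mor(1)[OF dT[OF t'] p]
      have "(\<epsilon> (head Q a) \<cdot> at_arc (e_rho Q C i T) a) \<cdot> einc i T (tail Q a) p =
        (if p \<noteq> [] \<and> hd p = a then \<epsilon>' (head Q a) (tl p) else Zero C T (at_head X a))"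
        using assoc[OF ip Va \<epsilon>(1)[OF h]] e_rho_arc_inc[OF TO a p] \<epsilon>(2)[OF h tl[OF p]] zero_right[OF \<epsilon>(1)[OF h] TO] by auto
      also have "\<dots> = at_arc X a \<cdot> (\<epsilon> (tail Q a) \<cdot> einc i T (tail Q a) p)" using rel[OF a p] \<epsilon>(2)[OF t' p] by simp
      finally show "(\<epsilon> (head Q a) \<cdot> at_arc (e_rho Q C i T) a) \<cdot> einc i T (tail Q a) p = (at_arc X a \<cdot> \<epsilon> (tail Q a)) \<cdot> einc i T (tail Q a) p"
        using assoc[OF ip \<epsilon>(1)[OF t'] obj_arc[OF X a]] by simp
    qed
  qed (use \<epsilon>(1) in auto)
  have "\<exists>u. mor R (e_rho Q C i T') (e_rho Q C i T) u \<and> restrict \<epsilon> (verts Q) \<odot> u = \<psi>"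
    if T': "T' \<in> \<T>" and \<psi>: "mor R (e_rho Q C i T') X \<psi>" for T' \<psi>
  proof -
    have TO': "T' \<in> Obj C" using T' To by blast
    note d' = e_rho_ds[OF TO', of _ i]
    have "\<forall>c\<in>J. mor C T' (case c of (j, p) \<Rightarrow> at_vert X j) (case c of (j, p) \<Rightarrow> \<psi> j \<cdot> einc i T' j p)"
      using mor_comp ds_mor(1)[OF d'] mor_vert[OF \<psi>] by (fastforce simp: J_def)
    from ds_pair[OF S TO' this] obtain m where m: "mor C T' S m" and mp: "\<forall>c\<in>J. prj c \<cdot> m = (case c of (j, p) \<Rightarrow> \<psi> j \<cdot> einc i T' j p)" by blast
    have mp: "prj (j, p) \<cdot> m = \<psi> j \<cdot> einc i T' j p" if "j \<in> verts Q" "p \<in> paths Q j i" for j p using mp that by (auto simp: J_def)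
    have "\<alpha> (a, p) \<cdot> m = \<beta> (a, p) \<cdot> m" if a: "a \<in> arcs Q" and p: "p \<in> paths Q (tail Q a) i" for a p
    proof -
      note t' = arc_verts(1)[OF a] and h = arc_verts(2)[OF a] and Va = e_rho_arc(1)[OF TO' a, where i=i]
      note ip = ds_mor(1)[OF d'[OF t'] p]
      have "\<alpha> (a, p) \<cdot> m = at_arc X a \<cdot> (\<psi> (tail Q a) \<cdot> einc i T' (tail Q a) p)"
        using assoc[OF m sp[OF t' p] obj_arc[OF X a]] mp[OF t' p] by (simp add: \<alpha>_def)
      also have "\<dots> = \<psi> (head Q a) \<cdot> (at_arc (e_rho Q C i T') a \<cdot> einc i T' (tail Q a) p)"
        by (rule comp_square[OF ip mor_vert[OF \<psi> t'] obj_arc[OF X a] Va mor_vert[OF \<psi> h] mor_arc[OF \<psi> a, symmetric]])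
      also have "\<dots> = \<beta> (a, p) \<cdot> m"
        using e_rho_arc_inc[OF TO' a p] mp[OF h tl[OF p]] zero_right[OF mor_vert[OF \<psi> h] TO'] zero_left[OF m obj_vert[OF X h]]
        by (auto simp: \<beta>_def)
      finally show ?thesis .
    qed
    then have "\<forall>c\<in>L. \<alpha> c \<cdot> m = \<beta> c \<cdot> m" by (auto simp: L_def)
    then obtain v where v: "mor C T' K v" "k \<cdot> v = m" using k(3) m by blast
    obtain w where w: "mor C T' T w" "t \<cdot> w = v"
      using t v(1) T' TO TO' unfolding right_approximation_def mor_def by blast
    obtain U where U: "mor R (e_rho Q C i T') (e_rho Q C i T) U" "\<forall>j\<in>verts Q. \<forall>p\<in>paths Q j i.
      U j \<cdot> einc i T' j p = einc i T j p \<cdot> w \<and> eprj i T j p \<cdot> U j = w \<cdot> eprj i T' j p" using e_rho_map[OF w(1)] by blast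
    have "restrict \<epsilon> (verts Q) \<odot> U = \<psi>"
    proof (rule mor_eqI[OF R.mor_comp[OF U(1) \<epsilon>m] \<psi>])
      fix j assume j: "j \<in> verts Q"
      note Uj = mor_vert[OF U(1) j]
      have "\<epsilon> j \<cdot> U j = \<psi> j"
      proof (rule ds_eq_inc[OF d'[OF j] mor_comp[OF Uj \<epsilon>(1)[OF j]] mor_vert[OF \<psi> j]])
        fix p assume p: "p \<in> paths Q j i"
        have "(\<epsilon> j \<cdot> U j) \<cdot> einc i T' j p = \<epsilon> j \<cdot> (einc i T j p \<cdot> w)"
          using assoc[OF ds_mor(1)[OF d'[OF j] p] Uj \<epsilon>(1)[OF j]] U(2) j p by simp
        also have "\<dots> = \<epsilon>' j p \<cdot> w" by (rule comp_cong[OF w(1) ds_mor(1)[OF dT[OF j] p] \<epsilon>(1)[OF j] \<epsilon>(2)[OF j p]])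
        also have "\<dots> = prj (j, p) \<cdot> m"
          using assoc[OF w(1) kt sp[OF j p]] assoc[OF w(1) T(2) km] w(2) v(2) by (simp add: \<epsilon>'_def)
        finally show "(\<epsilon> j \<cdot> U j) \<cdot> einc i T' j p = \<psi> j \<cdot> einc i T' j p" using mp[OF j p] by simp
      qed
      then show "(restrict \<epsilon> (verts Q) \<odot> U) j = \<psi> j" using j by simp
    qed
    then show ?thesis using U(1) by blast
  qed
  then show ?thesis using T(1) \<epsilon>m by blast
qed

end

section \<open>Support tau-tilting for representations\<close>

context abelian_category
begin

text \<open>
  \<open>V\<close> is the product of \<open>K\<close> and the \<open>Y a\<close> with projections \<open>\<rho>\<close> and \<open>v a\<close>, and \<open>\<rho>\<close> is a retraction.
\<close>

definition split_product where
  "split_product V I Y v K \<rho> \<longleftrightarrow> (\<exists>k. retract C K V k \<rho>) \<and>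
    (\<forall>W f g. mor C W K f \<longrightarrow> (\<forall>a\<in>I. mor C W (Y a) (g a)) \<longrightarrow>
      (\<exists>h. mor C W V h \<and> \<rho> \<cdot> h = f \<and> (\<forall>a\<in>I. v a \<cdot> h = g a))) \<and>
    (\<forall>W h h'. mor C W V h \<longrightarrow> mor C W V h' \<longrightarrow> \<rho> \<cdot> h = \<rho> \<cdot> h' \<longrightarrow>
      (\<forall>a\<in>I. v a \<cdot> h = v a \<cdot> h') \<longrightarrow> h = h')"

text \<open>
  The sections make the map from \<open>V\<close> to the direct sum of the \<open>Y a\<close> a split epimorphism, and \<open>K\<close> is
  its kernel.
\<close>

lemma sections_split:
  assumes I: "finite I" and V: "V \<in> Obj C"
    and v: "\<forall>a\<in>I. mor C V (Y a) (v a)" and s: "\<forall>a\<in>I. mor C (Y a) V (s a)"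
    and vs: "\<forall>a\<in>I. \<forall>b\<in>I. v b \<cdot> s a = (if a = b then Ident C (Y a) else Zero C (Y a) (Y b))"
  shows "\<exists>K \<rho>. split_product V I Y v K \<rho>"
proof -
  have "Y a \<in> Obj C" if "a \<in> I" for a using v that mor_objD by blast
  then obtain B inc prj where B: "direct_sum C I Y B inc prj" using ex_direct_sum[OF I] by metis
  note BO = ds_obj(1)[OF B]
  obtain p where p: "mor C V B p" "\<forall>a\<in>I. prj a \<cdot> p = v a" using ds_pair[OF B V v] by blast
  obtain t where t: "mor C B V t" "\<forall>a\<in>I. t \<cdot> inc a = s a" using ds_copair[OF B V s] by blast
  have pt: "p \<cdot> t = Ident C B"
  proof (rule ds_eq_inc[OF B mor_comp[OF t(1) p(1)] mor_id[OF BO]])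
    fix a assume a: "a \<in> I"
    note ia = ds_mor(1)[OF B a]
    have sa: "mor C (Y a) V (s a)" using s a by blast
    have "p \<cdot> s a = inc a"
    proof (rule ds_eq_prj[OF B mor_comp[OF sa p(1)] ia])
      fix b assume b: "b \<in> I"
      show "prj b \<cdot> (p \<cdot> s a) = prj b \<cdot> inc a"
        using comp_cong[OF sa p(1) ds_mor(2)[OF B b] bspec[OF p(2) b]] vs a b ds_prj_inc[OF B b a] by auto
    qed
    then show "(p \<cdot> t) \<cdot> inc a = Ident C B \<cdot> inc a"
      using assoc[OF ia t(1) p(1)] t(2) a id_left[OF ia] by simp
  qed
  obtain K k where K: "is_kernel C V B p K k" using ex_kernel[OF p(1)] .
  obtain r where d: "direct_sum C UNIV (\<lambda>b. if b then K else B) V (\<lambda>b. if b then k else t) (\<lambda>b. if b then r else p)"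
    using split_direct_sum[OF p(1) t(1) pt K] .
  have r: "mor C V K r" using ds_mor(2)[OF d UNIV_I, of True] by simp
  have "retract C K V k r"
    using ds_mor(1)[OF d UNIV_I, of True] r ds_prj_inc[OF d UNIV_I UNIV_I, of True True] by (simp add: retract_def)
  moreover have "\<exists>h. mor C W V h \<and> r \<cdot> h = f \<and> (\<forall>a\<in>I. v a \<cdot> h = g a)"
    if f: "mor C W K f" and g: "\<forall>a\<in>I. mor C W (Y a) (g a)" for W f g
  proof -
    note W = mor_objD(1)[OF f]
    obtain g' where g': "mor C W B g'" "\<forall>a\<in>I. prj a \<cdot> g' = g a" using ds_pair[OF B W g] by blast
    have "\<forall>b\<in>UNIV. mor C W (if b then K else B) (if b then f else g')" using f g' by simp
    from ds_pair[OF d W this] obtain h where h: "mor C W V h"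
      and hb: "\<forall>b\<in>UNIV. (if b then r else p) \<cdot> h = (if b then f else g')" by blast
    have "r \<cdot> h = f" "p \<cdot> h = g'" using bspec[OF hb UNIV_I, of True] bspec[OF hb UNIV_I, of False] by simp_all
    moreover have "v a \<cdot> h = g a" if "a \<in> I" for a
      using assoc[OF h p(1) ds_mor(2)[OF B that]] p(2) g'(2) that \<open>p \<cdot> h = g'\<close> by auto
    ultimately show ?thesis using h by blast
  qed
  moreover have "h = h'" if h: "mor C W V h" and h': "mor C W V h'" and e: "r \<cdot> h = r \<cdot> h'" "\<forall>a\<in>I. v a \<cdot> h = v a \<cdot> h'" for W h h'
  proof (rule ds_eq_prj[OF d h h'])
    have "p \<cdot> h = p \<cdot> h'"
    proof (rule ds_eq_prj[OF B mor_comp[OF h p(1)] mor_comp[OF h' p(1)]])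
      fix a assume a: "a \<in> I"
      note pa = ds_mor(2)[OF B a]
      show "prj a \<cdot> (p \<cdot> h) = prj a \<cdot> (p \<cdot> h')"
        using comp_cong[OF h p(1) pa bspec[OF p(2) a]] comp_cong[OF h' p(1) pa bspec[OF p(2) a]] e(2) a by simp
    qed
    then show "(if b then r else p) \<cdot> h = (if b then r else p) \<cdot> h'" for b using e(1) by simp
  qed
  ultimately show ?thesis unfolding split_product_def by blast
qed

end

locale tilting_rep = acyclic_quiver_rep C Q
  for C :: "('o, 'm) preadd_cat" (structure) and Q :: "('v, 'a) pre_digraph" +
  fixes \<T> :: "'o set"
  assumes tilting: "support_tau_tilting C \<T>"
    and epi_kernels: "closed_under_epi_kernels C (Fac C \<T>)"
begin

abbreviation generators where "generators \<equiv> {e_rho Q C i T | i T. i \<in> verts Q \<and> T \<in> \<T>}"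
abbreviation \<T>\<^sub>Q where "\<T>\<^sub>Q \<equiv> add_subcat R generators"

lemma additive: "additive_subcategory C \<T>"
  using tilting by (simp add: support_tau_tilting_def)

lemma tilting_obj: "T \<in> \<T> \<Longrightarrow> T \<in> Obj C"
  using additive by (auto simp: additive_subcategory_def)

text \<open>
  The \<open>s a\<close> are the components of a section of the arc map at \<open>j\<close>, the morphism from the value at
  \<open>j\<close> to the direct sum of the values at the heads of the arcs that start at \<open>j\<close>.
\<close>

definition arc_sections :: "('v, 'a, 'o, 'm) rep \<Rightarrow> 'v \<Rightarrow> ('a \<Rightarrow> 'm) \<Rightarrow> bool" where
  "arc_sections V j s \<longleftrightarrow> (\<forall>a\<in>out_arcs Q j. mor C (at_head V a) (at_vert V j) (s a)) \<and>
    (\<forall>a\<in>out_arcs Q j. \<forall>b\<in>out_arcs Q j.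
      at_arc V b \<cdot> s a = (if a = b then Ident C (at_head V a) else Zero C (at_head V a) (at_head V b)))"

definition cofree :: "('v, 'a, 'o, 'm) rep \<Rightarrow> bool" where
  "cofree V \<longleftrightarrow> V \<in> Obj R \<and> (\<forall>j\<in>verts Q. at_vert V j \<in> \<T> \<and> (\<exists>s. arc_sections V j s))"

lemma out_arcD: "a \<in> out_arcs Q j \<Longrightarrow> a \<in> arcs Q" "a \<in> out_arcs Q j \<Longrightarrow> tail Q a = j"
  "a \<in> out_arcs Q j \<Longrightarrow> head Q a \<in> verts Q"
  using arc_verts by (auto simp: out_arcs_def)

lemma obj_out_arc:
  assumes "X \<in> Obj R" "a \<in> out_arcs Q j" shows "mor C (at_vert X j) (at_head X a) (at_arc X a)"
  using obj_arc[OF assms(1) out_arcD(1)[OF assms(2)]] out_arcD(2)[OF assms(2)] by simp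

lemma mor_out_arc:
  assumes "mor R X Y \<phi>" "a \<in> out_arcs Q j" shows "\<phi> (head Q a) \<cdot> at_arc X a = at_arc Y a \<cdot> \<phi> j"
  using mor_arc[OF assms(1) out_arcD(1)[OF assms(2)]] out_arcD(2)[OF assms(2)] by simp

text \<open>
  A path from the head of \<open>a\<close> to \<open>i\<close> is prefixed with \<open>a\<close>; this embeds the copies of \<open>T\<close> at the head
  into those at \<open>j\<close> and splits the arc map.
\<close>

lemma cofree_e_rho:
  assumes T: "T \<in> \<T>" shows "cofree (e_rho Q C i T)"
  unfolding cofree_def
proof (intro conjI ballI)
  note TO = tilting_obj[OF T]
  note d = e_rho_ds[OF TO, of _ i]
  let ?V = "e_rho Q C i T"
  show V: "?V \<in> Obj R" using e_rho_obj[OF TO] .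
  fix j assume j: "j \<in> verts Q"
  show "at_vert ?V j \<in> \<T>" using additive_sum[OF additive d[OF j]] T by blast
  have aq: "a # q \<in> paths Q j i" if "a \<in> out_arcs Q j" "q \<in> paths Q (head Q a) i" for a q
    using that out_arcD paths_Cons[OF quiver] by blast
  have "\<exists>s. mor C (at_head ?V a) (at_vert ?V j) s \<and> (\<forall>q\<in>paths Q (head Q a) i. s \<cdot> einc i T (head Q a) q = einc i T j (a # q))"
    if a: "a \<in> out_arcs Q j" for a
    by (rule ds_copair[OF d[OF out_arcD(3)[OF a]] ds_obj(1)[OF d[OF j]]]) (use ds_mor(1)[OF d[OF j] aq[OF a]] in blast)
  then obtain s where s: "\<And>a. a \<in> out_arcs Q j \<Longrightarrow> mor C (at_head ?V a) (at_vert ?V j) (s a)"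
    "\<And>a q. a \<in> out_arcs Q j \<Longrightarrow> q \<in> paths Q (head Q a) i \<Longrightarrow> s a \<cdot> einc i T (head Q a) q = einc i T j (a # q)" by metis
  have "at_arc ?V b \<cdot> s a =
    (if a = b then Ident C (at_head ?V a) else Zero C (at_head ?V a) (at_head ?V b))"
    if a: "a \<in> out_arcs Q j" and b: "b \<in> out_arcs Q j" for a b
  proof (rule ds_eq_inc[OF d[OF out_arcD(3)[OF a]] mor_comp[OF s(1)[OF a] obj_out_arc[OF V b]]])
    note ha = ds_obj(1)[OF d[OF out_arcD(3)[OF a]]] and hb = ds_obj(1)[OF d[OF out_arcD(3)[OF b]]]
    show "mor C (at_head ?V a) (at_head ?V b)
      (if a = b then Ident C (at_head ?V a) else Zero C (at_head ?V a) (at_head ?V b))"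
      using mor_id[OF ha] mor_zero[OF ha hb] by auto
    fix q assume q: "q \<in> paths Q (head Q a) i"
    note iq = ds_mor(1)[OF d[OF out_arcD(3)[OF a]] q]
    have "(at_arc ?V b \<cdot> s a) \<cdot> einc i T (head Q a) q = at_arc ?V b \<cdot> einc i T j (a # q)"
      using assoc[OF iq s(1)[OF a] obj_out_arc[OF V b]] s(2)[OF a q] by simp
    also have "\<dots> = (if a = b then einc i T (head Q b) q else Zero C T (at_head ?V b))"
      using e_rho_arc_inc[OF TO out_arcD(1)[OF b], of "a # q" i] aq[OF a q] out_arcD(2)[OF b] by simp
    finally show "(at_arc ?V b \<cdot> s a) \<cdot> einc i T (head Q a) q = (if a = b then Ident C (at_head ?V a)
        else Zero C (at_head ?V a) (at_head ?V b)) \<cdot> einc i T (head Q a) q"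
      using id_left[OF iq] zero_left[OF iq hb] by auto
  qed
  then show "\<exists>s. arc_sections ?V j s"
    using s(1) unfolding arc_sections_def by blast
qed

lemma cofree_direct_sum:
  assumes S: "direct_sum R I X S inc prj" and X: "\<forall>k\<in>I. cofree (X k)"
  shows "cofree S"
  unfolding cofree_def
proof (intro conjI ballI)
  show SO: "S \<in> Obj R" using R.ds_obj(1)[OF S] .
  note d = rep_direct_sum_vert[OF S]
  fix j assume j: "j \<in> verts Q"
  show "at_vert S j \<in> \<T>" using additive_sum[OF additive d[OF j]] X j by (auto simp: cofree_def)
  have XO: "X k \<in> Obj R" if "k \<in> I" for k using X that by (simp add: cofree_def)
  have "\<exists>s. arc_sections (X k) j s" if "k \<in> I" for k using X that j by (simp add: cofree_def)
  then obtain t where "\<And>k. k \<in> I \<Longrightarrow> arc_sections (X k) j (t k)" by metis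
  then have t: "\<And>k. k \<in> I \<Longrightarrow> \<forall>a\<in>out_arcs Q j. mor C (at_head (X k) a) (at_vert (X k) j) (t k a)"
    "\<And>k. k \<in> I \<Longrightarrow> \<forall>a\<in>out_arcs Q j. \<forall>b\<in>out_arcs Q j. at_arc (X k) b \<cdot> t k a =
       (if a = b then Ident C (at_head (X k) a) else Zero C (at_head (X k) a) (at_head (X k) b))"
    unfolding arc_sections_def by blast+
  have "\<exists>s. mor C (at_head S a) (at_vert S j) s \<and> (\<forall>k\<in>I. s \<cdot> inc k (head Q a) = inc k j \<cdot> t k a)"
    if a: "a \<in> out_arcs Q j" for a
    by (rule ds_copair[OF d[OF out_arcD(3)[OF a]] obj_vert[OF SO j]])
      (use mor_comp[OF bspec[OF t(1) a] ds_mor(1)[OF d[OF j]]] in blast)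
  then obtain s where s: "\<And>a. a \<in> out_arcs Q j \<Longrightarrow> mor C (at_head S a) (at_vert S j) (s a)"
    "\<And>a. a \<in> out_arcs Q j \<Longrightarrow> \<forall>k\<in>I. s a \<cdot> inc k (head Q a) = inc k j \<cdot> t k a" by metis
  have "at_arc S b \<cdot> s a =
    (if a = b then Ident C (at_head S a) else Zero C (at_head S a) (at_head S b))"
    if a: "a \<in> out_arcs Q j" and b: "b \<in> out_arcs Q j" for a b
  proof (rule ds_eq_inc[OF d[OF out_arcD(3)[OF a]] mor_comp[OF s(1)[OF a] obj_out_arc[OF SO b]]])
    note ha = obj_vert[OF SO out_arcD(3)[OF a]] and hb = obj_vert[OF SO out_arcD(3)[OF b]]
    show "mor C (at_head S a) (at_head S b)
      (if a = b then Ident C (at_head S a) else Zero C (at_head S a) (at_head S b))"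
      using mor_id[OF ha] mor_zero[OF ha hb] by auto
    fix k assume k: "k \<in> I"
    note ik = ds_mor(1)[OF d[OF out_arcD(3)[OF a]] k] and ikb = ds_mor(1)[OF d[OF out_arcD(3)[OF b]] k]
    have ta: "mor C (at_head (X k) a) (at_vert (X k) j) (t k a)" using t(1)[OF k] a by blast
    have "(at_arc S b \<cdot> s a) \<cdot> inc k (head Q a) = at_arc S b \<cdot> (inc k j \<cdot> t k a)"
      using assoc[OF ik s(1)[OF a] obj_out_arc[OF SO b]] s(2)[OF a] k by simp
    also have "\<dots> = inc k (head Q b) \<cdot> (at_arc (X k) b \<cdot> t k a)"
      by (rule comp_square[OF ta ds_mor(1)[OF d[OF j] k] obj_out_arc[OF SO b] obj_out_arc[OF XO[OF k] b] ikb
          mor_out_arc[OF R.ds_mor(1)[OF S k] b, symmetric]])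
    also have "\<dots> = (if a = b then inc k (head Q b) else Zero C (at_head (X k) a) (at_head S b))"
      using t(2)[OF k] a b id_right[OF ikb] zero_right[OF ikb mor_objD(1)[OF ta]] by simp
    finally show "(at_arc S b \<cdot> s a) \<cdot> inc k (head Q a) = (if a = b then Ident C (at_head S a)
        else Zero C (at_head S a) (at_head S b)) \<cdot> inc k (head Q a)"
      using id_left[OF ik] zero_left[OF ik hb] by auto
  qed
  then show "\<exists>s. arc_sections S j s"
    using s(1) unfolding arc_sections_def by blast
qed

text \<open>
  Sections of the arc maps of \<open>V\<close>, conjugated by \<open>i\<close> and \<open>r\<close>, are sections for \<open>M\<close>, since \<open>i\<close> and \<open>r\<close>
  commute with the arcs.
\<close>

lemma cofree_retract:
  assumes M: "retract R M V i r" and V: "cofree V" shows "cofree M"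
  unfolding cofree_def
proof (intro conjI ballI)
  have i: "mor R M V i" and r: "mor R V M r" and ri: "r \<odot> i = Ident R M" using M by (auto simp: retract_def)
  have riv: "r j \<cdot> i j = Ident C (at_vert M j)" if "j \<in> verts Q" for j using fun_cong[OF ri, of j] that by simp
  show MO: "M \<in> Obj R" using mor_obj(1)[OF i] .
  have VO: "V \<in> Obj R" using V by (simp add: cofree_def)
  fix j assume j: "j \<in> verts Q"
  have "retract C (at_vert M j) (at_vert V j) (i j) (r j)"
    using mor_vert[OF i j] mor_vert[OF r j] riv[OF j] by (simp add: retract_def)
  then show "at_vert M j \<in> \<T>" using additive_retract[OF additive] V j by (auto simp: cofree_def)
  obtain t where t: "\<forall>a\<in>out_arcs Q j. mor C (at_head V a) (at_vert V j) (t a)"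
    "\<forall>a\<in>out_arcs Q j. \<forall>b\<in>out_arcs Q j. at_arc V b \<cdot> t a = (if a = b
         then Ident C (at_head V a) else Zero C (at_head V a) (at_head V b))"
    using V j unfolding cofree_def arc_sections_def by blast
  define s where "s a = r j \<cdot> (t a \<cdot> i (head Q a))" for a
  have ti: "mor C (at_head M a) (at_vert V j) (t a \<cdot> i (head Q a))" if a: "a \<in> out_arcs Q j" for a
    using mor_comp[OF mor_vert[OF i out_arcD(3)[OF a]]] t(1) a by blast
  have s: "mor C (at_head M a) (at_vert M j) (s a)" if a: "a \<in> out_arcs Q j" for a
    unfolding s_def using mor_comp[OF ti[OF a] mor_vert[OF r j]] .
  have "at_arc M b \<cdot> s a =
    (if a = b then Ident C (at_head M a) else Zero C (at_head M a) (at_head M b))"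
    if a: "a \<in> out_arcs Q j" and b: "b \<in> out_arcs Q j" for a b
  proof -
    note ia = mor_vert[OF i out_arcD(3)[OF a]] and rb = mor_vert[OF r out_arcD(3)[OF b]]
    have ta: "mor C (at_head V a) (at_vert V j) (t a)" using t(1) a by blast
    have e: "at_arc V b \<cdot> t a = (if a = b then Ident C (at_head V a) else Zero C (at_head V a) (at_head V b))"
      using t(2) a b by blast
    have "at_arc M b \<cdot> s a = r (head Q b) \<cdot> (at_arc V b \<cdot> (t a \<cdot> i (head Q a)))"
      unfolding s_def by (rule comp_square[OF ti[OF a] mor_vert[OF r j] obj_out_arc[OF MO b] obj_out_arc[OF VO b] rb
          mor_out_arc[OF r b, symmetric]])
    also have "\<dots> = r (head Q b) \<cdot> (if a = b then i (head Q a) else Zero C (at_head M a) (at_head V b))"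
      using comp_cong[OF ia ta obj_out_arc[OF VO b] e] id_left[OF ia] zero_left[OF ia obj_vert[OF VO out_arcD(3)[OF b]]] by auto
    also have "\<dots> = (if a = b then Ident C (at_head M a) else Zero C (at_head M a) (at_head M b))"
      using riv[OF out_arcD(3)[OF a]] zero_right[OF rb obj_vert[OF MO out_arcD(3)[OF a]]] by auto
    finally show ?thesis .
  qed
  then show "\<exists>s. arc_sections M j s"
    using s unfolding arc_sections_def by blast
qed

lemma add_generators_cofree:
  assumes "M \<in> \<T>\<^sub>Q" shows "cofree M"
proof -
  obtain n :: nat and G S inc prj i r where *: "direct_sum R {..<n} G S inc prj" "\<forall>k<n. G k \<in> generators" "retract R M S i r"
    using R.add_subcatD[OF assms] by blast
  have "cofree g" if "g \<in> generators" for g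
    using that by (elim CollectE exE conjE) (simp add: cofree_e_rho)
  then have "\<forall>k\<in>{..<n}. cofree (G k)" using *(2) by simp
  then show ?thesis using cofree_retract[OF *(3)] cofree_direct_sum[OF *(1)] by blast
qed

lemma cofree_split_vert:
  assumes M: "cofree M" and j: "j \<in> verts Q"
  shows "\<exists>K \<rho>. split_product (at_vert M j) (out_arcs Q j) (at_head M) (at_arc M) K \<rho>"
proof -
  have MO: "M \<in> Obj R" using M by (simp add: cofree_def)
  have v: "\<forall>a\<in>out_arcs Q j. mor C (at_vert M j) (at_head M a) (at_arc M a)" using obj_out_arc[OF MO] by blast
  obtain s where "arc_sections M j s" using M j unfolding cofree_def by blast
  then show ?thesis
    unfolding arc_sections_def by (intro sections_split[OF finite_out_arcs obj_vert[OF MO j] v]) auto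
qed

text \<open>
  A morphism to \<open>M\<close> is the same as a family of morphisms to the \<open>K j\<close>: the representation \<open>M\<close> is the
  value at \<open>K\<close> of the right adjoint of the functor that forgets the arcs.
\<close>

definition cofree_on :: "('v, 'a, 'o, 'm) rep \<Rightarrow> ('v \<Rightarrow> 'o) \<Rightarrow> ('v \<Rightarrow> 'm) \<Rightarrow> bool" where
  "cofree_on M K \<rho> \<longleftrightarrow> (\<forall>j\<in>verts Q. mor C (at_vert M j) (K j) (\<rho> j)) \<and>
    (\<forall>X f. X \<in> Obj R \<longrightarrow> (\<forall>j\<in>verts Q. mor C (at_vert X j) (K j) (f j)) \<longrightarrow>
      (\<exists>\<phi>. mor R X M \<phi> \<and> (\<forall>j\<in>verts Q. \<rho> j \<cdot> \<phi> j = f j))) \<and>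
    (\<forall>X \<phi> \<phi>'. mor R X M \<phi> \<longrightarrow> mor R X M \<phi>' \<longrightarrow> (\<forall>j\<in>verts Q. \<rho> j \<cdot> \<phi> j = \<rho> j \<cdot> \<phi>' j) \<longrightarrow> \<phi> = \<phi>')"

lemma cofree_on_mor: "cofree_on M K \<rho> \<Longrightarrow> j \<in> verts Q \<Longrightarrow> mor C (at_vert M j) (K j) (\<rho> j)"
  by (simp add: cofree_on_def)

lemma cofree_on_ex:
  assumes "cofree_on M K \<rho>" "X \<in> Obj R" "\<forall>j\<in>verts Q. mor C (at_vert X j) (K j) (f j)"
  shows "\<exists>\<phi>. mor R X M \<phi> \<and> (\<forall>j\<in>verts Q. \<rho> j \<cdot> \<phi> j = f j)"
  using assms unfolding cofree_on_def by blast

lemma cofree_on_eqI: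
  assumes "cofree_on M K \<rho>" "mor R X M \<phi>" "mor R X M \<phi>'" "\<And>j. j \<in> verts Q \<Longrightarrow> \<rho> j \<cdot> \<phi> j = \<rho> j \<cdot> \<phi>' j"
  shows "\<phi> = \<phi>'"
  using assms unfolding cofree_on_def by blast

text \<open>
  At each vertex, \<open>M\<close> is the product of the kernel \<open>K j\<close> of the arc map and of the values at the heads.
  The components of a morphism at the heads are known by recursion, and the one at \<open>K j\<close> is free.
\<close>

lemma cofree_cofree_on:
  assumes M: "cofree M"
  shows "\<exists>K \<rho>. (\<forall>j\<in>verts Q. K j \<in> \<T>) \<and> cofree_on M K \<rho>"
proof -
  have MO: "M \<in> Obj R" using M by (simp add: cofree_def)
  obtain K \<rho> where "\<And>j. j \<in> verts Q \<Longrightarrow> split_product (at_vert M j) (out_arcs Q j) (at_head M) (at_arc M) (K j) (\<rho> j)"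
    using cofree_split_vert[OF M] by metis
  then have ret: "\<And>j. j \<in> verts Q \<Longrightarrow> \<exists>k. retract C (K j) (at_vert M j) k (\<rho> j)"
    and ex: "\<And>j W f g. j \<in> verts Q \<Longrightarrow> mor C W (K j) f \<Longrightarrow> \<forall>a\<in>out_arcs Q j. mor C W (at_head M a) (g a) \<Longrightarrow>
      \<exists>h. mor C W (at_vert M j) h \<and> \<rho> j \<cdot> h = f \<and> (\<forall>a\<in>out_arcs Q j. at_arc M a \<cdot> h = g a)"
    and un: "\<And>j W h h'. j \<in> verts Q \<Longrightarrow> mor C W (at_vert M j) h \<Longrightarrow> mor C W (at_vert M j) h' \<Longrightarrow> \<rho> j \<cdot> h = \<rho> j \<cdot> h' \<Longrightarrow>
      \<forall>a\<in>out_arcs Q j. at_arc M a \<cdot> h = at_arc M a \<cdot> h' \<Longrightarrow> h = h'"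
    unfolding split_product_def by blast+
  have 1: "K j \<in> \<T> \<and> mor C (at_vert M j) (K j) (\<rho> j)" if j: "j \<in> verts Q" for j
  proof -
    obtain k where k: "retract C (K j) (at_vert M j) k (\<rho> j)" using ret[OF j] by blast
    have "at_vert M j \<in> \<T>" using M j by (simp add: cofree_def)
    then show ?thesis using additive_retract[OF additive k] k by (simp add: retract_def)
  qed
  have 2: "\<exists>\<phi>. mor R X M \<phi> \<and> (\<forall>j\<in>verts Q. \<rho> j \<cdot> \<phi> j = f j)"
    if X: "X \<in> Obj R" and f: "\<forall>j\<in>verts Q. mor C (at_vert X j) (K j) (f j)" for X f
  proof (rule mor_by_recursion[OF X MO])
    fix j \<psi> assume j: "j \<in> verts Q" and \<psi>: "\<forall>a\<in>out_arcs Q j.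
      mor C (at_head X a) (at_head M a) (\<psi> (head Q a)) \<and> \<rho> (head Q a) \<cdot> \<psi> (head Q a) = f (head Q a)"
    have "\<forall>a\<in>out_arcs Q j. mor C (at_vert X j) (at_head M a) (\<psi> (head Q a) \<cdot> at_arc X a)"
      using mor_comp[OF obj_out_arc[OF X]] \<psi> by blast
    from ex[OF j bspec[OF f j] this]
    show "\<exists>h. mor C (at_vert X j) (at_vert M j) h \<and> \<rho> j \<cdot> h = f j \<and>
      (\<forall>a\<in>out_arcs Q j. at_arc M a \<cdot> h = \<psi> (head Q a) \<cdot> at_arc X a)" .
  qed
  have 3: "\<phi> = \<phi>'" if \<phi>: "mor R X M \<phi>" and \<phi>': "mor R X M \<phi>'" and e: "\<forall>j\<in>verts Q. \<rho> j \<cdot> \<phi> j = \<rho> j \<cdot> \<phi>' j" for X \<phi> \<phi>'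
  proof (rule mor_eqI[OF \<phi> \<phi>'])
    fix j assume "j \<in> verts Q"
    then show "\<phi> j = \<phi>' j"
    proof (induction j rule: vertex_induct)
      case (vertex j)
      have "at_arc M a \<cdot> \<phi> j = at_arc M a \<cdot> \<phi>' j" if a: "a \<in> out_arcs Q j" for a
        using mor_out_arc[OF \<phi> a] mor_out_arc[OF \<phi>' a] vertex(2)[OF a] by simp
      then show ?case using un[OF vertex(1) mor_vert[OF \<phi> vertex(1)] mor_vert[OF \<phi>' vertex(1)]] e vertex(1) by blast
    qed
  qed
  show ?thesis unfolding cofree_on_def using 1 2 3 by (intro exI[of _ K] exI[of _ \<rho>]) blast
qed

lemma e_rho_sum:
  assumes K: "\<forall>j\<in>verts Q. K j \<in> \<T>"
  shows "\<exists>V inc prj. direct_sum R (verts Q) (\<lambda>j. e_rho Q C j (K j)) V inc prj \<and> V \<in> \<T>\<^sub>Q"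
proof -
  have "\<forall>j\<in>verts Q. e_rho Q C j (K j) \<in> Obj R" using e_rho_obj tilting_obj K by blast
  then obtain V inc prj where V: "direct_sum R (verts Q) (\<lambda>j. e_rho Q C j (K j)) V inc prj"
    using rep_direct_sum_exists[OF finite_verts, of "\<lambda>j. e_rho Q C j (K j)"] by blast
  have VO: "V \<in> Obj R" using R.ds_obj(1)[OF V] .
  have "retract R V V (Ident R V) (Ident R V)"
    using R.mor_id[OF VO] R.id_left[OF R.mor_id[OF VO]] by (simp add: retract_def)
  then have "V \<in> \<T>\<^sub>Q" by (rule R.add_subcatI[OF V, rotated]) (use K in blast)
  then show ?thesis using V by blast
qed

text \<open>
  Combine the adjunctions at the single vertices.
\<close>

lemma e_rho_sum_cofree_on:
  assumes K: "\<forall>j\<in>verts Q. K j \<in> \<T>"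
  shows "\<exists>V \<epsilon>. V \<in> \<T>\<^sub>Q \<and> V \<in> Obj R \<and> cofree_on V K \<epsilon>"
proof -
  have KO: "K j \<in> Obj C" if "j \<in> verts Q" for j using K that tilting_obj by blast
  obtain V inc prj where V: "direct_sum R (verts Q) (\<lambda>j. e_rho Q C j (K j)) V inc prj" and VT: "V \<in> \<T>\<^sub>Q"
    using e_rho_sum[OF K] by blast
  define \<epsilon> where "\<epsilon> j = ecounit j (K j) \<cdot> prj j j" for j
  note p = R.ds_mor(2)[OF V]
  have \<epsilon>_comp: "\<epsilon> j \<cdot> u j = ecounit j (K j) \<cdot> (prj j \<odot> u) j" if j: "j \<in> verts Q" and u: "mor R X V u" for j X u
    using assoc[OF mor_vert[OF u j] mor_vert[OF p[OF j] j] ecounit_mor[OF KO[OF j] j]] j by (simp add: \<epsilon>_def)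
  have "\<exists>\<phi>. mor R X V \<phi> \<and> (\<forall>j\<in>verts Q. \<epsilon> j \<cdot> \<phi> j = f j)"
    if X: "X \<in> Obj R" and f: "\<forall>j\<in>verts Q. mor C (at_vert X j) (K j) (f j)" for X f
  proof -
    have "\<exists>\<phi>. mor R X (e_rho Q C j (K j)) \<phi> \<and> ecounit j (K j) \<cdot> \<phi> j = f j" if j: "j \<in> verts Q" for j
      using e_rho_universal[OF X j] f j by blast
    then obtain \<phi> where \<phi>: "\<forall>j\<in>verts Q. mor R X (e_rho Q C j (K j)) (\<phi> j)" "\<forall>j\<in>verts Q. ecounit j (K j) \<cdot> \<phi> j j = f j" by metis
    obtain u where u: "mor R X V u" "\<forall>j\<in>verts Q. prj j \<odot> u = \<phi> j" using R.ds_pair[OF V X \<phi>(1)] by blast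
    then show ?thesis using \<phi>(2) \<epsilon>_comp[OF _ u(1)] by (intro exI[of _ u]) auto
  qed
  moreover have "\<phi> = \<phi>'" if \<phi>: "mor R X V \<phi>" and \<phi>': "mor R X V \<phi>'" and e: "\<forall>j\<in>verts Q. \<epsilon> j \<cdot> \<phi> j = \<epsilon> j \<cdot> \<phi>' j" for X \<phi> \<phi>'
  proof (rule R.ds_eq_prj[OF V \<phi> \<phi>'])
    fix j assume j: "j \<in> verts Q"
    show "prj j \<odot> \<phi> = prj j \<odot> \<phi>'"
      by (rule e_rho_unique[OF KO[OF j] j R.mor_comp[OF \<phi> p[OF j]] R.mor_comp[OF \<phi>' p[OF j]]])
        (use \<epsilon>_comp[OF j \<phi>] \<epsilon>_comp[OF j \<phi>'] e j in auto)
  qed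
  moreover have "mor C (at_vert V j) (K j) (\<epsilon> j)" if j: "j \<in> verts Q" for j
    unfolding \<epsilon>_def using mor_comp[OF mor_vert[OF p[OF j] j] ecounit_mor[OF KO[OF j] j]] .
  ultimately have "cofree_on V K \<epsilon>" unfolding cofree_on_def by blast
  then show ?thesis using VT R.ds_obj(1)[OF V] by blast
qed

text \<open>
  Both \<open>M\<close> and the sum of the \<open>e_rho Q C j (K j)\<close> are cofree on the same family \<open>K\<close>, so their
  universal properties give comparison morphisms, and \<open>M\<close> is a retract of the sum.
\<close>

lemma cofree_add_generators:
  assumes M: "cofree M" shows "M \<in> \<T>\<^sub>Q"
proof -
  have MO: "M \<in> Obj R" using M by (simp add: cofree_def)
  obtain K \<rho> where K: "\<forall>j\<in>verts Q. K j \<in> \<T>" and \<rho>: "cofree_on M K \<rho>" using cofree_cofree_on[OF M] by blast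
  obtain V \<epsilon> where V: "V \<in> \<T>\<^sub>Q" "V \<in> Obj R" and \<epsilon>: "cofree_on V K \<epsilon>" using e_rho_sum_cofree_on[OF K] by blast
  obtain \<phi> where \<phi>: "mor R M V \<phi>" "\<forall>j\<in>verts Q. \<epsilon> j \<cdot> \<phi> j = \<rho> j"
    using cofree_on_ex[OF \<epsilon> MO] cofree_on_mor[OF \<rho>] by blast
  obtain r where r: "mor R V M r" "\<forall>j\<in>verts Q. \<rho> j \<cdot> r j = \<epsilon> j"
    using cofree_on_ex[OF \<rho> V(2)] cofree_on_mor[OF \<epsilon>] by blast
  have "r \<odot> \<phi> = Ident R M"
  proof (rule cofree_on_eqI[OF \<rho> R.mor_comp[OF \<phi>(1) r(1)] R.mor_id[OF MO]])
    fix j assume j: "j \<in> verts Q"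
    note \<rho>j = cofree_on_mor[OF \<rho> j]
    show "\<rho> j \<cdot> (r \<odot> \<phi>) j = \<rho> j \<cdot> Ident R M j"
      using comp_cong[OF mor_vert[OF \<phi>(1) j] mor_vert[OF r(1) j] \<rho>j bspec[OF r(2) j]] \<phi>(2) j id_right[OF \<rho>j] by simp
  qed
  then have "retract R M V \<phi> r" using \<phi>(1) r(1) by (simp add: retract_def)
  then show ?thesis using R.additive_retract[OF R.additive_add_subcat _ V(1)] by blast
qed

text \<open>
  The values lie in \<open>Fac \<T>\<close>, and the arc map at each vertex is an epimorphism.  The latter is stated
  in terms of elements: a family of elements at the heads lifts to \<open>j\<close> after passing to a cover.
  In this form it feeds directly into \<open>lift_if_local_lift\<close>, and no direct sum has to be chosen.
\<close>

definition arc_epi :: "('v, 'a, 'o, 'm) rep \<Rightarrow> bool" where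
  "arc_epi X \<longleftrightarrow> X \<in> Obj R \<and> (\<forall>j\<in>verts Q. at_vert X j \<in> Fac C \<T> \<and>
    (\<forall>W x. W \<in> Obj C \<longrightarrow> (\<forall>a\<in>out_arcs Q j. mor C W (at_head X a) (x a)) \<longrightarrow>
      (\<exists>W' q y. epic C W' W q \<and> mor C W' (at_vert X j) y \<and> (\<forall>a\<in>out_arcs Q j. at_arc X a \<cdot> y = x a \<cdot> q))))"

text \<open>
  Elements at the heads of arcs are lifted locally from \<open>X\<close> to \<open>M\<close>, then to \<open>j\<close> by a section of
  the arc map of \<open>M\<close>, and mapped back to \<open>X\<close>.
\<close>

lemma arc_epi_quotient:
  assumes M: "cofree M" and e: "epic R M X e" shows "arc_epi X"
  unfolding arc_epi_def
proof (intro conjI ballI allI impI)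
  note em = R.epicD[OF e]
  have MO: "M \<in> Obj R" and XO: "X \<in> Obj R" using mor_obj[OF em] by auto
  show "X \<in> Obj R" by fact
  fix j assume j: "j \<in> verts Q"
  have "at_vert M j \<in> \<T>" using M j by (simp add: cofree_def)
  then show "at_vert X j \<in> Fac C \<T>" using rep_epic_vert[OF e j] by (auto simp: Fac_def)
  fix W x assume W: "W \<in> Obj C" and x: "\<forall>a\<in>out_arcs Q j. mor C W (at_head X a) (x a)"
  obtain W' q m where q: "epic C W' W q"
    and m: "\<forall>a\<in>out_arcs Q j. mor C W' (at_head M a) (m a) \<and> e (head Q a) \<cdot> m a = x a \<cdot> q"
    using joint_local_lift[OF finite_out_arcs W, of j "\<lambda>a. at_head M a" "\<lambda>a. at_head X a" "\<lambda>a. e (head Q a)" x]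
      rep_epic_vert[OF e out_arcD(3)] x by blast
  have W': "W' \<in> Obj C" using epicD[OF q] mor_objD by blast
  obtain K k \<rho> where "retract C K (at_vert M j) k \<rho>"
    and ex: "\<forall>W f g. mor C W K f \<longrightarrow> (\<forall>a\<in>out_arcs Q j. mor C W (at_head M a) (g a)) \<longrightarrow>
      (\<exists>h. mor C W (at_vert M j) h \<and> \<rho> \<cdot> h = f \<and> (\<forall>a\<in>out_arcs Q j. at_arc M a \<cdot> h = g a))"
    using cofree_split_vert[OF M j] unfolding split_product_def by blast
  then have "mor C W' K (Zero C W' K)" using mor_zero[OF W'] mor_objD by (auto simp: retract_def)
  then obtain h where h: "mor C W' (at_vert M j) h" "\<forall>a\<in>out_arcs Q j. at_arc M a \<cdot> h = m a" using ex m by blast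
  have "at_arc X a \<cdot> (e j \<cdot> h) = x a \<cdot> q" if a: "a \<in> out_arcs Q j" for a
  proof -
    have "at_arc X a \<cdot> (e j \<cdot> h) = e (head Q a) \<cdot> (at_arc M a \<cdot> h)"
      by (rule comp_square[OF h(1) mor_vert[OF em j] obj_out_arc[OF XO a] obj_out_arc[OF MO a] mor_vert[OF em out_arcD(3)[OF a]]
          mor_out_arc[OF em a, symmetric]])
    then show ?thesis using h(2) m a by simp
  qed
  then show "\<exists>W' q y. epic C W' W q \<and> mor C W' (at_vert X j) y \<and> (\<forall>a\<in>out_arcs Q j. at_arc X a \<cdot> y = x a \<cdot> q)"
    using q mor_comp[OF h(1) mor_vert[OF em j]] by blast
qed

text \<open>
  The arc map is an epimorphism between objects of \<open>Fac \<T>\<close>, which is closed under finite direct sums.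
  By the closure of \<open>Fac \<T>\<close> under kernels of epimorphisms, its kernel \<open>K\<close> is again in \<open>Fac \<T>\<close>.
\<close>

lemma arc_epi_kernel:
  assumes X: "arc_epi X" and j: "j \<in> verts Q"
  shows "\<exists>K k. K \<in> Fac C \<T> \<and> monic C K (at_vert X j) k \<and>
    (\<forall>a\<in>out_arcs Q j. at_arc X a \<cdot> k = Zero C K (at_head X a)) \<and>
    (\<forall>W h. mor C W (at_vert X j) h \<longrightarrow> (\<forall>a\<in>out_arcs Q j. at_arc X a \<cdot> h = Zero C W (at_head X a)) \<longrightarrow>
      (\<exists>u. mor C W K u \<and> k \<cdot> u = h))"
proof -
  have XO: "X \<in> Obj R" and Xj: "at_vert X j \<in> Fac C \<T>" using X j by (auto simp: arc_epi_def)
  have XF: "at_head X a \<in> Fac C \<T>" if "a \<in> out_arcs Q j" for a using X out_arcD(3)[OF that] by (simp add: arc_epi_def)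
  have v: "\<forall>a\<in>out_arcs Q j. mor C (at_vert X j) (at_head X a) (at_arc X a)" using obj_out_arc[OF XO] by blast
  have "at_head X a \<in> Obj C" if "a \<in> out_arcs Q j" for a using obj_vert[OF XO out_arcD(3)[OF that]] .
  then obtain B inc prj where B: "direct_sum C (out_arcs Q j) (\<lambda>a. at_head X a) B inc prj"
    using ex_direct_sum[OF finite_out_arcs, of j "\<lambda>a. at_head X a"] by metis
  have BF: "B \<in> Fac C \<T>" using Fac_direct_sum[OF additive B XF] .
  note BO = ds_obj(1)[OF B]
  obtain p where p: "mor C (at_vert X j) B p" "\<forall>a\<in>out_arcs Q j. prj a \<cdot> p = at_arc X a"
    using ds_pair[OF B obj_vert[OF XO j] v] by blast
  have "\<forall>a\<in>out_arcs Q j. mor C B (at_head X a) (prj a)" using ds_mor(2)[OF B] by blast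
  then obtain W' q y where q: "epic C W' B q" and y: "mor C W' (at_vert X j) y" "\<forall>a\<in>out_arcs Q j. at_arc X a \<cdot> y = prj a \<cdot> q"
    using X j BO unfolding arc_epi_def by blast
  have "p \<cdot> y = q"
  proof (rule ds_eq_prj[OF B mor_comp[OF y(1) p(1)] epicD[OF q]])
    fix a assume a: "a \<in> out_arcs Q j"
    show "prj a \<cdot> (p \<cdot> y) = prj a \<cdot> q" using comp_cong[OF y(1) p(1) ds_mor(2)[OF B a] bspec[OF p(2) a]] y(2) a by simp
  qed
  then have pe: "epic C (at_vert X j) B p" using epic_if_comp_epic[OF y(1) p(1)] q by simp
  obtain K k where k: "is_kernel C (at_vert X j) B p K k" using ex_kernel[OF p(1)] .
  note km = kernel_mor[OF k]
  have "K \<in> Fac C \<T>" using epi_kernels Xj BF pe k unfolding closed_under_epi_kernels_def by blast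
  moreover have "at_arc X a \<cdot> k = Zero C K (at_head X a)" if a: "a \<in> out_arcs Q j" for a
    using assoc[OF km(2) p(1) ds_mor(2)[OF B a]] p(2) a km(3) zero_right[OF ds_mor(2)[OF B a] mor_objD(1)[OF km(2)]] by simp
  moreover have "\<exists>u. mor C W K u \<and> k \<cdot> u = h" if h: "mor C W (at_vert X j) h"
    and z: "\<forall>a\<in>out_arcs Q j. at_arc X a \<cdot> h = Zero C W (at_head X a)" for W h
  proof -
    have W: "W \<in> Obj C" using h mor_objD by blast
    have "p \<cdot> h = Zero C W B"
    proof (rule ds_eq_prj[OF B mor_comp[OF h p(1)] mor_zero[OF W BO]])
      fix a assume a: "a \<in> out_arcs Q j"
      show "prj a \<cdot> (p \<cdot> h) = prj a \<cdot> Zero C W B"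
        using comp_cong[OF h p(1) ds_mor(2)[OF B a] bspec[OF p(2) a]] z a zero_right[OF ds_mor(2)[OF B a] W] by simp
    qed
    then show ?thesis using kernel_lift[OF k h] by blast
  qed
  ultimately show ?thesis using km(4) by blast
qed

text \<open>
  The lift \<open>s\<close> is built by recursion.  At a vertex \<open>j\<close> it has to satisfy \<open>p j \<cdot> s j = h j\<close> and to agree,
  along each arc \<open>a\<close> that starts at \<open>j\<close>, with the lift \<open>\<psi>\<close> already found at the head.  In terms of
  elements, choose \<open>y0\<close> over \<open>h j\<close>.  Its images under the arcs differ from the required elements by
  elements \<open>x a\<close> of \<open>X\<close>, since both lie over the same element of \<open>Z\<close>; as \<open>X\<close> has epimorphic arc maps,
  \<open>y0\<close> can be corrected by an element \<open>z\<close> of \<open>X\<close> at \<open>j\<close>.  So the equations are locally solvable.  The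
  homogeneous solutions are the kernel of the arc map of \<open>X\<close>, which lies in \<open>Fac \<T>\<close>, so that
  \<open>lift_if_local_lift\<close> applies.
\<close>

lemma lift_along_arc_epi:
  assumes X: "arc_epi X" and k: "is_kernel R E Z p X k" and p: "epic R E Z p"
    and M: "\<forall>j\<in>verts Q. at_vert M j \<in> \<T>" and h: "mor R M Z h"
  shows "\<exists>s. mor R M E s \<and> p \<odot> s = h"
proof -
  note pm = R.epicD[OF p] and km = R.kernel_mor(2)[OF k]
  have MO: "M \<in> Obj R" and EO: "E \<in> Obj R" and ZO: "Z \<in> Obj R" and XO: "X \<in> Obj R"
    using mor_obj[OF h] mor_obj[OF pm] mor_obj[OF km] by auto
  have "\<exists>s. mor R M E s \<and> (\<forall>j\<in>verts Q. p j \<cdot> s j = h j)"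
  proof (rule mor_by_recursion[OF MO EO])
    fix j \<psi> assume j: "j \<in> verts Q"
      and \<psi>0: "\<forall>a\<in>out_arcs Q j. mor C (at_head M a) (at_head E a) (\<psi> (head Q a)) \<and>
        p (head Q a) \<cdot> \<psi> (head Q a) = h (head Q a)"
    then have \<psi>: "mor C (at_head M a) (at_head E a) (\<psi> (head Q a))"
      "p (head Q a) \<cdot> \<psi> (head Q a) = h (head Q a)" if "a \<in> out_arcs Q j" for a using that by auto
    note pj = mor_vert[OF pm j] and kj = mor_vert[OF km j] and hj = mor_vert[OF h j]
    note Ea = obj_out_arc[OF EO] and Xa = obj_out_arc[OF XO] and Ma = obj_out_arc[OF MO] and Za = obj_out_arc[OF ZO]
    have ph: "mor C (at_head E a) (at_head Z a) (p (head Q a))"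
      and kh: "mor C (at_head X a) (at_head E a) (k (head Q a))"
      and hh: "mor C (at_head M a) (at_head Z a) (h (head Q a))" if "a \<in> out_arcs Q j" for a
      using mor_vert[OF pm] mor_vert[OF km] mor_vert[OF h] out_arcD(3)[OF that] by auto
    note kerj = rep_kernel_vert[OF k j]
    have kera: "is_kernel C (at_head E a) (at_head Z a) (p (head Q a)) (at_head X a) (k (head Q a))"
      if "a \<in> out_arcs Q j" for a using rep_kernel_vert[OF k out_arcD(3)[OF that]] .
    obtain K \<kappa> where KF: "K \<in> Fac C \<T>" and \<kappa>: "monic C K (at_vert X j) \<kappa>"
      and \<kappa>0: "\<forall>a\<in>out_arcs Q j. at_arc X a \<cdot> \<kappa> = Zero C K (at_head X a)"
      and \<kappa>u: "\<forall>W h. mor C W (at_vert X j) h \<longrightarrow> (\<forall>a\<in>out_arcs Q j. at_arc X a \<cdot> h = Zero C W (at_head X a)) \<longrightarrow>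
        (\<exists>u. mor C W K u \<and> \<kappa> \<cdot> u = h)" using arc_epi_kernel[OF X j] by blast
    note \<kappa>m = monicD[OF \<kappa>]
    have KO: "K \<in> Obj C" using \<kappa>m mor_objD by blast
    \<comment> \<open>The index \<open>None\<close> stands for the equation over \<open>Z\<close>, and \<open>Some a\<close> for the one along the arc \<open>a\<close>.\<close>
    let ?I = "insert None (Some ` out_arcs Q j)"
    let ?Y = "\<lambda>c. case c of None \<Rightarrow> at_vert Z j | Some a \<Rightarrow> at_head E a"
    let ?D = "\<lambda>c. case c of None \<Rightarrow> p j | Some a \<Rightarrow> at_arc E a"
    let ?t = "\<lambda>c. case c of None \<Rightarrow> h j | Some a \<Rightarrow> \<psi> (head Q a) \<cdot> at_arc M a"
    have D: "mor C (at_vert E j) (?Y c) (?D c)" if "c \<in> ?I" for c using that pj Ea by auto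
    have t: "mor C (at_vert M j) (?Y c) (?t c)" if "c \<in> ?I" for c using that hj mor_comp[OF Ma \<psi>(1)] by auto
    have kk: "monic C K (at_vert E j) (k j \<cdot> \<kappa>)" using monic_comp[OF \<kappa> kernel_mor(4)[OF kerj]] .
    have Dk: "?D c \<cdot> (k j \<cdot> \<kappa>) = Zero C K (?Y c)" if c: "c \<in> ?I" for c
    proof (cases c)
      case None
      then show ?thesis using comp_cong[OF \<kappa>m kj pj kernel_mor(3)[OF kerj]] zero_left[OF \<kappa>m mor_objD(2)[OF pj]] by simp
    next
      case (Some a)
      then have a: "a \<in> out_arcs Q j" using c by auto
      have "at_arc E a \<cdot> (k j \<cdot> \<kappa>) = k (head Q a) \<cdot> (at_arc X a \<cdot> \<kappa>)"
        by (rule comp_square[OF \<kappa>m kj Ea[OF a] Xa[OF a] kh[OF a] mor_out_arc[OF km a, symmetric]])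
      then show ?thesis using Some \<kappa>0 a zero_right[OF kh[OF a] KO] by simp
    qed
    have univ: "\<exists>u. mor C W K u \<and> (k j \<cdot> \<kappa>) \<cdot> u = g" if g: "mor C W (at_vert E j) g"
      and z: "\<And>c. c \<in> ?I \<Longrightarrow> ?D c \<cdot> g = Zero C W (?Y c)" for W g
    proof -
      have W: "W \<in> Obj C" using g mor_objD by blast
      have "p j \<cdot> g = Zero C W (at_vert Z j)" using z[of None] by simp
      then obtain u where u: "mor C W (at_vert X j) u" "k j \<cdot> u = g" using kernel_lift[OF kerj g] by blast
      have "at_arc X a \<cdot> u = Zero C W (at_head X a)" if a: "a \<in> out_arcs Q j" for a
      proof (rule monic_zero[OF kernel_mor(4)[OF kera[OF a]] mor_comp[OF u(1) Xa[OF a]]])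
        have "k (head Q a) \<cdot> (at_arc X a \<cdot> u) = at_arc E a \<cdot> (k j \<cdot> u)"
          by (rule comp_square[OF u(1) Xa[OF a] kh[OF a] kj Ea[OF a] mor_out_arc[OF km a]])
        then show "k (head Q a) \<cdot> (at_arc X a \<cdot> u) = Zero C W (at_head E a)" using u(2) z[of "Some a"] a by simp
      qed
      then obtain w where w: "mor C W K w" "\<kappa> \<cdot> w = u" using \<kappa>u u(1) by blast
      then show ?thesis using assoc[OF w(1) \<kappa>m kj] u(2) by auto
    qed
    obtain M' q y0 where q: "epic C M' (at_vert M j) q" and y0: "mor C M' (at_vert E j) y0" "p j \<cdot> y0 = h j \<cdot> q"
      using epic_pullback[OF rep_epic_vert[OF p j] hj] .
    note qm = epicD[OF q]
    have M'O: "M' \<in> Obj C" using qm mor_objD by blast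
    have "\<exists>x. mor C M' (at_head X a) x \<and>
      Plus C (k (head Q a) \<cdot> x) (at_arc E a \<cdot> y0) = (\<psi> (head Q a) \<cdot> at_arc M a) \<cdot> q" if a: "a \<in> out_arcs Q j" for a
    proof -
      have l: "mor C M' (at_head E a) ((\<psi> (head Q a) \<cdot> at_arc M a) \<cdot> q)"
        using mor_comp[OF qm mor_comp[OF Ma[OF a] \<psi>(1)[OF a]]] .
      have r: "mor C M' (at_head E a) (at_arc E a \<cdot> y0)" using mor_comp[OF y0(1) Ea[OF a]] .
      obtain d where d: "mor C M' (at_head E a) d" "Plus C d (at_arc E a \<cdot> y0) = (\<psi> (head Q a) \<cdot> at_arc M a) \<cdot> q"
        and dz: "\<forall>Z h. mor C (at_head E a) Z h \<longrightarrow> (h \<cdot> d = Zero C M' Z \<longleftrightarrow> h \<cdot> ((\<psi> (head Q a) \<cdot> at_arc M a) \<cdot> q) = h \<cdot> (at_arc E a \<cdot> y0))"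
        using difference[OF l r] by blast
      have "p (head Q a) \<cdot> ((\<psi> (head Q a) \<cdot> at_arc M a) \<cdot> q) = p (head Q a) \<cdot> (\<psi> (head Q a) \<cdot> (at_arc M a \<cdot> q))"
        using assoc[OF qm Ma[OF a] \<psi>(1)[OF a]] by simp
      also have "\<dots> = h (head Q a) \<cdot> (at_arc M a \<cdot> q)" by (rule comp_cong[OF mor_comp[OF qm Ma[OF a]] \<psi>(1)[OF a] ph[OF a] \<psi>(2)[OF a]])
      also have "\<dots> = at_arc Z a \<cdot> (h j \<cdot> q)" by (rule comp_square[OF qm Ma[OF a] hh[OF a] hj Za[OF a] mor_out_arc[OF h a]])
      also have "\<dots> = p (head Q a) \<cdot> (at_arc E a \<cdot> y0)"
        using comp_square[OF y0(1) pj Za[OF a] Ea[OF a] ph[OF a] mor_out_arc[OF pm a, symmetric]] y0(2) by simp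
      finally have "p (head Q a) \<cdot> d = Zero C M' (at_head Z a)" using dz ph[OF a] by blast
      then obtain x where "mor C M' (at_head X a) x" "k (head Q a) \<cdot> x = d" using kernel_lift[OF kera[OF a] d(1)] by blast
      then show ?thesis using d by blast
    qed
    then obtain x where x: "\<forall>a\<in>out_arcs Q j. mor C M' (at_head X a) (x a)"
      and xd: "\<forall>a\<in>out_arcs Q j. Plus C (k (head Q a) \<cdot> x a) (at_arc E a \<cdot> y0) = (\<psi> (head Q a) \<cdot> at_arc M a) \<cdot> q" by metis
    obtain M'' q' z where q': "epic C M'' M' q'" and z: "mor C M'' (at_vert X j) z" "\<forall>a\<in>out_arcs Q j. at_arc X a \<cdot> z = x a \<cdot> q'"
      using X j M'O x unfolding arc_epi_def by blast
    note qm' = epicD[OF q']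
    note kz = mor_comp[OF z(1) kj] and yq = mor_comp[OF qm' y0(1)]
    \<comment> \<open>The correction of \<open>y0\<close> by an element of \<open>X\<close>.\<close>
    define y where "y = Plus C (k j \<cdot> z) (y0 \<cdot> q')"
    have ym: "mor C M'' (at_vert E j) y" unfolding y_def using mor_plus[OF kz yq] .
    have Dy: "?D c \<cdot> y = ?t c \<cdot> (q \<cdot> q')" if c: "c \<in> ?I" for c
    proof (cases c)
      case None
      have "p j \<cdot> (k j \<cdot> z) = Zero C M'' (at_vert Z j)"
        using comp_cong[OF z(1) kj pj kernel_mor(3)[OF kerj]] zero_left[OF z(1) mor_objD(2)[OF pj]] by simp
      moreover have "p j \<cdot> (y0 \<cdot> q') = h j \<cdot> (q \<cdot> q')" by (rule comp_square[OF qm' y0(1) pj qm hj y0(2)])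
      ultimately show ?thesis
        using None plus_right[OF kz yq pj] plus_zero[OF mor_comp[OF mor_comp[OF qm' qm] hj]] by (simp add: y_def)
    next
      case (Some a)
      then have a: "a \<in> out_arcs Q j" using c by auto
      have da: "Plus C (k (head Q a) \<cdot> x a) (at_arc E a \<cdot> y0) = (\<psi> (head Q a) \<cdot> at_arc M a) \<cdot> q" using xd a by blast
      have xa: "mor C M' (at_head X a) (x a)" using x a by blast
      have "at_arc E a \<cdot> (k j \<cdot> z) = k (head Q a) \<cdot> (at_arc X a \<cdot> z)"
        by (rule comp_square[OF z(1) kj Ea[OF a] Xa[OF a] kh[OF a] mor_out_arc[OF km a, symmetric]])
      also have "\<dots> = (k (head Q a) \<cdot> x a) \<cdot> q'" using bspec[OF z(2) a] assoc[OF qm' xa kh[OF a]] by simp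
      finally have "at_arc E a \<cdot> y = Plus C ((k (head Q a) \<cdot> x a) \<cdot> q') ((at_arc E a \<cdot> y0) \<cdot> q')"
        using plus_right[OF kz yq Ea[OF a]] assoc[OF qm' y0(1) Ea[OF a]] by (simp add: y_def)
      also have "\<dots> = ((\<psi> (head Q a) \<cdot> at_arc M a) \<cdot> q) \<cdot> q'" 
        using plus_left[OF qm' mor_comp[OF xa kh[OF a]] mor_comp[OF y0(1) Ea[OF a]]] da by simp
      also have "\<dots> = (\<psi> (head Q a) \<cdot> at_arc M a) \<cdot> (q \<cdot> q')" using assoc[OF qm' qm mor_comp[OF Ma[OF a] \<psi>(1)[OF a]]] .
      finally show ?thesis using Some by simp
    qed
    have fin: "finite ?I" using finite_out_arcs by simp
    have ext: "Ext1_vanishes C (at_vert M j) K" using tilting_Ext1_Fac[OF tilting _ KF] M j by blast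
    have "\<exists>s. mor C (at_vert M j) (at_vert E j) s \<and> (\<forall>c\<in>?I. ?D c \<cdot> s = ?t c)"
      by (rule lift_if_local_lift[OF fin D t kk Dk univ ext epic_comp[OF q' q] ym Dy])
    then obtain s where s: "mor C (at_vert M j) (at_vert E j) s" "\<forall>c\<in>?I. ?D c \<cdot> s = ?t c" by blast
    have "p j \<cdot> s = h j" using s(2) by simp
    moreover have "at_arc E a \<cdot> s = \<psi> (head Q a) \<cdot> at_arc M a" if "a \<in> out_arcs Q j" for a
      using s(2) that by simp
    ultimately show "\<exists>f. mor C (at_vert M j) (at_vert E j) f \<and> p j \<cdot> f = h j \<and>
      (\<forall>a\<in>out_arcs Q j. at_arc E a \<cdot> f = \<psi> (head Q a) \<cdot> at_arc M a)" using s(1) by blast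
  qed
  then obtain s where s: "mor R M E s" "\<forall>j\<in>verts Q. p j \<cdot> s j = h j" by blast
  have "p \<odot> s = h" by (rule mor_eqI[OF R.mor_comp[OF s(1) pm] h]) (use s(2) in auto)
  then show ?thesis using s(1) by blast
qed

lemma Ext1_vanishes_cofree_arc_epi:
  assumes M: "cofree M" and X: "arc_epi X" shows "Ext1_vanishes R M X"
proof (rule R.Ext1_vanishesI)
  show MO: "M \<in> Obj R" using M by (simp add: cofree_def)
  show "X \<in> Obj R" using X by (simp add: arc_epi_def)
  fix E i p assume "is_kernel R E M p X i" "epic R E M p"
  then show "\<exists>s. mor R M E s \<and> p \<odot> s = Ident R M"
    using lift_along_arc_epi[OF X _ _ _ R.mor_id[OF MO]] M by (simp add: cofree_def)
qed

lemma Fac_obj_arc_epi: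
  assumes M: "cofree M" and Y: "Y \<in> Fac_obj R M" shows "arc_epi Y"
proof -
  obtain Xs S e where Xs: "set Xs \<subseteq> {M}" "is_dsum R Xs S" and e: "epic R S Y e"
    using Y by (auto simp: Fac_obj_def Fac_def direct_sums_def)
  obtain inc prj where d: "direct_sum R {..<length Xs} (\<lambda>k. Xs ! k) S inc prj" using Xs(2) by (auto simp: is_dsum_def)
  have "\<forall>k\<in>{..<length Xs}. Xs ! k = M" using Xs(1) nth_mem by blast
  then have "cofree S" using cofree_direct_sum[OF d] M by simp
  then show ?thesis using arc_epi_quotient e by blast
qed

text \<open>
  It is enough to approximate \<open>X\<close> by the generators, since a morphism from a retract of a direct sum of
  generators can be factored on each summand.  There are finitely many vertices, and the sum of the
  approximations at the single vertices serves all generators at once.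
\<close>

lemma add_generators_contravariantly_finite: "contravariantly_finite R \<T>\<^sub>Q"
  unfolding contravariantly_finite_def
proof
  fix X assume X: "X \<in> Obj R"
  have cf: "contravariantly_finite C \<T>" using tilting by (simp add: support_tau_tilting_def)
  have To: "\<T> \<subseteq> Obj C" using tilting_obj by blast
  define apx where "apx i T \<epsilon> \<longleftrightarrow> T \<in> \<T> \<and> mor R (e_rho Q C i T) X \<epsilon> \<and> (\<forall>T'\<in>\<T>. \<forall>\<psi>. mor R (e_rho Q C i T') X \<psi> \<longrightarrow>
    (\<exists>u. mor R (e_rho Q C i T') (e_rho Q C i T) u \<and> \<epsilon> \<odot> u = \<psi>))" for i T \<epsilon>
  have "\<exists>T \<epsilon>. apx i T \<epsilon>" if "i \<in> verts Q" for i
    unfolding apx_def by (rule e_rho_right_approximation[OF X that cf To])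
  then obtain T \<epsilon> where "\<And>i. i \<in> verts Q \<Longrightarrow> apx i (T i) (\<epsilon> i)" by metis
  then have T: "\<forall>i\<in>verts Q. T i \<in> \<T>" and \<epsilon>: "\<forall>i\<in>verts Q. mor R (e_rho Q C i (T i)) X (\<epsilon> i)"
    and app: "\<And>i T' \<psi>. i \<in> verts Q \<Longrightarrow> T' \<in> \<T> \<Longrightarrow> mor R (e_rho Q C i T') X \<psi> \<Longrightarrow>
      \<exists>u. mor R (e_rho Q C i T') (e_rho Q C i (T i)) u \<and> \<epsilon> i \<odot> u = \<psi>"
    unfolding apx_def by blast+
  obtain V inc prj where V: "direct_sum R (verts Q) (\<lambda>j. e_rho Q C j (T j)) V inc prj" and VT: "V \<in> \<T>\<^sub>Q"
    using e_rho_sum[OF T] by blast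
  obtain v where v: "mor R V X v" "\<forall>i\<in>verts Q. v \<odot> inc i = \<epsilon> i" using R.ds_copair[OF V X \<epsilon>] by blast
  have gen: "\<exists>w. mor R G V w \<and> v \<odot> w = g" if G: "G \<in> generators" and g: "mor R G X g" for G g
  proof -
    obtain i T' where G': "G = e_rho Q C i T'" "i \<in> verts Q" "T' \<in> \<T>" using G by blast
    obtain u where u: "mor R G (e_rho Q C i (T i)) u" "\<epsilon> i \<odot> u = g" using app[OF G'(2,3)] g G'(1) by blast
    note ii = R.ds_mor(1)[OF V G'(2)]
    have "v \<odot> (inc i \<odot> u) = g" using R.comp_cong[OF u(1) ii v(1) bspec[OF v(2) G'(2)]] u(2) by simp
    then show ?thesis using R.mor_comp[OF u(1) ii] by blast
  qed
  have "\<exists>u\<in>Hom R M V. v \<odot> u = h" if M: "M \<in> \<T>\<^sub>Q" and h: "h \<in> Hom R M X" for M h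
  proof -
    obtain n :: nat and G S incS prjS i r where S: "direct_sum R {..<n} G S incS prjS"
      and G: "\<forall>k<n. G k \<in> generators" and ir: "retract R M S i r" using R.add_subcatD[OF M] by blast
    have i: "mor R M S i" and r: "mor R S M r" and ri: "r \<odot> i = Ident R M" using ir by (auto simp: retract_def)
    have h: "mor R M X h" using h mor_obj[OF i] X by (simp add: mor_def)
    have "\<exists>w. mor R (G k) V w \<and> v \<odot> w = (h \<odot> r) \<odot> incS k" if k: "k < n" for k
      using gen[OF G[rule_format, OF k] R.mor_comp[OF R.ds_mor(1)[OF S] R.mor_comp[OF r h]]] k by simp
    then obtain w where w: "\<forall>k\<in>{..<n}. mor R (G k) V (w k)" "\<forall>k\<in>{..<n}. v \<odot> w k = (h \<odot> r) \<odot> incS k"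
      by (metis lessThan_iff)
    obtain u where u: "mor R S V u" "\<forall>k\<in>{..<n}. u \<odot> incS k = w k" using R.ds_copair[OF S R.ds_obj(1)[OF V] w(1)] by blast
    have "v \<odot> u = h \<odot> r"
      by (rule R.ds_eq_inc[OF S R.mor_comp[OF u(1) v(1)] R.mor_comp[OF r h]])
        (use R.assoc[OF R.ds_mor(1)[OF S] u(1) v(1)] u(2) w(2) in auto)
    then have "v \<odot> (u \<odot> i) = h"
      using R.comp_square[OF i u(1) v(1) r h] ri R.id_right[OF h] by simp
    then show ?thesis using R.mor_comp[OF i u(1)] unfolding mor_def by blast
  qed
  then have "right_approximation R \<T>\<^sub>Q X V v" using VT v(1) unfolding right_approximation_def mor_def by blast
  then show "\<exists>V v. right_approximation R \<T>\<^sub>Q X V v" by blast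
qed

text \<open>
  The identity of the direct sum \<open>B\<close> of the values at the heads lifts along the arc map: \<open>B\<close> lies in
  \<open>\<T>\<close> and the kernel of the arc map lies in \<open>Fac \<T>\<close>.
\<close>

lemma cofree_if_arc_epi:
  assumes X: "arc_epi X" and XT: "\<forall>j\<in>verts Q. at_vert X j \<in> \<T>" shows "cofree X"
  unfolding cofree_def
proof (intro conjI ballI)
  show XO: "X \<in> Obj R" using X by (simp add: arc_epi_def)
  fix j assume j: "j \<in> verts Q"
  show "at_vert X j \<in> \<T>" using XT j by blast
  have Xh: "at_head X a \<in> \<T>" if "a \<in> out_arcs Q j" for a using XT out_arcD(3)[OF that] by blast
  obtain B inc prj where B: "direct_sum C (out_arcs Q j) (\<lambda>a. at_head X a) B inc prj"
    using ex_direct_sum[OF finite_out_arcs, of j "\<lambda>a. at_head X a"] tilting_obj[OF Xh] by metis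
  have BT: "B \<in> \<T>" using additive_sum[OF additive B Xh] .
  obtain K \<kappa> where KF: "K \<in> Fac C \<T>" and \<kappa>: "monic C K (at_vert X j) \<kappa>"
      and \<kappa>0: "\<forall>a\<in>out_arcs Q j. at_arc X a \<cdot> \<kappa> = Zero C K (at_head X a)"
      and \<kappa>u: "\<forall>W h. mor C W (at_vert X j) h \<longrightarrow> (\<forall>a\<in>out_arcs Q j. at_arc X a \<cdot> h = Zero C W (at_head X a)) \<longrightarrow>
        (\<exists>u. mor C W K u \<and> \<kappa> \<cdot> u = h)" using arc_epi_kernel[OF X j] by blast
  have pB: "\<forall>a\<in>out_arcs Q j. mor C B (at_head X a) (prj a)" using ds_mor(2)[OF B] by blast
  then obtain W q y where q: "epic C W B q" and y: "mor C W (at_vert X j) y" "\<forall>a\<in>out_arcs Q j. at_arc X a \<cdot> y = prj a \<cdot> q"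
    using X j ds_obj(1)[OF B] unfolding arc_epi_def by blast
  have "\<exists>s. mor C B (at_vert X j) s \<and> (\<forall>a\<in>out_arcs Q j. at_arc X a \<cdot> s = prj a)"
    by (rule lift_if_local_lift[OF finite_out_arcs obj_out_arc[OF XO] bspec[OF pB] \<kappa> bspec[OF \<kappa>0] _ tilting_Ext1_Fac[OF tilting BT KF]
        q y(1) bspec[OF y(2)]]) (use \<kappa>u in blast)+
  then obtain s where s: "mor C B (at_vert X j) s" "\<forall>a\<in>out_arcs Q j. at_arc X a \<cdot> s = prj a" by blast
  have "mor C (at_head X a) (at_vert X j) (s \<cdot> inc a)" if a: "a \<in> out_arcs Q j" for a
    using mor_comp[OF ds_mor(1)[OF B a] s(1)] .
  moreover have "at_arc X b \<cdot> (s \<cdot> inc a) =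
      (if a = b then Ident C (at_head X a) else Zero C (at_head X a) (at_head X b))"
    if a: "a \<in> out_arcs Q j" and b: "b \<in> out_arcs Q j" for a b
    using comp_cong[OF ds_mor(1)[OF B a] s(1) obj_out_arc[OF XO b] bspec[OF s(2) b]] ds_prj_inc[OF B b a] by auto
  ultimately show "\<exists>s. arc_sections X j s"
    unfolding arc_sections_def by (intro exI[of _ "\<lambda>a. s \<cdot> inc a"]) blast
qed

text \<open>
  Left approximations \<open>f i\<close> of the values of \<open>P\<close> by \<open>T i\<close> define \<open>F\<close> from \<open>P\<close> to the cofree
  representation \<open>V\<close> on \<open>T\<close>.  A morphism from \<open>P\<close> to a cofree \<open>M\<close> is a family of morphisms to the
  cofree coordinates \<open>K j\<close> of \<open>M\<close>, which lie in \<open>\<T>\<close>; these factor through the \<open>f j\<close>.  Moreover each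
  component of \<open>F\<close> is itself a left \<open>\<T>\<close>-approximation, because \<open>f j\<close> factors through it.
\<close>

lemma add_generators_left_approximation:
  assumes P: "projective R P"
  shows "\<exists>V\<in>\<T>\<^sub>Q. \<exists>W\<in>\<T>\<^sub>Q. \<exists>f g. left_approximation R \<T>\<^sub>Q P V f \<and> exact_at R P V W f g \<and> epic R V W g"
proof -
  have PO: "P \<in> Obj R" using P by (simp add: projective_def)
  have "\<exists>T f. left_approximation C \<T> (at_vert P i) T f" if "i \<in> verts Q" for i
    using tilting projective_vert[OF P that] unfolding support_tau_tilting_def by blast
  then obtain T f where f: "\<And>i. i \<in> verts Q \<Longrightarrow> left_approximation C \<T> (at_vert P i) (T i) (f i)" by metis
  have T: "\<forall>i\<in>verts Q. T i \<in> \<T>" using f by (simp add: left_approximation_def)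
  have fm: "\<forall>i\<in>verts Q. mor C (at_vert P i) (T i) (f i)"
    using f T tilting_obj obj_vert[OF PO] unfolding left_approximation_def mor_def by blast
  have fl: "\<exists>u. mor C (T i) T' u \<and> u \<cdot> f i = h" if i: "i \<in> verts Q" and "T' \<in> \<T>" "mor C (at_vert P i) T' h" for i T' h
    using f[OF i] T i that tilting_obj unfolding left_approximation_def mor_def by blast
  obtain V \<epsilon> where VT: "V \<in> \<T>\<^sub>Q" and VO: "V \<in> Obj R" and V: "cofree_on V T \<epsilon>" using e_rho_sum_cofree_on[OF T] by blast
  note \<epsilon> = cofree_on_mor[OF V]
  note Vc = add_generators_cofree[OF VT]
  obtain F where F: "mor R P V F" "\<forall>j\<in>verts Q. \<epsilon> j \<cdot> F j = f j" using cofree_on_ex[OF V PO fm] by blast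
  have "\<exists>u\<in>Hom R V M. u \<odot> F = h" if M: "M \<in> \<T>\<^sub>Q" and h: "h \<in> Hom R P M" for M h
  proof -
    note Mc = add_generators_cofree[OF M]
    then have MO: "M \<in> Obj R" by (simp add: cofree_def)
    have h: "mor R P M h" using h MO PO by (simp add: mor_def)
    obtain K \<rho> where K: "\<forall>j\<in>verts Q. K j \<in> \<T>" and \<rho>: "cofree_on M K \<rho>" using cofree_cofree_on[OF Mc] by blast
    have "\<exists>u. mor C (T j) (K j) u \<and> u \<cdot> f j = \<rho> j \<cdot> h j" if j: "j \<in> verts Q" for j
      using fl[OF j _ mor_comp[OF mor_vert[OF h j] cofree_on_mor[OF \<rho> j]]] K j by blast
    then obtain u where u: "\<forall>j\<in>verts Q. mor C (T j) (K j) (u j)" "\<forall>j\<in>verts Q. u j \<cdot> f j = \<rho> j \<cdot> h j" by metis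
    have "\<forall>j\<in>verts Q. mor C (at_vert V j) (K j) (u j \<cdot> \<epsilon> j)" using mor_comp[OF \<epsilon>] u(1) by blast
    then obtain g where g: "mor R V M g" "\<forall>j\<in>verts Q. \<rho> j \<cdot> g j = u j \<cdot> \<epsilon> j"
      using cofree_on_ex[OF \<rho> VO, of "\<lambda>j. u j \<cdot> \<epsilon> j"] by blast
    have "\<rho> j \<cdot> (g \<odot> F) j = \<rho> j \<cdot> h j" if j: "j \<in> verts Q" for j
    proof -
      have uj: "mor C (T j) (K j) (u j)" using u(1) j by blast
      have "\<rho> j \<cdot> (g j \<cdot> F j) = u j \<cdot> (\<epsilon> j \<cdot> F j)"
        by (rule comp_square[OF mor_vert[OF F(1) j] mor_vert[OF g(1) j] cofree_on_mor[OF \<rho> j] \<epsilon>[OF j] uj bspec[OF g(2) j]])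
      then show ?thesis using F(2) u(2) j by simp
    qed
    then have "g \<odot> F = h" by (rule cofree_on_eqI[OF \<rho> R.mor_comp[OF F(1) g(1)] h])
    then show ?thesis using g(1) unfolding mor_def by blast
  qed
  then have left: "left_approximation R \<T>\<^sub>Q P V F" using VT F(1) unfolding left_approximation_def mor_def by blast
  obtain W c where c: "is_cokernel R P V F W c" using R.ex_cokernel[OF F(1)] .
  note cm = R.cokernel_mor[OF c]
  have "at_vert W j \<in> \<T>" if j: "j \<in> verts Q" for j
  proof (rule tilting_cokernel_left_approximation[OF tilting projective_vert[OF P j] _ rep_cokernel_vert[OF c j]])
    have VjT: "at_vert V j \<in> \<T>" using Vc j by (simp add: cofree_def)
    have "\<exists>u\<in>Hom C (at_vert V j) T'. u \<cdot> F j = h" if T': "T' \<in> \<T>" and h: "h \<in> Hom C (at_vert P j) T'" for T' h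
    proof -
      have "mor C (at_vert P j) T' h" using h tilting_obj[OF T'] obj_vert[OF PO j] by (simp add: mor_def)
      then obtain u where u: "mor C (T j) T' u" "u \<cdot> f j = h" using fl[OF j T'] by blast
      have "(u \<cdot> \<epsilon> j) \<cdot> F j = h" using assoc[OF mor_vert[OF F(1) j] \<epsilon>[OF j] u(1)] F(2) j u(2) by simp
      then show ?thesis using mor_comp[OF \<epsilon>[OF j] u(1)] unfolding mor_def by blast
    qed
    then show "left_approximation C \<T> (at_vert P j) (at_vert V j) (F j)"
      using VjT mor_vert[OF F(1) j] unfolding left_approximation_def mor_def by blast
  qed
  then have "cofree W" using cofree_if_arc_epi[OF arc_epi_quotient[OF Vc cm(4)]] by blast
  then have "W \<in> \<T>\<^sub>Q" by (rule cofree_add_generators)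
  then show ?thesis using VT left R.exact_at_cokernel[OF c] cm(4) by blast
qed

lemma add_generators_support_tau_tilting:
  assumes "enough_projectives C" shows "support_tau_tilting R \<T>\<^sub>Q"
  unfolding support_tau_tilting_def
proof (intro conjI ballI allI impI)
  fix M1 M2 Y assume "M1 \<in> \<T>\<^sub>Q" "M2 \<in> \<T>\<^sub>Q" "Y \<in> Fac_obj R M2"
  then show "Ext1_vanishes R M1 Y" using Ext1_vanishes_cofree_arc_epi Fac_obj_arc_epi add_generators_cofree by blast
qed (use abelian_Rep enough_projectives_Rep[OF assms] R.additive_add_subcat add_generators_contravariantly_finite add_generators_left_approximation in blast)+

end

theorem theorem1p5:
  fixes \<A> :: "('o, 'm) preadd_cat"
    and Q :: "('v, 'a) pre_digraph"
    and \<T> :: "'o set"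
  assumes "abelian_category \<A>" and "enough_projectives \<A>"
    and "fin_digraph Q" and "acyclic_quiver Q"
    and "support_tau_tilting \<A> \<T>"
    and "closed_under_epi_kernels \<A> (Fac \<A> \<T>)"
  shows "support_tau_tilting (Rep Q \<A>)
    (add_subcat (Rep Q \<A>) {e_rho Q \<A> i T | i T. i \<in> verts Q \<and> T \<in> \<T>})"
proof -
  have Q: "wf_digraph Q" using assms(3) by (rule fin_digraph.axioms)
  interpret tilting_rep \<A> Q \<T>
    by (intro tilting_rep.intro acyclic_quiver_rep.intro quiver_rep.intro quiver_rep_axioms.intro
        acyclic_quiver_rep_axioms.intro tilting_rep_axioms.intro assms Q acyclic_arc_rel
        fin_digraph.finite_verts fin_digraph.finite_arcs)
  show ?thesis by (rule add_generators_support_tau_tilting[OF assms(2)])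
qed

end
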